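(* Let $T$ be a minimal supercurrent of bidimension $(m,m)$ defined in a neighbourhood of the origin in $\mathbb{R}^n$. Then $$r\mapsto r^{-m}\int_{|x|<r}T\wedge\beta^m/m!$$ is nondecreasing (for those $r>0$ for which the ball $\{|x|<r\}$ is relatively compact in the neighbourhood where $T$ is defined).
   Context: Superforms: let $x=(x_1,\dots,x_n)$ be orthonormal coordinates on $\mathbb{R}^n$ and $\xi=(\xi_1,\dots,\xi_n)$ coordinates on a second copy of $\mathbb{R}^n$. A superform is a differential form $a=\sum a_{I,J}(x)\,dx_I\wedge d\xi_J$ on $\mathbb{R}^n_s=\mathbb{R}^n\oplus\mathbb{R}^n$ whose coefficients do not depend on $\xi$; it has bidegree $(p,q)$ if $|I|=p$, $|J|=q$. $J$ is the multiplicative operator on forms with $J(dx_i)=d\xi_i$, $J(d\xi_i)=-dx_i$; for $a$ of bidegree $(p,0)$ write $a^{\#}=J(a)$. Put $da=\sum \frac{\partial a_{I,J}}{\partial x_k}dx_k\wedge dx_I\wedge d\xi_J$. The superintegral of an $(n,n)$-form is $\int_{\mathbb{R}^n_s}a_0\,dx_1\wedge d\xi_1\wedge\dots\wedge dx_n\wedge d\xi_n=\int_{\mathbb{R}^n}a_0\,d\lambda$ ($\lambda$ Lebesgue measure). Supercurrents of bidegree $(p,q)$ (bidimension $(n-p,n-q)$) on an open set are the continuous linear functionals on smooth superforms of bidegree $(n-p,n-q)$ with compact support in $x$; equivalently superforms with distribution coefficients, acting by $T.\alpha=\int T\wedge\alpha$. In this setting the coefficients are at worst measures. A supercurrent of bidegree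 $(n,n)$ and order zero is identified with a measure on $\mathbb{R}^n$. The operator $d$ extends to supercurrents coefficientwise. $\beta=\sum_j dx_j\wedge d\xi_j$. A supercurrent $T$ of bidimension $(m,m)$ is (weakly) positive if $T.\alpha_1\wedge\alpha_1^{\#}\wedge\dots\wedge\alpha_m\wedge\alpha_m^{\#}\ge0$ for all compactly supported smooth $(1,0)$-forms $\alpha_j$; it is symmetric if $J(T)=T$. A positive symmetric supercurrent $T$ of bidimension $(m,m)$, $m\ge1$, is called minimal if $dT\wedge\beta^{m-1}=0$. *)

theory Defs
  imports "HOL-Analysis.Analysis"
begin

definition partial :: "'n::finite \<Rightarrow> (real^'n \<Rightarrow> real) \<Rightarrow> real^'n \<Rightarrow> real" where
  "partial k f x = deriv (\<lambda>t. f (x + t *\<^sub>R axis k 1)) 0"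

definition iter_partial :: "'n::finite list \<Rightarrow> (real^'n \<Rightarrow> real) \<Rightarrow> real^'n \<Rightarrow> real" where
  "iter_partial ks f = foldr partial ks f"

text \<open>\<open>C\<^sup>\<infinity>\<close>: all iterated partial derivatives exist and are (totally) differentiable,
  hence continuous, everywhere.\<close>

definition smooth :: "(real^'n::finite \<Rightarrow> real) \<Rightarrow> bool" where
  "smooth f \<longleftrightarrow> (\<forall>ks x. iter_partial ks f differentiable at x)"

text \<open>\<open>a x I J\<close> is the coefficient \<open>a\<^sub>I\<^sub>J(x)\<close> of \<open>dx\<^sub>I \<and> d\<xi>\<^sub>J\<close>, where
  \<open>dx\<^sub>I\<close> and \<open>d\<xi>\<^sub>J\<close> are the products in increasing order of the indices.\<close>

type_synonym 'n superform = "real^'n \<Rightarrow> 'n set \<Rightarrow> 'n set \<Rightarrow> real"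

definition has_bidegree :: "nat \<Rightarrow> nat \<Rightarrow> 'n::finite superform \<Rightarrow> bool" where
  "has_bidegree p q a \<longleftrightarrow> (\<forall>x I J. a x I J \<noteq> 0 \<longrightarrow> card I = p \<and> card J = q)"

definition sf_fun :: "(real^'n \<Rightarrow> real) \<Rightarrow> 'n::finite superform" where
  "sf_fun f = (\<lambda>x I J. if I = {} \<and> J = {} then f x else 0)"

definition sf_dx :: "'n \<Rightarrow> 'n::finite superform" where
  "sf_dx i = (\<lambda>x I J. if I = {i} \<and> J = {} then 1 else 0)"

definition sf_dxi :: "'n \<Rightarrow> 'n::finite superform" where
  "sf_dxi i = (\<lambda>x I J. if I = {} \<and> J = {i} then 1 else 0)"

definition sf_scale :: "real \<Rightarrow> 'n superform \<Rightarrow> 'n::finite superform" where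
  "sf_scale c a = (\<lambda>x I J. c * a x I J)"

text \<open>\<open>dx\<^sub>I \<and> dx\<^sub>K = shuffle_sign I K dx\<^sub>I\<^sub>\<union>\<^sub>K\<close> for disjoint \<open>I\<close>, \<open>K\<close>; the remaining sign in the
  product comes from moving \<open>dx\<^sub>K\<close> past \<open>d\<xi>\<^sub>J\<close> in \<open>dx\<^sub>I \<and> d\<xi>\<^sub>J \<and> dx\<^sub>K \<and> d\<xi>\<^sub>L\<close>, here with
  \<open>K = P - I\<close> and \<open>L = Q - J\<close>.\<close>

definition shuffle_sign :: "'n::linorder set \<Rightarrow> 'n set \<Rightarrow> real" where
  "shuffle_sign I K = (-1) ^ card {(i, k). i \<in> I \<and> k \<in> K \<and> k < i}"

definition sf_wedge ::
  "'n superform \<Rightarrow> 'n superform \<Rightarrow> 'n::{finite,linorder} superform" (infixr "\<and>\<^sub>s" 70) where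
  "a \<and>\<^sub>s b = (\<lambda>x P Q. \<Sum>I\<in>Pow P. \<Sum>J\<in>Pow Q.
     (-1) ^ (card J * card (P - I)) * shuffle_sign I (P - I) * shuffle_sign J (Q - J)
       * a x I J * b x (P - I) (Q - J))"

text \<open>\<open>sf_prod F m = F 0 \<and> \<dots> \<and> F (m - 1)\<close>\<close>

primrec sf_prod :: "(nat \<Rightarrow> 'n superform) \<Rightarrow> nat \<Rightarrow> 'n::{finite,linorder} superform" where
  "sf_prod F 0 = sf_fun (\<lambda>x. 1)"
| "sf_prod F (Suc k) = sf_prod F k \<and>\<^sub>s F k"

definition sf_power :: "'n superform \<Rightarrow> nat \<Rightarrow> 'n::{finite,linorder} superform" where
  "sf_power a m = sf_prod (\<lambda>_. a) m"

definition sf_beta :: "'n::{finite,linorder} superform" where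
  "sf_beta = (\<lambda>x I J. \<Sum>j\<in>UNIV. (sf_dx j \<and>\<^sub>s sf_dxi j) x I J)"

definition sf_d :: "'n superform \<Rightarrow> 'n::{finite,linorder} superform" where
  "sf_d a = (\<lambda>x P Q. \<Sum>k\<in>UNIV.
     (sf_dx k \<and>\<^sub>s (\<lambda>y I J. partial k (\<lambda>z. a z I J) y)) x P Q)"

text \<open>The multiplicative operator \<open>J\<close> with \<open>J(dx\<^sub>i) = d\<xi>\<^sub>i\<close> and \<open>J(d\<xi>\<^sub>i) = - dx\<^sub>i\<close>:
  \<open>J(dx\<^sub>L \<and> d\<xi>\<^sub>K) = (-1)\<^bsup>|K|\<^esup> d\<xi>\<^sub>L \<and> dx\<^sub>K = (-1)\<^bsup>|K| + |K||L|\<^esup> dx\<^sub>K \<and> d\<xi>\<^sub>L\<close>.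
  The lemmas below confirm that it has these properties.\<close>

definition sf_J :: "'n superform \<Rightarrow> 'n::finite superform" where
  "sf_J a = (\<lambda>x K L. (-1) ^ (card K + card K * card L) * a x L K)"

lemma sf_J_fun: "sf_J (sf_fun f) = sf_fun f"
  by (auto simp: sf_J_def sf_fun_def fun_eq_iff)

lemma sf_J_dx: "sf_J (sf_dx i) = sf_dxi i"
  by (auto simp: sf_J_def sf_dx_def sf_dxi_def fun_eq_iff)

lemma sf_J_dxi: "sf_J (sf_dxi i) = sf_scale (-1) (sf_dx i)"
  by (auto simp: sf_J_def sf_dx_def sf_dxi_def sf_scale_def fun_eq_iff)

lemma sf_J_wedge: "sf_J (a \<and>\<^sub>s b) = sf_J a \<and>\<^sub>s sf_J (b :: 'n::{finite,linorder} superform)"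
proof (intro ext)
  fix x :: "real^'n::{finite,linorder}" and P Q :: "'n set"
  have sgn: "(-1::real) ^ (card P + card P * card Q) * (-1) ^ (card J * card (Q - I))
      = (-1) ^ (card I * card (P - J)) * (-1) ^ (card J + card J * card I)
        * (-1) ^ (card (P - J) + card (P - J) * card (Q - I))"
    if "J \<subseteq> P" "I \<subseteq> Q" for I J
  proof -
    have P: "card P = card J + card (P - J)" and Q: "card Q = card I + card (Q - I)"
      using that by (auto simp: card_Diff_subset card_mono)
    show ?thesis
      unfolding P Q power_add[symmetric] minus_one_power_iff by auto
  qed
  have "sf_J (a \<and>\<^sub>s b) x P Q = (\<Sum>I\<in>Pow Q. \<Sum>J\<in>Pow P.
      ((-1) ^ (card P + card P * card Q) * (-1) ^ (card J * card (Q - I)))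
        * (shuffle_sign I (Q - I) * shuffle_sign J (P - J) * a x I J * b x (Q - I) (P - J)))"
    by (simp add: sf_J_def sf_wedge_def sum_distrib_left mult.assoc)
  also have "\<dots> = (\<Sum>I\<in>Pow Q. \<Sum>J\<in>Pow P.
      ((-1) ^ (card I * card (P - J)) * (-1) ^ (card J + card J * card I)
        * (-1) ^ (card (P - J) + card (P - J) * card (Q - I)))
        * (shuffle_sign I (Q - I) * shuffle_sign J (P - J) * a x I J * b x (Q - I) (P - J)))"
    by (intro sum.cong refl) (simp add: sgn)
  also have "\<dots> = (sf_J a \<and>\<^sub>s sf_J b) x P Q"
    unfolding sf_J_def sf_wedge_def
    by (subst sum.swap) (intro sum.cong refl, simp add: mult_ac)
  finally show "sf_J (a \<and>\<^sub>s b) x P Q = (sf_J a \<and>\<^sub>s sf_J b) x P Q" .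
qed

definition supported_in :: "(real^'n) set \<Rightarrow> 'n::finite superform \<Rightarrow> bool" where
  "supported_in K a \<longleftrightarrow> (\<forall>x I J. x \<notin> K \<longrightarrow> a x I J = 0)"

definition smooth_superform :: "'n::finite superform \<Rightarrow> bool" where
  "smooth_superform a \<longleftrightarrow> (\<forall>I J. smooth (\<lambda>x. a x I J))"

text \<open>Forms with compact support in the open set \<open>U\<close>, extended by zero to the whole space.\<close>

definition test_superform :: "(real^'n) set \<Rightarrow> nat \<Rightarrow> nat \<Rightarrow> 'n::finite superform \<Rightarrow> bool" where
  "test_superform U p q a \<longleftrightarrow> smooth_superform a \<and> has_bidegree p q a \<and>
     (\<exists>K. compact K \<and> K \<subseteq> U \<and> supported_in K a)"

text \<open>A supercurrent \<open>T\<close> is the functional \<open>\<alpha> \<mapsto> T.\<alpha> = \<integral> T \<and> \<alpha>\<close>; only its values on test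
  superforms of the complementary bidegree matter.\<close>

type_synonym 'n supercurrent = "'n superform \<Rightarrow> real"

definition test_tendsto ::
  "(real^'n) set \<Rightarrow> (nat \<Rightarrow> 'n superform) \<Rightarrow> 'n::finite superform \<Rightarrow> bool" where
  "test_tendsto U A a \<longleftrightarrow>
     (\<exists>K. compact K \<and> K \<subseteq> U \<and> supported_in K a \<and> (\<forall>j. supported_in K (A j))) \<and>
     (\<forall>I J ks. uniform_limit UNIV (\<lambda>j. iter_partial ks (\<lambda>x. A j x I J))
        (iter_partial ks (\<lambda>x. a x I J)) sequentially)"

text \<open>\<open>supercurrent U k l T\<close>: \<open>T\<close> is a supercurrent of bidimension \<open>(k, l)\<close> on \<open>U\<close>, i.e. of
  bidegree \<open>(n - k, n - l)\<close>. For linear functionals on the LF-space of test forms, continuity is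
  the same as sequential continuity.\<close>

definition supercurrent ::
  "(real^'n) set \<Rightarrow> nat \<Rightarrow> nat \<Rightarrow> 'n::finite supercurrent \<Rightarrow> bool" where
  "supercurrent U k l T \<longleftrightarrow> k \<le> CARD('n) \<and> l \<le> CARD('n) \<and>
     (\<forall>a b s t. test_superform U k l a \<longrightarrow> test_superform U k l b \<longrightarrow>
        T (\<lambda>x I J. s * a x I J + t * b x I J) = s * T a + t * T b) \<and>
     (\<forall>A a. (\<forall>j. test_superform U k l (A j)) \<longrightarrow> test_superform U k l a \<longrightarrow>
        test_tendsto U A a \<longrightarrow> (\<lambda>j. T (A j)) \<longlonglongrightarrow> T a)"

text \<open>Equality of supercurrents of bidimension \<open>(k, l)\<close> on \<open>U\<close>.\<close>

definition sc_eq ::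
  "(real^'n) set \<Rightarrow> nat \<Rightarrow> nat \<Rightarrow> 'n supercurrent \<Rightarrow> 'n::finite supercurrent \<Rightarrow> bool" where
  "sc_eq U k l S T \<longleftrightarrow> (\<forall>a. test_superform U k l a \<longrightarrow> S a = T a)"

text \<open>\<open>(T \<and> \<gamma>).\<alpha> = \<integral> T \<and> \<gamma> \<and> \<alpha>\<close> for a smooth form \<open>\<gamma>\<close>.\<close>

definition sc_wedge :: "'n supercurrent \<Rightarrow> 'n superform \<Rightarrow> 'n::{finite,linorder} supercurrent" where
  "sc_wedge T c = (\<lambda>a. T (c \<and>\<^sub>s a))"

text \<open>For \<open>T\<close> of bidimension \<open>(k, l)\<close>, hence of total degree \<open>2n - k - l\<close>, differentiating the
  distribution coefficients amounts to
  \<open>0 = \<integral> d(T \<and> \<alpha>) = \<integral> dT \<and> \<alpha> + (-1)\<^bsup>2n - k - l\<^esup> \<integral> T \<and> d\<alpha>\<close>.\<close>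

definition sc_d :: "nat \<Rightarrow> nat \<Rightarrow> 'n supercurrent \<Rightarrow> 'n::{finite,linorder} supercurrent" where
  "sc_d k l T = (\<lambda>a. (-1) ^ (k + l + 1) * T (sf_d a))"

text \<open>As \<open>J\<close> is multiplicative and fixes \<open>dx\<^sub>1 \<and> d\<xi>\<^sub>1 \<and> \<dots> \<and> dx\<^sub>n \<and> d\<xi>\<^sub>n\<close>, applying it to
  \<open>T = \<Sum> T\<^sub>I\<^sub>J dx\<^sub>I \<and> d\<xi>\<^sub>J\<close> gives \<open>J(T).\<alpha> = T.J\<^sup>-\<^sup>1(\<alpha>)\<close>, and \<open>J\<^sup>-\<^sup>1 = (-1)\<^bsup>k + l\<^esup> J\<close> on forms of total
  degree \<open>k + l\<close>.\<close>

definition sc_J :: "nat \<Rightarrow> nat \<Rightarrow> 'n supercurrent \<Rightarrow> 'n::finite supercurrent" where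
  "sc_J k l T = (\<lambda>a. (-1) ^ (k + l) * T (sf_J a))"

definition symmetric_supercurrent ::
  "(real^'n) set \<Rightarrow> nat \<Rightarrow> 'n::finite supercurrent \<Rightarrow> bool" where
  "symmetric_supercurrent U m T \<longleftrightarrow> sc_eq U m m (sc_J m m T) T"

definition weakly_positive ::
  "(real^'n::{finite,linorder}) set \<Rightarrow> nat \<Rightarrow> 'n::{finite,linorder} supercurrent \<Rightarrow> bool" where
  "weakly_positive U m T \<longleftrightarrow>
     (\<forall>\<alpha>. (\<forall>j<m. test_superform U 1 0 (\<alpha> j)) \<longrightarrow>
        T (sf_prod (\<lambda>j. \<alpha> j \<and>\<^sub>s sf_J (\<alpha> j)) m) \<ge> 0)"

text \<open>\<open>dT \<and> \<beta>\<^bsup>m-1\<^esup>\<close> has bidegree \<open>(n, n - 1)\<close>, so it acts on forms of bidegree \<open>(0, 1)\<close>.\<close>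

definition minimal_supercurrent ::
  "(real^'n::{finite,linorder}) set \<Rightarrow> nat \<Rightarrow> 'n::{finite,linorder} supercurrent \<Rightarrow> bool" where
  "minimal_supercurrent U m T \<longleftrightarrow> m \<ge> 1 \<and> supercurrent U m m T \<and>
     weakly_positive U m T \<and> symmetric_supercurrent U m T \<and>
     sc_eq U 0 1 (sc_wedge (sc_d m m T) (sf_power sf_beta (m - 1))) (\<lambda>_. 0)"

text \<open>The locally finite measure on \<open>U\<close> (regarded as a Borel measure on the whole space that does
  not charge the complement of \<open>U\<close>) with which a positive supercurrent \<open>S\<close> of bidegree \<open>(n, n)\<close> is
  identified: \<open>S.\<phi> = \<integral> \<phi> d\<mu>\<close> for test functions \<open>\<phi>\<close>.\<close>

definition represents_current ::
  "(real^'n) set \<Rightarrow> (real^'n) measure \<Rightarrow> 'n::finite supercurrent \<Rightarrow> bool" where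
  "represents_current U \<mu> S \<longleftrightarrow> sets \<mu> = sets borel \<and> emeasure \<mu> (- U) = 0 \<and>
     (\<forall>K. compact K \<longrightarrow> K \<subseteq> U \<longrightarrow> emeasure \<mu> K < \<infinity>) \<and>
     (\<forall>\<phi>. test_superform U 0 0 (sf_fun \<phi>) \<longrightarrow> S (sf_fun \<phi>) = (\<integral>x. \<phi> x \<partial>\<mu>))"

definition current_measure ::
  "(real^'n) set \<Rightarrow> 'n::finite supercurrent \<Rightarrow> (real^'n) measure" where
  "current_measure U S = (THE \<mu>. represents_current U \<mu> S)"

end

theory Submission
  imports Defs
begin

text \<open>Write \<open>w = |x|\<^sup>2\<close> and \<open>\<theta> = (\<Sum> x\<^sub>k dx\<^sub>k) \<and> (\<Sum> x\<^sub>j d\<xi>\<^sub>j)\<close>, and let \<open>\<mu>\<close> be the measure \<open>T \<and> \<beta>\<^bsup>m\<^esup>/m!\<close>, which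
  exists because the functional \<open>\<phi> \<mapsto> T.(\<phi> \<beta>\<^bsup>m\<^esup>)\<close> on test functions is positive. Testing minimality
  against \<open>\<gamma>(w) \<Sum> x\<^sub>j d\<xi>\<^sub>j\<close> gives \<open>T.(\<gamma> \<beta>\<^bsup>m\<^esup>) = - 2 T.(\<gamma>' \<beta>\<^bsup>m-1\<^esup> \<and> \<theta>)\<close>. By Lagrange's identity \<open>w \<beta> - \<theta>\<close> is
  a sum of terms \<open>\<eta> \<and> \<eta>\<^sup>#\<close>, so its \<open>m\<close>-th power, which is \<open>w\<^bsup>m\<^esup> \<beta>\<^bsup>m\<^esup> - m w\<^bsup>m-1\<^esup> \<beta>\<^bsup>m-1\<^esup> \<and> \<theta>\<close> as \<open>\<theta>\<^sup>2 = 0\<close>,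
  is nonnegative on \<open>T\<close>. Choosing \<open>\<gamma>(w) = H(w\<^bsup>m\<^esup>/\<rho>\<^sup>2)\<close> with a decreasing cutoff \<open>H\<close>, the two relations say
  that \<open>G(\<rho>) = \<integral> H(w\<^bsup>m\<^esup>/\<rho>\<^sup>2) d\<mu>\<close> satisfies \<open>G \<le> \<rho> G'\<close>, i.e. \<open>G(\<rho>)/\<rho>\<close> is nondecreasing. Now put
  \<open>\<rho> = r\<^bsup>m\<^esup>\<close> and let \<open>H\<close> tend to the indicator function of \<open>u < 1\<close>.\<close>

section \<open>Calculus of smooth functions\<close>

text \<open>The form \<open>w * beta - theta\<close> replaces the usual
  \<open>beta - theta / w\<close>, so nothing is singular at the origin, which lies in every ball
  considered. Multiplying it by \<open>beta ^ (m - 1)\<close> would also give something nonnegative,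
  but only the bound theta beta^(m-1) <= w beta^m and hence the growth rate r. The m-th power gains
  the factor m, which is what makes the exponent m appear. Its price is a factor w^(m-1), and the
  profile is a function of w^m precisely because the chain rule then produces this factor. The mass
  of a ball need not be differentiable in r, so the differential inequality is proved for smooth
  profiles and only the resulting monotonicity is passed to the limit.

  The current is known only as a functional on smooth forms, while the theorem speaks of a measure
  given by a definite description. Both existence and uniqueness of the representing measure must
  therefore be established before any integral against it makes sense.\<close>

lemma partial_eq:
  assumes "(f has_derivative f') (at x)"
  shows "partial k f x = f' (axis k 1)"
proof -
  have "((\<lambda>t. f (x + t *\<^sub>R axis k 1)) has_derivative (\<lambda>t. f' (t *\<^sub>R axis k 1))) (at 0)"
    by (rule has_derivative_compose[where g=f and f="\<lambda>t. x + t *\<^sub>R axis k 1"])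
      (auto intro!: derivative_eq_intros assms)
  moreover have "f' (t *\<^sub>R axis k 1) = t * f' (axis k 1)" for t
    using has_derivative_bounded_linear[OF assms] by (simp add: linear_simps)
  ultimately have "((\<lambda>t. f (x + t *\<^sub>R axis k 1)) has_real_derivative f' (axis k 1)) (at 0)"
    by (simp add: has_field_derivative_def mult.commute[of _ "f' (axis k 1)"])
  then show ?thesis
    unfolding partial_def by (rule DERIV_imp_deriv)
qed

text \<open>Smoothness is the largest class of differentiable functions closed under partial
  derivatives, so membership in any such class suffices.\<close>

lemma smooth_coinduct:
  assumes "P f" and diff: "\<And>f x. P f \<Longrightarrow> f differentiable at x"
    and closed: "\<And>f k. P f \<Longrightarrow> P (partial k f)"
  shows "smooth f"
proof -
  have "P (iter_partial ks f)" for ks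
    by (induction ks) (auto simp: iter_partial_def assms)
  then show ?thesis
    unfolding smooth_def using diff by blast
qed

lemma smooth_imp_differentiable: "smooth f \<Longrightarrow> f differentiable at x"
  unfolding smooth_def by (metis iter_partial_def foldr_Nil id_apply)

lemma smooth_partial: "smooth f \<Longrightarrow> smooth (partial k f)"
  unfolding smooth_def
proof (intro allI)
  fix ks x assume "\<forall>ks x. iter_partial ks f differentiable at x"
  then have "iter_partial (ks @ [k]) f differentiable at x" by blast
  then show "iter_partial ks (partial k f) differentiable at x" by (simp add: iter_partial_def)
qed

lemma smooth_continuous: "smooth f \<Longrightarrow> continuous_on A f"
  by (meson continuous_at_imp_continuous_on differentiable_imp_continuous_within smooth_imp_differentiable)

text \<open>A whole family containing its own derivatives on \<open>A\<close> certifies the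
  smoothness of each member there, without any formula for iterated derivatives. It is used for
  \<open>c * u powr a\<close> on the positive half-line and for \<open>flat_exp p\<close> on the
  whole line.\<close>

definition deriv_closed :: "real set \<Rightarrow> (real \<Rightarrow> real) set \<Rightarrow> bool" where
  "deriv_closed A G \<longleftrightarrow> (\<forall>g\<in>G. \<exists>g'\<in>G. \<forall>u\<in>A. (g has_real_derivative g' u) (at u))"

text \<open>This class is closed under partial derivatives and consists of differentiable functions, so it
  contains only smooth ones: all closure properties of smoothness follow from one induction.\<close>

inductive smooth_closure :: "(real^'n::finite \<Rightarrow> real) \<Rightarrow> bool" where
  smooth: "smooth f \<Longrightarrow> smooth_closure f"
| const: "smooth_closure (\<lambda>x. c)"
| coord: "smooth_closure (\<lambda>x. x $ i)"
| add: "smooth_closure f \<Longrightarrow> smooth_closure g \<Longrightarrow> smooth_closure (\<lambda>x. f x + g x)"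
| mult: "smooth_closure f \<Longrightarrow> smooth_closure g \<Longrightarrow> smooth_closure (\<lambda>x. f x * g x)"
| comp: "smooth_closure f \<Longrightarrow> deriv_closed A G \<Longrightarrow> g \<in> G \<Longrightarrow> (\<And>x. f x \<in> A) \<Longrightarrow>
    smooth_closure (\<lambda>x. g (f x))"

lemma smooth_closure_partial:
  fixes f :: "real^'n::finite \<Rightarrow> real"
  shows "smooth_closure f \<Longrightarrow> (\<forall>x. f differentiable at x) \<and> (\<forall>k. smooth_closure (partial k f))"
proof (induction rule: smooth_closure.induct)
  case (smooth f)
  then show ?case
    by (auto intro: smooth_closure.smooth smooth_imp_differentiable smooth_partial)
next
  case (const c)
  have "partial k (\<lambda>x::real^'n. c) = (\<lambda>x. 0)" for k
    by (intro ext) (simp add: partial_eq[where f'="\<lambda>_. 0"])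
  then show ?case by (auto intro: smooth_closure.const)
next
  case (coord i)
  have d: "((\<lambda>x. x $ i) has_derivative (\<lambda>h. h $ i)) (at x)" for x :: "real^'n"
    by (rule bounded_linear_imp_has_derivative) (rule bounded_linear_vec_nth)
  then have "partial k (\<lambda>x::real^'n. x $ i) = (\<lambda>x. axis k 1 $ i)" for k
    by (intro ext) (simp only: partial_eq[OF d])
  then show ?case using d by (auto intro: smooth_closure.const simp: differentiable_def)
next
  case (add f g)
  have "partial k (\<lambda>x. f x + g x) = (\<lambda>x. partial k f x + partial k g x)" for k
  proof
    fix x
    obtain f' g' where d: "(f has_derivative f') (at x)" "(g has_derivative g') (at x)"
      using add.IH unfolding differentiable_def by blast
    show "partial k (\<lambda>x. f x + g x) x = partial k f x + partial k g x"
      using partial_eq[OF has_derivative_add[OF d]] partial_eq[OF d(1)] partial_eq[OF d(2)] by simp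
  qed
  then show ?case using add.IH by (auto intro: smooth_closure.add)
next
  case (mult f g)
  have "partial k (\<lambda>x. f x * g x) = (\<lambda>x. f x * partial k g x + partial k f x * g x)" for k
  proof
    fix x
    obtain f' g' where d: "(f has_derivative f') (at x)" "(g has_derivative g') (at x)"
      using mult.IH unfolding differentiable_def by blast
    show "partial k (\<lambda>x. f x * g x) x = f x * partial k g x + partial k f x * g x"
      using partial_eq[OF has_derivative_mult[OF d]] partial_eq[OF d(1)] partial_eq[OF d(2)] by simp
  qed
  then show ?case using mult by (auto intro!: smooth_closure.add smooth_closure.mult)
next
  case (comp f A G g)
  obtain g' where g': "g' \<in> G" "\<And>u. u \<in> A \<Longrightarrow> (g has_real_derivative g' u) (at u)"
    using comp.hyps unfolding deriv_closed_def by blast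
  have d: "((\<lambda>x. g (f x)) has_derivative (\<lambda>h. g' (f x) * f' h)) (at x)"
    if "(f has_derivative f') (at x)" for f' x
    using has_derivative_compose[OF that, of g "\<lambda>h. g' (f x) * h"] g'(2)[OF comp.hyps(4)]
    by (simp add: has_field_derivative_def)
  have "partial k (\<lambda>x. g (f x)) = (\<lambda>x. g' (f x) * partial k f x)" for k
  proof
    fix x
    obtain f' where f': "(f has_derivative f') (at x)"
      using comp.IH unfolding differentiable_def by blast
    show "partial k (\<lambda>x. g (f x)) x = g' (f x) * partial k f x"
      using partial_eq[OF d[OF f']] partial_eq[OF f'] by simp
  qed
  \<comment> \<open>The outer factor of the chain rule stays in the class because \<open>g'\<close>
    is again a member of \<open>G\<close>; this is why \<open>comp\<close> ranges over a family and
    not a single function.\<close>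
  moreover have "smooth_closure (\<lambda>x. g' (f x))"
    using comp g'(1) by (auto intro: smooth_closure.comp)
  ultimately show ?case
    using comp.IH d by (fastforce intro: smooth_closure.mult simp: differentiable_def)
qed

lemma smooth_closure_imp_smooth: "smooth_closure f \<Longrightarrow> smooth f"
  by (rule smooth_coinduct[where P=smooth_closure]) (auto dest: smooth_closure_partial)

lemma smooth_const: "smooth (\<lambda>x. c)"
  and smooth_coord: "smooth (\<lambda>x. x $ i)"
  and smooth_add: "smooth f \<Longrightarrow> smooth g \<Longrightarrow> smooth (\<lambda>x. f x + g x)"
  and smooth_mult: "smooth f \<Longrightarrow> smooth g \<Longrightarrow> smooth (\<lambda>x. f x * g x)"
  and smooth_comp: "smooth f \<Longrightarrow> deriv_closed A G \<Longrightarrow> h \<in> G \<Longrightarrow> (\<And>x. f x \<in> A) \<Longrightarrow> smooth (\<lambda>x. h (f x))"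
  by (auto intro!: smooth_closure_imp_smooth smooth_closure.intros(2-5)
      intro: smooth_closure.comp smooth_closure.smooth)

lemma smooth_minus: "smooth f \<Longrightarrow> smooth (\<lambda>x. - f x)"
  using smooth_mult[OF smooth_const[of "-1"], of f] by simp

lemma smooth_diff: "smooth f \<Longrightarrow> smooth g \<Longrightarrow> smooth (\<lambda>x. f x - g x)"
  using smooth_add[OF _ smooth_minus, of f g] by simp

lemma smooth_divide_const: "smooth f \<Longrightarrow> smooth (\<lambda>x. f x / c)"
  using smooth_mult[OF _ smooth_const[of "1/c"], of f] by simp

lemma smooth_sum: "(\<And>i. i \<in> S \<Longrightarrow> smooth (f i)) \<Longrightarrow> smooth (\<lambda>x. \<Sum>i\<in>S. f i x)"
  by (induction S rule: infinite_finite_induct) (auto intro: smooth_const smooth_add)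

lemma smooth_prod: "(\<And>i. i \<in> S \<Longrightarrow> smooth (f i)) \<Longrightarrow> smooth (\<lambda>x. \<Prod>i\<in>S. f i x)"
  by (induction S rule: infinite_finite_induct) (auto intro: smooth_const smooth_mult)

lemma smooth_power: "smooth f \<Longrightarrow> smooth (\<lambda>x. f x ^ k)"
  by (induction k) (auto intro: smooth_const smooth_mult)

lemma smooth_inner_diff: "smooth (\<lambda>x. (x - a) \<bullet> (x - a))"
  unfolding inner_vec_def
  by (auto intro!: smooth_sum smooth_mult smooth_diff smooth_coord smooth_const)

lemma smooth_powr: "smooth f \<Longrightarrow> (\<And>x. f x > 0) \<Longrightarrow> smooth (\<lambda>x. f x powr a)"
proof (rule smooth_comp[where h="\<lambda>u. u powr a" and A="{0<..}" and G="range (\<lambda>(c, a) u. c * u powr a)"])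
  show "deriv_closed {0<..} (range (\<lambda>(c, a) u. c * u powr a))"
    unfolding deriv_closed_def
  proof safe
    fix c a :: real
    show "\<exists>g'\<in>range (\<lambda>(c, a) u. c * u powr a).
        \<forall>u\<in>{0<..}. ((\<lambda>u. c * u powr a) has_real_derivative g' u) (at u)"
      by (rule bexI[of _ "\<lambda>u. (c * a) * u powr (a - 1)"])
        (auto intro!: derivative_eq_intros image_eqI[of _ _ "(c * a, a - 1)"])
  qed
  show "(\<lambda>u. u powr a) \<in> range (\<lambda>(c, a) u. c * u powr a)"
    by (rule image_eqI[of _ _ "(1, a)"]) auto
qed auto

section \<open>A smooth step function built from exp(-1/t)\<close>

definition flat_exp :: "real poly \<Rightarrow> real \<Rightarrow> real" where
  "flat_exp p t = (if t > 0 then poly p (1 / t) * exp (- (1 / t)) else 0)"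

text \<open>With u = 1/t one has d/dt = -u^2 d/du, and d/du (p e^(-u)) = (p' - p) e^(-u). Hence the
  factor u^2, written \<open>[:0, 0, 1:]\<close>, and the difference
  \<open>p - pderiv p\<close>.\<close>

definition flat_exp_deriv :: "real poly \<Rightarrow> real poly" where
  "flat_exp_deriv p = [:0, 0, 1:] * (p - pderiv p)"

lemma poly_exp_tendsto_0: "((\<lambda>u. poly p u * exp (- u)) \<longlongrightarrow> (0::real)) at_top"
proof -
  have "((\<lambda>u. \<Sum>i\<le>degree p. coeff p i * (u ^ i / exp u)) \<longlongrightarrow> (\<Sum>i\<le>degree p. coeff p i * 0)) at_top"
    by (intro tendsto_sum tendsto_mult tendsto_const tendsto_power_div_exp_0)
  then show ?thesis
    by (simp add: poly_altdef exp_minus sum_distrib_right divide_inverse mult.assoc)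
qed

lemma flat_exp_has_derivative:
  "(flat_exp p has_real_derivative flat_exp (flat_exp_deriv p) t) (at t)"
proof (cases t "0::real" rule: linorder_cases)
  case less
  have "((\<lambda>_. 0::real) has_real_derivative 0) (at t)" by simp
  then have "(flat_exp p has_real_derivative 0) (at t)"
    by (rule has_field_derivative_transform_within_open[where S="{..<0}"]) (use less in \<open>auto simp: flat_exp_def\<close>)
  then show ?thesis using less by (simp add: flat_exp_def)
next
  case greater
  have "((\<lambda>t. poly p (1 / t) * exp (- (1 / t))) has_real_derivative flat_exp (flat_exp_deriv p) t) (at t)"
  proof -
    have i: "((\<lambda>t. 1 / t) has_real_derivative - (1 / t\<^sup>2)) (at t)"
      using greater by (auto intro!: derivative_eq_intros simp: power2_eq_square)
    have e: "((\<lambda>t. exp (- (1 / t))) has_real_derivative exp (- (1 / t)) * (1 / t\<^sup>2)) (at t)"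
      using DERIV_chain2[OF DERIV_exp DERIV_minus[OF i]] by simp
    show ?thesis
      using DERIV_mult[OF DERIV_chain2[OF poly_DERIV[of p] i] e] greater
      by (simp add: flat_exp_def flat_exp_deriv_def field_simps power2_eq_square)
  qed
  then show ?thesis
    by (rule has_field_derivative_transform_within_open[where S="{0<..}"]) (use greater in \<open>auto simp: flat_exp_def\<close>)
next
  case equal
  \<comment> \<open>The extra factor \<open>[:0, 1:]\<close> is the 1/h of the difference quotient,
    rewritten in terms of u = 1/h.\<close>
  have "((\<lambda>h. poly ([:0, 1:] * p) (inverse h) * exp (- inverse h)) \<longlongrightarrow> 0) (at_right 0)"
    by (rule filterlim_compose[OF poly_exp_tendsto_0 filterlim_inverse_at_top_right])
  then have "((\<lambda>h. flat_exp p h / h) \<longlongrightarrow> 0) (at_right 0)"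
    by (rule Lim_transform_eventually)
      (auto simp: eventually_at_filter flat_exp_def divide_inverse mult_ac intro!: always_eventually)
  moreover have "((\<lambda>h. flat_exp p h / h) \<longlongrightarrow> 0) (at_left 0)"
    by (rule Lim_transform_eventually[OF tendsto_const])
      (auto simp: eventually_at_filter flat_exp_def intro!: always_eventually)
  ultimately have "((\<lambda>h. flat_exp p h / h) \<longlongrightarrow> 0) (at 0)"
    by (simp add: filterlim_at_split)
  then show ?thesis
    using equal by (simp add: DERIV_def flat_exp_def)
qed

lemma smooth_flat_exp: "smooth f \<Longrightarrow> smooth (\<lambda>x. flat_exp p (f x))"
  by (rule smooth_comp[where h="flat_exp p" and A=UNIV and G="range flat_exp"])
    (auto simp: deriv_closed_def intro: flat_exp_has_derivative)

lemma flat_exp_1_mono: "s \<le> t \<Longrightarrow> flat_exp 1 s \<le> flat_exp 1 t"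
  by (auto simp: flat_exp_def frac_le)

lemma flat_exp_1_pos: "t > 0 \<Longrightarrow> flat_exp 1 t > 0"
  and flat_exp_nonpos: "t \<le> 0 \<Longrightarrow> flat_exp p t = 0"
  and flat_exp_1_nonneg: "flat_exp 1 t \<ge> 0"
  by (auto simp: flat_exp_def)

text \<open>Write e for \<open>flat_exp 1\<close>. The inner expression e(1) - e(1 - t) is
  nondecreasing, nonpositive for t <= 0 and constantly e(1) for t >= 1; the outer e flattens the
  nonpositive part to 0. Nesting, instead of the quotient e(t) / (e(t) + e(1 - t)), keeps the
  denominator constant, so the closure rules for smooth functions apply directly.\<close>

definition step :: "real \<Rightarrow> real" where
  "step t = flat_exp 1 (flat_exp 1 1 - flat_exp 1 (1 - t)) / flat_exp 1 (flat_exp 1 1)"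

definition step_deriv :: "real \<Rightarrow> real" where
  "step_deriv t = flat_exp [:0, 0, 1:] (flat_exp 1 1 - flat_exp 1 (1 - t)) *
     flat_exp [:0, 0, 1:] (1 - t) / flat_exp 1 (flat_exp 1 1)"

lemma step_has_derivative: "(step has_real_derivative step_deriv t) (at t)"
proof -
  have d: "(flat_exp 1 has_real_derivative flat_exp [:0, 0, 1:] t) (at t)" for t
    using flat_exp_has_derivative[of 1 t] by (simp add: flat_exp_deriv_def)
  show ?thesis
    unfolding step_def step_deriv_def
    by (auto intro!: derivative_eq_intros DERIV_chain2[OF d] simp: flat_exp_1_pos less_imp_neq[symmetric])
qed

lemma smooth_step: "smooth f \<Longrightarrow> smooth (\<lambda>x. step (f x))"
  and smooth_step_deriv: "smooth f \<Longrightarrow> smooth (\<lambda>x. step_deriv (f x))"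
  unfolding step_def step_deriv_def
  by (intro smooth_divide_const smooth_flat_exp smooth_diff smooth_const smooth_mult; assumption)+

lemma step_eq_0: "t \<le> 0 \<Longrightarrow> step t = 0"
  using flat_exp_1_mono[of 1 "1 - t"] by (simp add: step_def flat_exp_nonpos)

lemma step_eq_1: "t \<ge> 1 \<Longrightarrow> step t = 1"
  using flat_exp_1_pos[OF flat_exp_1_pos[of 1]] by (simp add: step_def flat_exp_nonpos)

lemma step_nonneg: "step t \<ge> 0"
  by (simp add: step_def flat_exp_1_nonneg)

lemma step_le_1: "step t \<le> 1"
proof -
  have "flat_exp 1 (flat_exp 1 1 - flat_exp 1 (1 - t)) \<le> flat_exp 1 (flat_exp 1 1)"
    by (rule flat_exp_1_mono) (simp add: flat_exp_1_nonneg)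
  then show ?thesis
    using flat_exp_1_pos[OF flat_exp_1_pos[of 1]] by (simp add: step_def)
qed

lemma step_deriv_nonneg: "step_deriv t \<ge> 0"
  by (auto simp: step_deriv_def flat_exp_def)

lemma step_deriv_eq_0: "t \<le> 0 \<or> t \<ge> 1 \<Longrightarrow> step_deriv t = 0"
  using flat_exp_1_mono[of 1 "1 - t"] by (auto simp: step_deriv_def flat_exp_nonpos)

lemma continuous_step_deriv: "continuous_on A step_deriv"
proof -
  have f: "continuous_on A (flat_exp p)" for A p
    by (meson DERIV_continuous_on flat_exp_has_derivative has_field_derivative_at_within)
  have g: "continuous_on A (\<lambda>t. flat_exp p (h t))" if "continuous_on A h" for A p h
    using continuous_on_compose2[OF f[of UNIV] that] by auto
  show ?thesis
    unfolding step_deriv_def divide_inverse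
    by (intro continuous_intros g)
qed

section \<open>Smooth cutoffs\<close>

definition test_fun :: "(real^'n::finite) set \<Rightarrow> (real^'n \<Rightarrow> real) \<Rightarrow> bool" where
  "test_fun U \<phi> \<longleftrightarrow> smooth \<phi> \<and> (\<exists>K. compact K \<and> K \<subseteq> U \<and> (\<forall>x. x \<notin> K \<longrightarrow> \<phi> x = 0))"

text \<open>The cutoff equals 1 on an open neighbourhood of \<open>K\<close> and not just on
  \<open>K\<close>: then \<open>1 - \<eta>\<close> times a function supported in \<open>K\<close>
  has compact support away from that neighbourhood, as needed for splitting test functions over two
  open sets.\<close>

lemma smooth_cutoff:
  fixes K :: "(real^'n::finite) set"
  assumes "compact K" "open V" "K \<subseteq> V"
  obtains \<eta> W where "test_fun V \<eta>" "\<And>x. 0 \<le> \<eta> x" "\<And>x. \<eta> x \<le> 1"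
    "open W" "K \<subseteq> W" "\<And>x. x \<in> W \<Longrightarrow> \<eta> x = 1"
proof -
  obtain r where r: "\<And>a. a \<in> K \<Longrightarrow> r a > 0 \<and> cball a (r a) \<subseteq> V"
    using assms by (metis open_contains_cball subsetD)
  \<comment> \<open>A bump around \<open>a\<close>: the argument of \<open>step\<close> is at least
    1 when |x - a|^2 <= r^2/2 and at most 0 when |x - a|^2 >= r^2.\<close>
  define b where "b = (\<lambda>a x. step (2 - (x - a) \<bullet> (x - a) / ((r a)\<^sup>2 / 2)))"
  define O' where "O' = (\<lambda>a. {x. (x - a) \<bullet> (x - a) < (r a)\<^sup>2 / 2})"
  have "K \<subseteq> (\<Union>a\<in>K. O' a)"
    unfolding O'_def using r by (force simp: O'_def)
  moreover have "open (O' a)" for a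
    unfolding O'_def by (intro open_Collect_less continuous_intros)
  ultimately obtain C where C: "C \<subseteq> K" "finite C" "K \<subseteq> (\<Union>a\<in>C. O' a)"
    using compactE_image[OF assms(1), of K O'] by metis
  have b1: "b a x = 1" if "a \<in> C" "x \<in> O' a" for a x
    unfolding b_def using r[of a] that C(1) by (intro step_eq_1) (auto simp: O'_def field_simps)
  have b0: "b a x = 0" if "a \<in> C" "x \<notin> cball a (r a)" for a x
  proof -
    have "r a < norm (x - a)" "0 < r a"
      using that r[of a] C(1) by (auto simp: dist_norm norm_minus_commute)
    then have "(r a)\<^sup>2 < (norm (x - a))\<^sup>2"
      by (intro power_strict_mono) auto
    then have "(r a)\<^sup>2 \<le> (x - a) \<bullet> (x - a)"
      by (simp only: power2_norm_eq_inner)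
    then show ?thesis
      unfolding b_def using \<open>0 < r a\<close>
      by (intro step_eq_0) (simp add: field_simps)
  qed
  \<comment> \<open>This combination is 1 where some bump is 1 and 0 where all bumps vanish, and it
    never leaves [0, 1].\<close>
  define \<eta> where "\<eta> = (\<lambda>x. 1 - (\<Prod>a\<in>C. 1 - b a x))"
  have sm: "smooth \<eta>"
    unfolding \<eta>_def b_def
    by (intro smooth_diff smooth_prod smooth_const smooth_step smooth_divide_const smooth_inner_diff)
  have "0 \<le> 1 - b a x" "1 - b a x \<le> 1" for a x
    by (auto simp: b_def step_le_1 step_nonneg)
  then have p: "0 \<le> (\<Prod>a\<in>C. 1 - b a x)" "(\<Prod>a\<in>C. 1 - b a x) \<le> 1" for x
    by (auto intro!: prod_nonneg prod_le_1)
  show thesis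
  proof
    show "test_fun V \<eta>"
      unfolding test_fun_def
    proof (intro conjI exI[of _ "\<Union>a\<in>C. cball a (r a)"] sm)
      show "compact (\<Union>a\<in>C. cball a (r a))" using C by auto
      show "(\<Union>a\<in>C. cball a (r a)) \<subseteq> V" using C r by auto
      show "\<forall>x. x \<notin> (\<Union>a\<in>C. cball a (r a)) \<longrightarrow> \<eta> x = 0"
        using b0 by (auto simp: \<eta>_def intro!: prod.neutral)
    qed
    show "0 \<le> \<eta> x" "\<eta> x \<le> 1" for x
      using p[of x] by (auto simp: \<eta>_def)
    show "open (\<Union>a\<in>C. O' a)" using \<open>\<And>a. open (O' a)\<close> by blast
    show "K \<subseteq> (\<Union>a\<in>C. O' a)" by (rule C)
    show "\<eta> x = 1" if "x \<in> (\<Union>a\<in>C. O' a)" for x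
    proof -
      have "(\<Prod>a\<in>C. 1 - b a x) = 0"
        using that C(2) b1 by (auto simp: prod_zero_iff)
      then show ?thesis by (simp add: \<eta>_def)
    qed
  qed
qed

section \<open>Riesz representation for positive functionals on test functions\<close>

lemma test_fun_smooth: "test_fun U \<phi> \<Longrightarrow> smooth \<phi>"
  by (simp add: test_fun_def)

lemma test_funE:
  assumes "test_fun U \<phi>"
  obtains K where "compact K" "K \<subseteq> U" "\<And>x. x \<notin> K \<Longrightarrow> \<phi> x = 0"
  using assms unfolding test_fun_def by metis

lemma test_fun_outside: "test_fun U \<phi> \<Longrightarrow> x \<notin> U \<Longrightarrow> \<phi> x = 0"
  by (metis test_funE subsetD)

lemma test_fun_mono: "test_fun U \<phi> \<Longrightarrow> U \<subseteq> V \<Longrightarrow> test_fun V \<phi>"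
  unfolding test_fun_def by blast

lemma test_fun_mult_left: "test_fun U \<phi> \<Longrightarrow> smooth \<psi> \<Longrightarrow> test_fun U (\<lambda>x. \<phi> x * \<psi> x)"
  unfolding test_fun_def by (metis mult_zero_left smooth_mult)

lemma test_fun_mult_right: "smooth \<psi> \<Longrightarrow> test_fun U \<phi> \<Longrightarrow> test_fun U (\<lambda>x. \<psi> x * \<phi> x)"
  using test_fun_mult_left[of U \<phi> \<psi>] by (simp add: mult.commute)

lemma test_fun_scale: "test_fun U \<phi> \<Longrightarrow> test_fun U (\<lambda>x. c * \<phi> x)"
  by (rule test_fun_mult_right[OF smooth_const])

lemma test_fun_zero: "test_fun U (\<lambda>x. 0)"
  unfolding test_fun_def by (auto intro!: smooth_const exI[of _ "{}"])

lemma test_fun_add: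
  assumes "test_fun U \<phi>" "test_fun U \<psi>"
  shows "test_fun U (\<lambda>x. \<phi> x + \<psi> x)"
proof -
  obtain K K' where "compact K" "K \<subseteq> U" "\<And>x. x \<notin> K \<Longrightarrow> \<phi> x = 0"
    "compact K'" "K' \<subseteq> U" "\<And>x. x \<notin> K' \<Longrightarrow> \<psi> x = 0"
    using assms unfolding test_fun_def by metis
  then show ?thesis
    using assms unfolding test_fun_def
    by (intro conjI smooth_add exI[of _ "K \<union> K'"]) auto
qed

lemma test_fun_diff: "test_fun U \<phi> \<Longrightarrow> test_fun U \<psi> \<Longrightarrow> test_fun U (\<lambda>x. \<phi> x - \<psi> x)"
  using test_fun_add[OF _ test_fun_scale[of U \<psi> "-1"], of \<phi>] by simp

lemma test_fun_sum: "(\<And>i. i \<in> S \<Longrightarrow> test_fun U (f i)) \<Longrightarrow> test_fun U (\<lambda>x. \<Sum>i\<in>S. f i x)"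
  by (induction S rule: infinite_finite_induct) (auto intro: test_fun_zero test_fun_add)

lemma test_fun_bounded:
  assumes "test_fun U \<phi>"
  obtains B where "B > 0" "\<And>x. \<bar>\<phi> x\<bar> \<le> B"
proof -
  obtain K where K: "compact K" "\<And>x. x \<notin> K \<Longrightarrow> \<phi> x = 0"
    using assms unfolding test_fun_def by metis
  have "compact (\<phi> ` K)"
    using K smooth_continuous[OF test_fun_smooth[OF assms]] by (intro compact_continuous_image)
  then obtain B where "B > 0" "\<forall>y\<in>\<phi> ` K. norm y \<le> B"
    by (meson bounded_pos compact_imp_bounded)
  then have "\<bar>\<phi> x\<bar> \<le> B" for x
    using K(2)[of x] by (cases "x \<in> K") auto
  with \<open>B > 0\<close> show thesis by (rule that)
qed

text \<open>No continuity is assumed: for functionals on smooth test functions, positivity alone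
  produces the measure. The instance of interest is the action of T wedge beta^m / m! on
  functions.\<close>

locale positive_functional =
  fixes U :: "(real^'n::finite) set" and L :: "(real^'n \<Rightarrow> real) \<Rightarrow> real"
  assumes open_U: "open U"
    and L_add: "test_fun U \<phi> \<Longrightarrow> test_fun U \<psi> \<Longrightarrow> L (\<lambda>x. \<phi> x + \<psi> x) = L \<phi> + L \<psi>"
    and L_scale: "test_fun U \<phi> \<Longrightarrow> L (\<lambda>x. c * \<phi> x) = c * L \<phi>"
    and L_nonneg: "test_fun U \<phi> \<Longrightarrow> (\<And>x. 0 \<le> \<phi> x) \<Longrightarrow> 0 \<le> L \<phi>"
begin

lemma L_diff: "test_fun U \<phi> \<Longrightarrow> test_fun U \<psi> \<Longrightarrow> L (\<lambda>x. \<phi> x - \<psi> x) = L \<phi> - L \<psi>"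
  using L_add[OF _ test_fun_scale[of U \<psi> "-1"], of \<phi>] L_scale[of \<psi> "-1"] by simp

lemma L_mono: "test_fun U \<phi> \<Longrightarrow> test_fun U \<psi> \<Longrightarrow> (\<And>x. \<phi> x \<le> \<psi> x) \<Longrightarrow> L \<phi> \<le> L \<psi>"
  using L_diff[of \<psi> \<phi>] L_nonneg[OF test_fun_diff, of \<psi> \<phi>] by simp

lemma L_zero: "L (\<lambda>x. 0) = 0"
  using L_scale[OF test_fun_zero, of 0] by simp

lemma L_sum: "(\<And>i. i \<in> S \<Longrightarrow> test_fun U (f i)) \<Longrightarrow> L (\<lambda>x. \<Sum>i\<in>S. f i x) = (\<Sum>i\<in>S. L (f i))"
  by (induction S rule: infinite_finite_induct) (auto simp: L_zero L_add test_fun_sum)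

section \<open>The outer measure of a positive functional\<close>

definition below :: "(real^'n) set \<Rightarrow> (real^'n \<Rightarrow> real) set" where
  "below V = {\<phi>. test_fun V \<phi> \<and> (\<forall>x. 0 \<le> \<phi> x \<and> \<phi> x \<le> 1)}"

definition inner_content :: "(real^'n) set \<Rightarrow> ennreal" where
  "inner_content V = (SUP \<phi>\<in>below V. ennreal (L \<phi>))"

text \<open>Covering only \<open>A \<inter> U\<close> extends the measure by zero: the complement of
  \<open>U\<close> is covered by the empty set.\<close>

definition outer :: "(real^'n) set \<Rightarrow> ennreal" where
  "outer A = (INF V\<in>{V. open V \<and> V \<subseteq> U \<and> A \<inter> U \<subseteq> V}. inner_content V)"

lemma zero_below: "(\<lambda>x. 0) \<in> below V"
  by (simp add: below_def test_fun_zero)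

lemma below_mono: "V \<subseteq> W \<Longrightarrow> below V \<subseteq> below W"
  unfolding below_def using test_fun_mono by blast

lemma inner_content_upper: "\<phi> \<in> below V \<Longrightarrow> ennreal (L \<phi>) \<le> inner_content V"
  unfolding inner_content_def by (rule SUP_upper)

lemma inner_content_mono: "V \<subseteq> W \<Longrightarrow> inner_content V \<le> inner_content W"
  unfolding inner_content_def by (intro SUP_subset_mono below_mono) auto

lemma inner_content_empty: "inner_content {} = 0"
proof -
  have "\<phi> = (\<lambda>x. 0)" if "\<phi> \<in> below {}" for \<phi>
    using that by (auto simp: below_def test_fun_def)
  then have "below {} = {\<lambda>x. 0}" using zero_below by blast
  then show ?thesis by (simp add: inner_content_def L_zero)
qed

text \<open>A function supported in a compact \<open>K\<close> inside the union splits as phi eta +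
  phi (1 - eta), where eta lives in \<open>V\<close> and equals 1 near \<open>K - W\<close>; the
  second summand then has compact support in \<open>W\<close>.\<close>

lemma inner_content_Un:
  assumes "open V" "open W" "V \<subseteq> U" "W \<subseteq> U"
  shows "inner_content (V \<union> W) \<le> inner_content V + inner_content W"
  unfolding inner_content_def[of "V \<union> W"]
proof (rule SUP_least)
  fix \<phi> assume "\<phi> \<in> below (V \<union> W)"
  then obtain K where K: "compact K" "K \<subseteq> V \<union> W" "\<And>x. x \<notin> K \<Longrightarrow> \<phi> x = 0"
    and \<phi>: "smooth \<phi>" "\<And>x. 0 \<le> \<phi> x" "\<And>x. \<phi> x \<le> 1"
    unfolding below_def test_fun_def by auto
  have "compact (K - W)" using K assms by (simp add: compact_diff)
  then obtain \<eta> O' where \<eta>: "test_fun V \<eta>" "\<And>x. 0 \<le> \<eta> x" "\<And>x. \<eta> x \<le> 1"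
    "open O'" "K - W \<subseteq> O'" "\<And>x. x \<in> O' \<Longrightarrow> \<eta> x = 1"
    using smooth_cutoff[OF _ assms(1)] K(2) by (metis Diff_subset_conv sup_commute)
  have 1: "(\<lambda>x. \<phi> x * \<eta> x) \<in> below V"
    unfolding below_def using \<phi> \<eta> test_fun_mult_right[OF \<phi>(1) \<eta>(1)] by (auto simp: mult_le_one)
  have "test_fun W (\<lambda>x. \<phi> x * (1 - \<eta> x))"
    unfolding test_fun_def
  proof (intro conjI exI[of _ "K - O'"])
    show "smooth (\<lambda>x. \<phi> x * (1 - \<eta> x))"
      using \<phi> \<eta> by (intro smooth_mult smooth_diff smooth_const) (auto simp: test_fun_def)
  qed (use K \<eta> in \<open>auto simp: compact_diff\<close>)
  then have 2: "(\<lambda>x. \<phi> x * (1 - \<eta> x)) \<in> below W"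
    unfolding below_def using \<phi> \<eta> by (auto intro!: mult_le_one)
  have "test_fun U (\<lambda>x. \<phi> x * \<eta> x)" "test_fun U (\<lambda>x. \<phi> x * (1 - \<eta> x))"
    using 1 2 test_fun_mono[OF _ assms(3)] test_fun_mono[OF _ assms(4)] by (auto simp: below_def)
  moreover have "(\<lambda>x. \<phi> x * \<eta> x + \<phi> x * (1 - \<eta> x)) = \<phi>"
    by (simp add: algebra_simps)
  ultimately have "L \<phi> = L (\<lambda>x. \<phi> x * \<eta> x) + L (\<lambda>x. \<phi> x * (1 - \<eta> x))"
    using L_add[of "\<lambda>x. \<phi> x * \<eta> x" "\<lambda>x. \<phi> x * (1 - \<eta> x)"] by simp
  moreover have "0 \<le> L (\<lambda>x. \<phi> x * \<eta> x)" "0 \<le> L (\<lambda>x. \<phi> x * (1 - \<eta> x))"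
    using 1 2 assms by (auto simp: below_def intro!: L_nonneg elim: test_fun_mono)
  ultimately have "ennreal (L \<phi>) = ennreal (L (\<lambda>x. \<phi> x * \<eta> x)) + ennreal (L (\<lambda>x. \<phi> x * (1 - \<eta> x)))"
    by simp
  also have "\<dots> \<le> inner_content V + inner_content W"
    by (intro add_mono inner_content_upper 1 2)
  finally show "ennreal (L \<phi>) \<le> inner_content V + inner_content W" .
qed

lemma inner_content_UN:
  fixes V :: "nat \<Rightarrow> (real^'n) set"
  assumes V: "\<And>i. open (V i)" "\<And>i. V i \<subseteq> U"
  shows "inner_content (\<Union>i. V i) \<le> (\<Sum>i. inner_content (V i))"
  unfolding inner_content_def[of "\<Union>i. V i"]
proof (rule SUP_least)
  fix \<phi> assume \<phi>: "\<phi> \<in> below (\<Union>i. V i)"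
  then obtain K where K: "compact K" "K \<subseteq> (\<Union>i. V i)" "\<And>x. x \<notin> K \<Longrightarrow> \<phi> x = 0"
    unfolding below_def test_fun_def by auto
  obtain C where C: "finite C" "K \<subseteq> (\<Union>i\<in>C. V i)"
    using compactE_image[OF K(1), of UNIV V] V(1) K(2) by metis
  \<comment> \<open>An initial segment of indices lets the finite case run by induction. If
    \<open>C\<close> is empty, \<open>Max C\<close> is unspecified, but the inclusion still
    holds.\<close>
  have "C \<subseteq> {..<Suc (Max C)}"
    using C(1) by (auto simp: less_Suc_eq_le)
  then have "K \<subseteq> (\<Union>i<Suc (Max C). V i)" using C by blast
  then have "\<phi> \<in> below (\<Union>i<Suc (Max C). V i)"
    using \<phi> K unfolding below_def test_fun_def by blast
  then have "ennreal (L \<phi>) \<le> inner_content (\<Union>i<Suc (Max C). V i)"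
    by (rule inner_content_upper)
  also have "inner_content (\<Union>i<n. V i) \<le> (\<Sum>i<n. inner_content (V i))" for n
  proof (induction n)
    case (Suc n)
    have "inner_content (\<Union>i<Suc n. V i) = inner_content ((\<Union>i<n. V i) \<union> V n)"
      by (simp add: lessThan_Suc Un_commute)
    also have "\<dots> \<le> inner_content (\<Union>i<n. V i) + inner_content (V n)"
      using V by (intro inner_content_Un) auto
    finally show ?case using Suc.IH by (auto intro: order_trans add_right_mono)
  qed (simp add: inner_content_empty)
  also have "(\<Sum>i<Suc (Max C). inner_content (V i)) \<le> (\<Sum>i. inner_content (V i))"
    by (rule sum_le_suminf) auto
  finally show "ennreal (L \<phi>) \<le> (\<Sum>i. inner_content (V i))" .
qed

lemma outer_upper: "open V \<Longrightarrow> V \<subseteq> U \<Longrightarrow> A \<inter> U \<subseteq> V \<Longrightarrow> outer A \<le> inner_content V"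
  unfolding outer_def by (rule INF_lower) simp

lemma outer_mono: "A \<subseteq> B \<Longrightarrow> outer A \<le> outer B"
  unfolding outer_def by (rule INF_superset_mono) auto

lemma outer_open: "open V \<Longrightarrow> V \<subseteq> U \<Longrightarrow> outer V = inner_content V"
  by (rule antisym[OF outer_upper]) (auto simp: outer_def intro!: INF_greatest inner_content_mono)

lemma outer_measure_space_outer: "outer_measure_space UNIV outer"
  unfolding outer_measure_space_def
proof (intro conjI)
  show "positive UNIV outer"
    using outer_open[of "{}"] by (simp add: positive_def inner_content_empty)
  show "increasing UNIV outer"
    by (auto simp: increasing_def intro: outer_mono)
  show "countably_subadditive UNIV outer"
    unfolding countably_subadditive_def
  proof (intro allI impI)
    fix A :: "nat \<Rightarrow> (real^'n) set"
    show "outer (\<Union>i. A i) \<le> (\<Sum>i. outer (A i))"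
    proof (rule ennreal_le_epsilon)
      fix e :: real assume "0 < e" "(\<Sum>n. outer (A n)) < top"
      \<comment> \<open>Since the total is finite, so is each \<open>outer (A n)\<close>, and adding
        a positive amount makes the inequality strict; the amounts sum to \<open>e\<close>.\<close>
      then have *: "(INF V\<in>{V. open V \<and> V \<subseteq> U \<and> A n \<inter> U \<subseteq> V}. inner_content V)
          < outer (A n) + e * (1/2)^Suc n" for n
        by (auto simp add: less_top outer_def[of "A n", symmetric] dest!: ennreal_suminf_lessD)
      have "\<exists>V. open V \<and> V \<subseteq> U \<and> A n \<inter> U \<subseteq> V \<and>
          inner_content V \<le> outer (A n) + e * (1/2)^Suc n" for n
        using *[of n] unfolding INF_less_iff by (auto intro: less_imp_le)
      then obtain V where V: "\<And>n. open (V n)" "\<And>n. V n \<subseteq> U" "\<And>n. A n \<inter> U \<subseteq> V n"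
        "\<And>n. inner_content (V n) \<le> outer (A n) + e * (1/2)^Suc n"
        by metis
      have "outer (\<Union>i. A i) \<le> inner_content (\<Union>i. V i)"
        using V(1-3) by (intro outer_upper) blast+
      also have "\<dots> \<le> (\<Sum>i. inner_content (V i))"
        using V by (intro inner_content_UN)
      also have "\<dots> \<le> (\<Sum>n. outer (A n) + e * (1/2) ^ Suc n)"
        by (intro suminf_le allI V(4)) auto
      also have "\<dots> = (\<Sum>n. outer (A n)) + (\<Sum>n. ennreal e * ennreal ((1/2) ^ Suc n))"
        using \<open>0 < e\<close> by (subst suminf_add[symmetric])
          (auto simp del: ennreal_suminf_cmult simp add: ennreal_mult[symmetric])
      also have "\<dots> = (\<Sum>n. outer (A n)) + e"
        unfolding ennreal_suminf_cmult
        by (subst suminf_ennreal_eq[OF zero_le_power power_half_series]) auto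
      finally show "outer (\<Union>i. A i) \<le> (\<Sum>n. outer (A n)) + e" .
    qed
  qed
qed

text \<open>This is the nontrivial half of Caratheodory's criterion for open sets. If phi is
  subordinate to \<open>W \<inter> V\<close> and vanishes off the compact \<open>K\<close>, and psi
  is subordinate to \<open>W - K\<close>, then phi + psi is still at most 1 and hence subordinate to
  \<open>W\<close>. Taking suprema over psi and then phi gives the bound.\<close>

lemma outer_Int_Diff:
  assumes "open V"
  shows "outer (A \<inter> V) + outer (A - V) \<le> outer A"
  unfolding outer_def[of A]
proof (rule INF_greatest, clarify)
  fix W assume W: "open W" "W \<subseteq> U" "A \<inter> U \<subseteq> W"
  have "ennreal (L \<phi>) + outer (A - V) \<le> inner_content W" if "\<phi> \<in> below (W \<inter> V)" for \<phi>
  proof -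
    have "test_fun (W \<inter> V) \<phi>" using that by (simp add: below_def)
    then obtain K where K: "compact K" "K \<subseteq> W \<inter> V" "\<And>x. x \<notin> K \<Longrightarrow> \<phi> x = 0"
      by (metis test_funE)
    have \<phi>: "\<phi> \<in> below W" using that below_mono[of "W \<inter> V" W] by blast
    have "outer (A - V) \<le> inner_content (W - K)"
      using W K by (intro outer_upper) (auto intro: open_Diff compact_imp_closed)
    then have "ennreal (L \<phi>) + outer (A - V) \<le> ennreal (L \<phi>) + inner_content (W - K)"
      by (intro add_left_mono)
    also have "\<dots> = (SUP \<psi>\<in>below (W - K). ennreal (L \<phi>) + ennreal (L \<psi>))"
      unfolding inner_content_def using zero_below by (intro ennreal_SUP_add_right) blast
    also have "\<dots> \<le> inner_content W"
    proof (rule SUP_least)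
      fix \<psi> assume \<psi>: "\<psi> \<in> below (W - K)"
      then have \<psi>': "\<psi> \<in> below W" and 0: "\<And>x. x \<in> K \<Longrightarrow> \<psi> x = 0"
        using below_mono[of "W - K" W] test_fun_outside[of "W - K" \<psi>] by (auto simp: below_def)
      have "\<phi> x + \<psi> x \<le> 1" for x
        using 0[of x] K(3)[of x] \<phi> \<psi> by (cases "x \<in> K") (auto simp: below_def)
      then have "(\<lambda>x. \<phi> x + \<psi> x) \<in> below W"
        using \<phi> \<psi>' by (auto simp: below_def test_fun_add)
      moreover have "test_fun U \<phi>" "test_fun U \<psi>"
        using \<phi> \<psi>' test_fun_mono[OF _ W(2)] by (auto simp: below_def)
      moreover from this have "0 \<le> L \<phi>" "0 \<le> L \<psi>"
        using \<phi> \<psi>' by (auto simp: below_def intro!: L_nonneg)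
      ultimately show "ennreal (L \<phi>) + ennreal (L \<psi>) \<le> inner_content W"
        using inner_content_upper[of "\<lambda>x. \<phi> x + \<psi> x" W] by (simp add: L_add)
    qed
    finally show ?thesis .
  qed
  then have "(SUP \<phi>\<in>below (W \<inter> V). ennreal (L \<phi>) + outer (A - V)) \<le> inner_content W"
    by (rule SUP_least)
  moreover have "(SUP \<phi>\<in>below (W \<inter> V). ennreal (L \<phi>) + outer (A - V)) = inner_content (W \<inter> V) + outer (A - V)"
    unfolding inner_content_def using zero_below by (intro ennreal_SUP_add_left) blast
  moreover have "outer (A \<inter> V) \<le> inner_content (W \<inter> V)"
    using W assms by (intro outer_upper) auto
  ultimately show "outer (A \<inter> V) + outer (A - V) \<le> inner_content W"
    by (metis add_right_mono order_trans)
qed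

definition riesz_measure :: "(real^'n) measure" where
  "riesz_measure = measure_of UNIV (sets borel) outer"

lemma sets_riesz_measure: "sets riesz_measure = sets borel"
  unfolding riesz_measure_def using sets.sigma_sets_eq[of "borel :: (real^'n) measure"] by simp

text \<open>Open sets satisfy Caratheodory's criterion, so the lambda system, being a sigma-algebra,
  contains all Borel sets and \<open>outer\<close> is countably additive on them.\<close>

lemma emeasure_riesz_measure:
  assumes "A \<in> sets borel"
  shows "emeasure riesz_measure A = outer A"
proof -
  interpret sigma_algebra UNIV "UNIV :: (real^'n) set set"
    using sigma_algebra_Pow[of UNIV] by simp
  define \<Lambda> where "\<Lambda> = lambda_system UNIV UNIV outer"
  have ms: "measure_space UNIV \<Lambda> outer"
    unfolding \<Lambda>_def by (rule caratheodory_lemma[OF outer_measure_space_outer])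
  have sub: "outer A \<le> outer (A \<inter> V) + outer (A - V)" for A V
  proof -
    have "subadditive UNIV outer"
      using outer_measure_space_outer countably_subadditive_subadditive
      unfolding outer_measure_space_def by blast
    from subadditiveD[OF this, of "A \<inter> V" "A - V"] show ?thesis
      by (auto simp: Int_Diff_Un)
  qed
  have "V \<in> \<Lambda>" if "open V" for V
    unfolding \<Lambda>_def lambda_system_eq using antisym[OF outer_Int_Diff[OF that] sub] by simp
  then have "sigma_sets UNIV {V. open V} \<subseteq> \<Lambda>"
    using ms by (intro sigma_algebra.sigma_sets_subset) (auto simp: measure_space_def)
  then have "sets (borel :: (real^'n) measure) \<subseteq> \<Lambda>"
    by (simp add: borel_def)
  then have "positive (sets borel) outer" "countably_additive (sets borel) outer"
    using ms unfolding measure_space_def countably_additive_def positive_def by blast+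
  then show ?thesis
    using assms unfolding riesz_measure_def
    by (intro emeasure_measure_of_sigma) (auto intro: sets.sigma_algebra_axioms[of borel, simplified])
qed

text \<open>Together with the lower bound for functions subordinate to \<open>V\<close>, this
  comparison is what ties \<open>L\<close> to the measure in the representation theorem; finiteness
  on compact sets follows from it as well.\<close>

lemma riesz_measure_open_upper:
  assumes V: "open V" "V \<subseteq> U" and f: "test_fun U f" "\<And>x. 0 \<le> f x" "\<And>x. x \<in> V \<Longrightarrow> 1 \<le> f x"
  shows "emeasure riesz_measure V \<le> ennreal (L f)"
proof -
  have "inner_content V \<le> ennreal (L f)"
    unfolding inner_content_def
  proof (rule SUP_least)
    fix \<phi> assume \<phi>: "\<phi> \<in> below V"
    then have "\<phi> x \<le> 1" "x \<notin> V \<Longrightarrow> \<phi> x = 0" for x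
      using test_fun_outside[of V \<phi>] by (auto simp: below_def)
    then have "\<phi> x \<le> f x" for x
      using f(2,3)[of x] by (cases "x \<in> V") (auto intro: order_trans)
    moreover have "test_fun U \<phi>"
      using \<phi> test_fun_mono[OF _ V(2)] by (simp add: below_def)
    ultimately show "ennreal (L \<phi>) \<le> ennreal (L f)"
      using f(1) by (intro ennreal_leI L_mono)
  qed
  then show ?thesis
    using V by (simp add: emeasure_riesz_measure outer_open)
qed

lemma riesz_measure_open_lower:
  assumes V: "open V" "V \<subseteq> U" and f: "test_fun V f" "\<And>x. 0 \<le> f x" "\<And>x. f x \<le> 1"
  shows "ennreal (L f) \<le> emeasure riesz_measure V"
  using assms by (simp add: emeasure_riesz_measure outer_open inner_content_upper below_def)

lemma riesz_measure_compact:
  assumes "compact K" "K \<subseteq> U"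
  shows "emeasure riesz_measure K < \<infinity>"
proof -
  obtain \<eta> W where \<eta>: "test_fun U \<eta>" "\<And>x. 0 \<le> \<eta> x" "open W" "K \<subseteq> W" "\<And>x. x \<in> W \<Longrightarrow> \<eta> x = 1"
    using smooth_cutoff[OF assms(1) open_U assms(2)] by metis
  have "emeasure riesz_measure K \<le> emeasure riesz_measure (W \<inter> U)"
    using \<eta> assms open_U by (intro emeasure_mono) (auto simp: sets_riesz_measure)
  also have "\<dots> \<le> ennreal (L \<eta>)"
    using \<eta> open_U by (intro riesz_measure_open_upper) auto
  finally show ?thesis by (metis ennreal_less_top infinity_ennreal_def le_less_trans)
qed

lemma riesz_measure_Compl: "emeasure riesz_measure (- U) = 0"
  using outer_upper[of "{}" "- U"] open_U by (simp add: emeasure_riesz_measure inner_content_empty)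

end

section \<open>Representation by integrals\<close>

lemma test_fun_integrable:
  fixes \<mu> :: "(real^'n::finite) measure"
  assumes "sets \<mu> = sets borel" and fin: "\<And>K. compact K \<Longrightarrow> K \<subseteq> U \<Longrightarrow> emeasure \<mu> K < \<infinity>"
    and "test_fun U \<phi>"
  shows "integrable \<mu> \<phi>"
proof -
  obtain K where K: "compact K" "K \<subseteq> U" "\<And>x. x \<notin> K \<Longrightarrow> \<phi> x = 0"
    using test_funE[OF assms(3)] by metis
  obtain B where B: "\<And>x. \<bar>\<phi> x\<bar> \<le> B"
    using test_fun_bounded[OF assms(3)] by metis
  have "integrable \<mu> (\<lambda>x. B * indicator K x)"
    using K fin[of K] assms(1) compact_imp_closed[OF K(1)]
    by (intro integrable_mult_right integrable_real_indicator) auto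
  moreover have "\<phi> \<in> borel_measurable \<mu>"
    using borel_measurable_continuous_onI[OF smooth_continuous[OF test_fun_smooth[OF assms(3)]]]
    by (simp add: measurable_cong_sets[OF assms(1) refl])
  moreover have "norm (\<phi> x) \<le> norm (B * indicator K x :: real)" for x
    using B[of x] K(3)[of x] by (cases "x \<in> K") auto
  ultimately show ?thesis
    by (intro Bochner_Integration.integrable_bound[of _ "\<lambda>x. B * indicator K x" \<phi>]) auto
qed

text \<open>The slices with k <= y - 1 equal 1 and those with k >= y vanish, so at most one slice
  takes an intermediate value.\<close>

lemma sum_step_approx:
  assumes "0 \<le> y" "y \<le> real M"
  shows "\<bar>(\<Sum>k<M. step (y - real k)) - y\<bar> \<le> 1"
  using assms
proof (induction M arbitrary: y)
  case (Suc M)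
  have "(\<Sum>k<Suc M. step (y - real k)) = step y + (\<Sum>k<M. step (y - 1 - real k))"
    by (subst sum.lessThan_Suc_shift) (simp add: algebra_simps)
  moreover have "step (y - 1 - real k) = 0" if "y \<le> 1" for k
    using that by (intro step_eq_0) simp
  ultimately show ?case
    using Suc.IH[of "y - 1"] Suc.prems step_eq_1[of y] step_nonneg[of y] step_le_1[of y]
    by (cases "y \<le> 1") auto
qed simp

context positive_functional
begin

lemma riesz_measure_integrable: "test_fun U \<phi> \<Longrightarrow> integrable riesz_measure \<phi>"
  by (rule test_fun_integrable[OF sets_riesz_measure riesz_measure_compact])

text \<open>The slices \<open>step (N \<phi> - k)\<close> add up to \<open>N \<phi>\<close> up to a bounded error, and both \<open>L\<close> and the
  integral of such a slice are controlled by the measures of neighbouring superlevel sets of \<open>\<phi>\<close>.\<close>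

lemma riesz_representation_nonneg:
  assumes \<phi>: "test_fun U \<phi>" "\<And>x. 0 \<le> \<phi> x"
  shows "L \<phi> = (\<integral>x. \<phi> x \<partial>riesz_measure)"
proof -
  let ?\<mu> = riesz_measure
  obtain K where K: "compact K" "K \<subseteq> U" "\<And>x. x \<notin> K \<Longrightarrow> \<phi> x = 0"
    using test_funE[OF \<phi>(1)] by metis
  obtain \<eta> where \<eta>: "test_fun U \<eta>" "\<And>x. 0 \<le> \<eta> x" "\<And>x. x \<in> K \<Longrightarrow> \<eta> x = 1"
    using smooth_cutoff[OF K(1) open_U K(2)] by (metis subsetD)
  obtain B where B: "\<And>x. \<bar>\<phi> x\<bar> \<le> B"
    using test_fun_bounded[OF \<phi>(1)] by metis
  \<comment> \<open>\<open>C\<close> bounds both \<open>L\<close> and the integral on every slice,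
    since each slice is dominated by \<open>\<eta>\<close>, whatever \<open>N\<close> is.\<close>
  define C where "C = max (L \<eta>) (\<integral>x. \<eta> x \<partial>?\<mu>)"
  have C0: "0 \<le> C" using L_nonneg[OF \<eta>(1,2)] by (simp add: C_def)
  have int_mono: "(\<integral>x. f x \<partial>?\<mu>) \<le> (\<integral>x. g x \<partial>?\<mu>)"
    if "test_fun U f" "test_fun U g" "\<And>x. f x \<le> g x" for f g
    using that by (intro integral_mono riesz_measure_integrable) auto
  have main: "\<bar>L \<phi> - (\<integral>x. \<phi> x \<partial>?\<mu>)\<bar> \<le> 4 * C / real N" if "N > 0" for N :: nat
  proof -
    define S where "S = (\<lambda>k::nat. \<lambda>x. step (real N * \<phi> x - real k))"
    have Sb: "0 \<le> S k x" "S k x \<le> 1" for k x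
      by (auto simp: S_def step_nonneg step_le_1)
    have Ssm: "smooth (S k)" for k
      unfolding S_def using \<phi>(1) by (intro smooth_step smooth_diff smooth_mult smooth_const test_fun_smooth)
    have S0: "S k x = 0" if "real N * \<phi> x \<le> real k" for k x
      using that by (auto simp: S_def step_eq_0)
    have S1: "S k x = 1" if "real N * \<phi> x \<ge> real k + 1" for k x
      using that by (auto simp: S_def step_eq_1)
    have SK: "S k x = 0" if "x \<notin> K" for k x
      using S0[of x k] K(3)[OF that] by simp
    have St: "test_fun U (S k)" for k
      unfolding test_fun_def using Ssm SK K by blast
    have S\<eta>: "S k x \<le> \<eta> x" for k x
      using SK[of x k] \<eta>(2)[of x] \<eta>(3)[of x] Sb(2)[of k x] by (cases "x \<in> K") auto
    define P where "P = (\<lambda>k::nat. {x. real N * \<phi> x > real k})"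
    have Po: "open (P k)" for k
      unfolding P_def using smooth_continuous[OF test_fun_smooth[OF \<phi>(1)]]
      by (intro open_Collect_less continuous_intros)
    have PU: "P k \<subseteq> K" for k
      using K(3) unfolding P_def by (metis (mono_tags, lifting) mem_Collect_eq mult_zero_right not_less of_nat_0_le_iff subsetI)
    have fin: "emeasure ?\<mu> (P k) < \<infinity>" for k
    proof -
      have "emeasure ?\<mu> (P k) \<le> emeasure ?\<mu> K"
        using PU K(1) by (intro emeasure_mono) (auto simp: sets_riesz_measure compact_imp_closed)
      also have "\<dots> < \<infinity>" using riesz_measure_compact K by blast
      finally show ?thesis .
    qed
    have upper: "measure ?\<mu> (P (Suc k)) \<le> L (S k)" for k
    proof -
      have "emeasure ?\<mu> (P (Suc k)) \<le> ennreal (L (S k))"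
        using Po[of "Suc k"] PU[of "Suc k"] K(2) St Sb S1[of k]
        by (intro riesz_measure_open_upper) (auto simp: P_def)
      then show ?thesis
        using L_nonneg[OF St Sb(1)] by (simp add: measure_def enn2real_leI)
    qed
    \<comment> \<open>The index shifts by one because a function subordinate to the open set
      \<open>P k\<close> needs compact support inside it. The set where N phi >= k + 1 qualifies for
      \<open>S (Suc k)\<close>; the analogous set for \<open>S k\<close> need not lie in
      \<open>P k\<close>.\<close>
    have lower: "L (S (Suc k)) \<le> measure ?\<mu> (P k)" for k
    proof -
      have "compact {x \<in> K. real N * \<phi> x \<ge> real (Suc k)}"
      proof -
        have "closed {x. real N * \<phi> x \<ge> real (Suc k)}"
          using smooth_continuous[OF test_fun_smooth[OF \<phi>(1)]]
          by (intro closed_Collect_le continuous_intros)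
        from compact_Int_closed[OF K(1) this] show ?thesis by (simp add: Int_def)
      qed
      then have "test_fun (P k) (S (Suc k))"
        unfolding test_fun_def using Ssm
        by (intro conjI exI[of _ "{x \<in> K. real N * \<phi> x \<ge> real (Suc k)}"])
          (auto simp: P_def intro: S0 SK)
      then have "ennreal (L (S (Suc k))) \<le> emeasure ?\<mu> (P k)"
        using Po PU K(2) Sb by (intro riesz_measure_open_lower) auto
      then show ?thesis
        using fin[of k] by (simp add: emeasure_eq_ennreal_measure less_top ennreal_le_iff)
    qed
    have Pint: "integrable ?\<mu> (indicator (P k) :: _ \<Rightarrow> real)" for k
      using fin[of k] Po by (intro integrable_real_indicator) (auto simp: sets_riesz_measure)
    have Pm: "(\<integral>x. indicator (P k) x \<partial>?\<mu>) = measure ?\<mu> (P k)" for k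
      using Po[of k] by (simp add: sets_riesz_measure)
    have iupper: "measure ?\<mu> (P (Suc k)) \<le> (\<integral>x. S k x \<partial>?\<mu>)" for k
      unfolding Pm[symmetric]
      by (intro integral_mono Pint riesz_measure_integrable St)
        (use Sb S1 in \<open>auto simp: indicator_def P_def\<close>)
    have ilower: "(\<integral>x. S k x \<partial>?\<mu>) \<le> measure ?\<mu> (P k)" for k
      unfolding Pm[symmetric]
      by (intro integral_mono Pint riesz_measure_integrable St)
        (use Sb S0 in \<open>auto simp: indicator_def P_def not_less\<close>)
    define a b where "a = (\<lambda>k. L (S k))" and "b = (\<lambda>k. \<integral>x. S k x \<partial>?\<mu>)"
    \<comment> \<open>Both estimates pass through the measure of \<open>P (Suc k)\<close>. The shift
      is by one in one direction and by two in the other, the second one coming from the compact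
      support required in \<open>lower\<close>.\<close>
    have ab: "b (Suc k) \<le> a k" "a (Suc (Suc k)) \<le> b k" for k
      unfolding a_def b_def using upper ilower lower iupper order_trans by blast+
    have abC: "a k \<le> C" "b k \<le> C" for k
      unfolding a_def b_def C_def
      using L_mono[OF St \<eta>(1) S\<eta>] int_mono[OF St \<eta>(1) S\<eta>] by (auto intro: max.coboundedI1 max.coboundedI2)
    have ab0: "0 \<le> a k" "0 \<le> b k" for k
      unfolding a_def b_def using L_nonneg[OF St Sb(1)] Sb(1) by auto
    \<comment> \<open>After the shift by two only the slices 0 and 1 remain unmatched, each costing
      at most \<open>C\<close>. The opposite comparison leaves a single one.\<close>
    have "(\<Sum>k<M. a k) \<le> (\<Sum>k<M. b k) + 2 * C" for M
    proof -
      have "(\<Sum>k<M. a k) \<le> (\<Sum>k<Suc (Suc M). a k)" using ab0 by simp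
      also have "\<dots> = a 0 + a 1 + (\<Sum>k<M. a (Suc (Suc k)))"
        unfolding sum.lessThan_Suc_shift[of _ "Suc M"] sum.lessThan_Suc_shift[of _ M] by simp
      also have "\<dots> \<le> C + C + (\<Sum>k<M. b k)"
        by (intro add_mono abC sum_mono ab)
      finally show ?thesis by simp
    qed
    moreover have "(\<Sum>k<M. b k) \<le> (\<Sum>k<M. a k) + 2 * C" for M
    proof -
      have "(\<Sum>k<M. b k) \<le> (\<Sum>k<Suc M. b k)" using ab0 by simp
      also have "\<dots> = b 0 + (\<Sum>k<M. b (Suc k))"
        unfolding sum.lessThan_Suc_shift[of _ M] by simp
      also have "\<dots> \<le> C + (\<Sum>k<M. a k)"
        by (intro add_mono abC sum_mono ab)
      finally show ?thesis using C0 by simp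
    qed
    ultimately have diff: "\<bar>(\<Sum>k<M. a k) - (\<Sum>k<M. b k)\<bar> \<le> 2 * C" for M
      by (simp add: abs_le_iff algebra_simps)
    \<comment> \<open>Enough slices to exhaust the range of \<open>\<phi>\<close>: N phi never
      exceeds \<open>M\<close>.\<close>
    define M where "M = nat \<lceil>real N * B\<rceil>"
    define \<psi> where "\<psi> = (\<lambda>x. (1 / real N) * (\<Sum>k<M. S k x))"
    have \<psi>t: "test_fun U \<psi>"
      unfolding \<psi>_def by (intro test_fun_scale test_fun_sum St)
    \<comment> \<open>Carrying the factor \<open>\<eta>\<close> turns a uniform error into a bound
      by a test function, to which monotonicity of \<open>L\<close> and of the integral
      applies.\<close>
    have approx: "\<bar>\<psi> x - \<phi> x\<bar> \<le> 1 / real N * \<eta> x" for x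
    proof (cases "x \<in> K")
      case True
      have "\<phi> x \<le> B" using B[of x] by auto
      then have "real N * \<phi> x \<le> real N * B" by (simp add: mult_left_mono)
      then have "real N * \<phi> x \<le> real M" unfolding M_def by linarith
      then have "\<bar>(\<Sum>k<M. S k x) - real N * \<phi> x\<bar> \<le> 1"
        unfolding S_def using \<phi>(2) by (intro sum_step_approx) auto
      moreover have "\<psi> x - \<phi> x = ((\<Sum>k<M. S k x) - real N * \<phi> x) / real N"
        using \<open>N > 0\<close> by (simp add: \<psi>_def field_simps)
      ultimately show ?thesis
        using True \<eta>(3)[of x] \<open>N > 0\<close> by (simp add: abs_divide divide_right_mono)
    qed (use SK K \<eta>(2) in \<open>auto simp: \<psi>_def\<close>)
    have \<eta>N: "test_fun U (\<lambda>x. 1 / real N * \<eta> x)"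
      by (rule test_fun_scale[OF \<eta>(1)])
    have d: "test_fun U (\<lambda>x. \<psi> x - \<phi> x)" "test_fun U (\<lambda>x. \<phi> x - \<psi> x)"
      by (intro test_fun_diff \<psi>t \<phi>)+
    have "\<psi> x - \<phi> x \<le> 1 / real N * \<eta> x" "\<phi> x - \<psi> x \<le> 1 / real N * \<eta> x" for x
      using approx[of x] by auto
    then have "L \<psi> - L \<phi> \<le> 1 / real N * L \<eta>" "L \<phi> - L \<psi> \<le> 1 / real N * L \<eta>"
      "(\<integral>x. \<psi> x \<partial>?\<mu>) - (\<integral>x. \<phi> x \<partial>?\<mu>) \<le> 1 / real N * (\<integral>x. \<eta> x \<partial>?\<mu>)"
      "(\<integral>x. \<phi> x \<partial>?\<mu>) - (\<integral>x. \<psi> x \<partial>?\<mu>) \<le> 1 / real N * (\<integral>x. \<eta> x \<partial>?\<mu>)"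
      using L_mono[OF d(1) \<eta>N] L_mono[OF d(2) \<eta>N] int_mono[OF d(1) \<eta>N] int_mono[OF d(2) \<eta>N]
      by (simp_all only: L_diff[OF \<psi>t \<phi>(1)] L_diff[OF \<phi>(1) \<psi>t] L_scale[OF \<eta>(1)]
          Bochner_Integration.integral_diff[OF riesz_measure_integrable[OF \<psi>t] riesz_measure_integrable[OF \<phi>(1)]]
          Bochner_Integration.integral_diff[OF riesz_measure_integrable[OF \<phi>(1)] riesz_measure_integrable[OF \<psi>t]]
          integral_mult_right_zero)
    moreover have "1 / real N * L \<eta> \<le> C / real N" "1 / real N * (\<integral>x. \<eta> x \<partial>?\<mu>) \<le> C / real N"
      by (auto simp: C_def divide_right_mono)
    moreover have "L \<psi> = 1 / real N * (\<Sum>k<M. a k)"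
      unfolding \<psi>_def a_def by (subst L_scale) (auto intro: test_fun_sum St simp: L_sum[OF St])
    moreover have "(\<integral>x. \<psi> x \<partial>?\<mu>) = 1 / real N * (\<Sum>k<M. b k)"
      unfolding \<psi>_def b_def
      by (simp add: Bochner_Integration.integral_sum riesz_measure_integrable[OF St])
    ultimately have *: "\<bar>L \<psi> - L \<phi>\<bar> \<le> C / real N" "\<bar>(\<integral>x. \<psi> x \<partial>?\<mu>) - (\<integral>x. \<phi> x \<partial>?\<mu>)\<bar> \<le> C / real N"
      "L \<psi> - (\<integral>x. \<psi> x \<partial>?\<mu>) = ((\<Sum>k<M. a k) - (\<Sum>k<M. b k)) / real N"
      by (auto simp: abs_le_iff diff_divide_distrib)
    then have "\<bar>L \<psi> - (\<integral>x. \<psi> x \<partial>?\<mu>)\<bar> \<le> 2 * C / real N"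
      using diff[of M] by (simp only: abs_divide abs_of_nat divide_right_mono of_nat_0_le_iff)
    moreover have "4 * C / real N = C / real N + C / real N + 2 * C / real N" by simp
    ultimately show ?thesis using * by linarith
  qed
  have "(\<lambda>N. 4 * C / real (Suc N)) \<longlonglongrightarrow> 0"
    using LIMSEQ_Suc[OF lim_const_over_n[of "4 * C"]] by simp
  from tendsto_lowerbound[OF this, of "\<bar>L \<phi> - (\<integral>x. \<phi> x \<partial>?\<mu>)\<bar>"]
  have "\<bar>L \<phi> - (\<integral>x. \<phi> x \<partial>?\<mu>)\<bar> \<le> 0"
    using main[of "Suc _"] by (auto intro: always_eventually simp del: of_nat_Suc)
  then show ?thesis by simp
qed

text \<open>Adding a large multiple of a cutoff makes a signed test function nonnegative, and the
  added term is itself covered by the nonnegative case.\<close>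

theorem riesz_representation:
  assumes "test_fun U \<phi>"
  shows "L \<phi> = (\<integral>x. \<phi> x \<partial>riesz_measure)"
proof -
  obtain K where K: "compact K" "K \<subseteq> U" "\<And>x. x \<notin> K \<Longrightarrow> \<phi> x = 0"
    using test_funE[OF assms(1)] by metis
  obtain \<eta> where \<eta>: "test_fun U \<eta>" "\<And>x. 0 \<le> \<eta> x" "\<And>x. x \<in> K \<Longrightarrow> \<eta> x = 1"
    using smooth_cutoff[OF K(1) open_U K(2)] by (metis subsetD)
  obtain B where B: "B > 0" "\<And>x. \<bar>\<phi> x\<bar> \<le> B"
    using test_fun_bounded[OF assms(1)] by metis
  have t: "test_fun U (\<lambda>x. B * \<eta> x)" by (rule test_fun_scale[OF \<eta>(1)])
  have p: "test_fun U (\<lambda>x. \<phi> x + B * \<eta> x)" by (rule test_fun_add[OF assms t])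
  have nn: "0 \<le> \<phi> x + B * \<eta> x" for x
    using K(3)[of x] \<eta>(2,3)[of x] B(1) B(2)[of x] by (cases "x \<in> K") (auto simp: abs_le_iff)
  have "L \<phi> + L (\<lambda>x. B * \<eta> x) = (\<integral>x. \<phi> x + B * \<eta> x \<partial>riesz_measure)"
    using riesz_representation_nonneg[OF p nn] by (simp only: L_add[OF assms t])
  also have "\<dots> = (\<integral>x. \<phi> x \<partial>riesz_measure) + (\<integral>x. B * \<eta> x \<partial>riesz_measure)"
    by (intro Bochner_Integration.integral_add riesz_measure_integrable assms t)
  also have "(\<integral>x. B * \<eta> x \<partial>riesz_measure) = L (\<lambda>x. B * \<eta> x)"
    using riesz_representation_nonneg[OF t] B(1) \<eta>(2) by simp
  finally show ?thesis by simp
qed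

end

section \<open>Uniqueness of the representing measure\<close>

lemma test_superform_fun: "test_superform U 0 0 (sf_fun \<phi>) \<longleftrightarrow> test_fun U \<phi>"
proof -
  have eq: "(\<lambda>x. sf_fun \<phi> x I J) = (if I = {} \<and> J = {} then \<phi> else (\<lambda>x. 0))" for I J
    by (auto simp: sf_fun_def)
  have "smooth_superform (sf_fun \<phi>) \<longleftrightarrow> smooth \<phi>"
    unfolding smooth_superform_def eq by (auto intro: smooth_const)
  moreover have "supported_in K (sf_fun \<phi>) \<longleftrightarrow> (\<forall>x. x \<notin> K \<longrightarrow> \<phi> x = 0)" for K
    by (auto simp: supported_in_def sf_fun_def)
  moreover have "has_bidegree 0 0 (sf_fun \<phi>)"
    by (auto simp: has_bidegree_def sf_fun_def)
  ultimately show ?thesis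
    by (simp add: test_superform_def test_fun_def)
qed

text \<open>The indicator of \<open>K\<close> is the pointwise limit of the test functions eta
  zeta_j, where zeta_j is 1 on \<open>K\<close> and lives in the 1/(j+1)-neighbourhood. That
  neighbourhood may leave \<open>U\<close>; the fixed factor eta keeps supports in \<open>U\<close>
  and serves as the dominating function.\<close>

lemma measure_compact_eqI:
  fixes \<mu> \<nu> :: "(real^'n::finite) measure"
  assumes U: "open U" and sets: "sets \<mu> = sets borel" "sets \<nu> = sets borel"
    and fin: "\<And>K. compact K \<Longrightarrow> K \<subseteq> U \<Longrightarrow> emeasure \<mu> K < \<infinity>"
      "\<And>K. compact K \<Longrightarrow> K \<subseteq> U \<Longrightarrow> emeasure \<nu> K < \<infinity>"
    and eq: "\<And>\<phi>. test_fun U \<phi> \<Longrightarrow> (\<integral>x. \<phi> x \<partial>\<mu>) = (\<integral>x. \<phi> x \<partial>\<nu>)"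
    and K: "compact K" "K \<subseteq> U"
  shows "emeasure \<mu> K = emeasure \<nu> K"
proof (cases "K = {}")
  case False
  obtain \<eta> where \<eta>: "test_fun U \<eta>" "\<And>x. 0 \<le> \<eta> x" "\<And>x. x \<in> K \<Longrightarrow> \<eta> x = 1"
    using smooth_cutoff[OF K(1) U K(2)] by (metis subsetD)
  define V where "V = (\<lambda>j::nat. {x. infdist x K < 1 / real (Suc j)})"
  have "open (V j)" "K \<subseteq> V j" for j
    unfolding V_def by (auto intro!: open_Collect_less continuous_intros)
  then have "\<exists>\<zeta>. test_fun (V j) \<zeta> \<and> (\<forall>x. 0 \<le> \<zeta> x \<and> \<zeta> x \<le> 1) \<and> (\<forall>x\<in>K. \<zeta> x = 1)" for j
    using smooth_cutoff[OF K(1), of "V j"] by (metis subsetD)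
  then obtain \<zeta> where \<zeta>: "\<And>j. test_fun (V j) (\<zeta> j)" "\<And>j x. 0 \<le> \<zeta> j x" "\<And>j x. \<zeta> j x \<le> 1"
      "\<And>j x. x \<in> K \<Longrightarrow> \<zeta> j x = 1"
    by metis
  have t: "test_fun U (\<lambda>x. \<eta> x * \<zeta> j x)" for j
    by (intro test_fun_mult_left[OF \<eta>(1)] test_fun_smooth[OF \<zeta>(1)])
  have lim: "(\<lambda>j. \<eta> x * \<zeta> j x) \<longlonglongrightarrow> indicator K x" for x
  proof (cases "x \<in> K")
    case False
    have "infdist x K > 0"
      using False \<open>K \<noteq> {}\<close> K(1) by (simp add: compact_imp_closed infdist_pos_not_in_closed)
    then obtain j0 where j0: "1 / real (Suc j0) < infdist x K"
      using nat_approx_posE by blast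
    have "\<zeta> j x = 0" if "j \<ge> j0" for j
    proof -
      have "1 / real (Suc j) \<le> 1 / real (Suc j0)"
        using that by (intro divide_left_mono) auto
      then have "x \<notin> V j" using j0 by (simp add: V_def)
      then show ?thesis by (rule test_fun_outside[OF \<zeta>(1)])
    qed
    then have "\<forall>\<^sub>F j in sequentially. \<eta> x * \<zeta> j x = 0"
      unfolding eventually_sequentially by auto
    then show ?thesis using False by (simp add: tendsto_eventually)
  qed (simp add: \<eta> \<zeta>)
  have conv: "(\<lambda>j. \<integral>x. \<eta> x * \<zeta> j x \<partial>M) \<longlonglongrightarrow> measure M K"
    if M: "sets M = sets borel" "\<And>K. compact K \<Longrightarrow> K \<subseteq> U \<Longrightarrow> emeasure M K < \<infinity>" for M
  proof -
    have "(\<lambda>j. \<integral>x. \<eta> x * \<zeta> j x \<partial>M) \<longlonglongrightarrow> (\<integral>x. indicator K x \<partial>M)"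
    proof (rule integral_dominated_convergence[where w=\<eta>])
      show "integrable M \<eta>" by (rule test_fun_integrable[OF M \<eta>(1)])
      show "(\<lambda>x. \<eta> x * \<zeta> j x) \<in> borel_measurable M" for j
        using test_fun_integrable[OF M t] by (rule borel_measurable_integrable)
      show "AE x in M. norm (\<eta> x * \<zeta> j x) \<le> \<eta> x" for j
        using \<eta>(2) \<zeta>(2,3) by (auto simp: abs_mult mult_left_le)
      show "indicator K \<in> borel_measurable M"
        using K(1) M(1) by (intro borel_measurable_indicator) (simp add: compact_imp_closed)
    qed (use lim in auto)
    then show ?thesis using K(1) M(1) by (simp add: compact_imp_closed)
  qed
  have "measure \<mu> K = measure \<nu> K"
    using LIMSEQ_unique[OF conv[OF sets(1) fin(1)]] conv[OF sets(2) fin(2)] eq[OF t] by simp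
  then show ?thesis
    using fin[OF K] by (simp add: emeasure_eq_ennreal_measure less_top)
qed simp

lemma represents_current_unique:
  fixes \<mu> \<nu> :: "(real^'n::finite) measure"
  assumes U: "open U" and \<mu>: "represents_current U \<mu> S" and \<nu>: "represents_current U \<nu> S"
  shows "\<mu> = \<nu>"
proof -
  have compact: "emeasure \<mu> K = emeasure \<nu> K" if "compact K" "K \<subseteq> U" for K
    using \<mu> \<nu> that
    by (intro measure_compact_eqI[OF U]) (auto simp: represents_current_def test_superform_fun)
  obtain C where C: "\<And>n. compact (C n)" "\<And>n. C n \<subseteq> U"
    "\<And>n. C n \<subseteq> interior (C (Suc n))" "\<Union>(range C) = U"
    using open_Union_compact_subsets[OF U] by metis
  have inc: "incseq C"
    using C(3) interior_subset by (intro incseq_SucI) blast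
  have restrict: "emeasure M A = (SUP n. emeasure M (A \<inter> C n))"
    if M: "represents_current U M S" and A: "closed A" for M A
  proof -
    have s: "sets M = sets borel" "emeasure M (- U) = 0"
      using M by (auto simp: represents_current_def)
    have "emeasure M A = emeasure M (A - (- U))"
      using s A U by (intro emeasure_Diff_null_set[symmetric]) (auto simp: null_sets_def)
    also have "A - (- U) = (\<Union>n. A \<inter> C n)" using C(4) by auto
    also have "emeasure M (\<Union>n. A \<inter> C n) = (SUP n. emeasure M (A \<inter> C n))"
      using inc C(1) A s by (intro SUP_emeasure_incseq[symmetric])
        (auto simp: incseq_def compact_imp_closed intro!: borel_closed)
    finally show ?thesis .
  qed
  show ?thesis
  \<comment> \<open>As \<open>- U\<close> is closed and null, the sets
    \<open>C n \<union> - U\<close> belong to the generator, have finite measure and exhaust the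
    space. Values on closed sets follow from those on compact sets by exhausting
    \<open>U\<close>.\<close>
  proof (rule measure_eqI_generator_eq[where E="{A. closed A}" and \<Omega>=UNIV and A="\<lambda>n. C n \<union> - U"])
    show "Int_stable {A :: (real^'n) set. closed A}" by (auto simp: Int_stable_def)
    show "emeasure \<mu> A = emeasure \<nu> A" if "A \<in> {A. closed A}" for A
      using that C(1,2) restrict[OF \<mu>, of A] restrict[OF \<nu>, of A] compact
      by (simp add: closed_Int_compact le_infI2)
    show "sets \<mu> = sigma_sets UNIV {A. closed A}" "sets \<nu> = sigma_sets UNIV {A. closed A}"
      using \<mu> \<nu> by (auto simp: represents_current_def borel_eq_closed)
    show "emeasure \<mu> (C n \<union> - U) \<noteq> \<infinity>" for n
    proof -
      have "emeasure \<mu> (C n \<union> - U) \<le> emeasure \<mu> (C n) + emeasure \<mu> (- U)"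
        using \<mu> U C(1) by (intro emeasure_subadditive) (auto simp: represents_current_def compact_imp_closed)
      moreover have "emeasure \<mu> (C n) < \<infinity>" "emeasure \<mu> (- U) = 0"
        using \<mu> C(1,2) by (auto simp: represents_current_def)
      ultimately show ?thesis by (auto simp: top_unique)
    qed
  qed (use C U in \<open>auto simp: compact_imp_closed closed_Un\<close>)
qed

lemma represents_current_measure:
  assumes U: "open U" and "\<exists>\<mu>. represents_current U \<mu> S"
  shows "represents_current U (current_measure U S) S"
  unfolding current_measure_def
  using assms represents_current_unique by (metis (no_types, lifting) theI)

section \<open>The algebra of superforms\<close>

text \<open>The pointwise algebra of superforms: the exterior algebra on the \<open>2n\<close> generators \<open>dx\<^sub>i\<close>, \<open>d\<xi>\<^sub>i\<close>.\<close>

typedef 'n ext = "UNIV :: ('n::{finite,linorder} set \<Rightarrow> 'n set \<Rightarrow> real) set"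
  morphisms coeff Ext by simp

lemma coeff_Ext [simp]: "coeff (Ext f) = f"
  by (simp add: Ext_inverse)

lemma ext_eqI: "(\<And>I J. coeff a I J = coeff b I J) \<Longrightarrow> a = b"
  by (simp add: coeff_inject[symmetric] fun_eq_iff)

text \<open>The sign of (dx_I dxi_J)(dx_K dxi_L) relative to the ordered monomial, as a function of
  all four index sets; in this form associativity becomes a cocycle identity.\<close>

definition wedge_sign :: "'n::{finite,linorder} set \<Rightarrow> 'n set \<Rightarrow> 'n set \<Rightarrow> 'n set \<Rightarrow> real" where
  "wedge_sign I J K L = (-1) ^ (card J * card K) * shuffle_sign I K * shuffle_sign J L"

lemma shuffle_sign_Un_left:
  fixes A B C :: "'n::{finite,linorder} set"
  assumes "A \<inter> B = {}"
  shows "shuffle_sign (A \<union> B) C = shuffle_sign A C * shuffle_sign B C"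
proof -
  have "{(i, k). i \<in> A \<union> B \<and> k \<in> C \<and> k < i} =
      {(i, k). i \<in> A \<and> k \<in> C \<and> k < i} \<union> {(i, k). i \<in> B \<and> k \<in> C \<and> k < i}" by auto
  moreover have "card \<dots> = card {(i, k). i \<in> A \<and> k \<in> C \<and> k < i} + card {(i, k). i \<in> B \<and> k \<in> C \<and> k < i}"
    using assms by (intro card_Un_disjoint) auto
  ultimately show ?thesis by (simp add: shuffle_sign_def power_add)
qed

lemma shuffle_sign_Un_right:
  fixes A B C :: "'n::{finite,linorder} set"
  assumes "B \<inter> C = {}"
  shows "shuffle_sign A (B \<union> C) = shuffle_sign A B * shuffle_sign A C"
proof -
  have "{(i, k). i \<in> A \<and> k \<in> B \<union> C \<and> k < i} =
      {(i, k). i \<in> A \<and> k \<in> B \<and> k < i} \<union> {(i, k). i \<in> A \<and> k \<in> C \<and> k < i}" by auto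
  moreover have "card \<dots> = card {(i, k). i \<in> A \<and> k \<in> B \<and> k < i} + card {(i, k). i \<in> A \<and> k \<in> C \<and> k < i}"
    using assms by (intro card_Un_disjoint) auto
  ultimately show ?thesis by (simp add: shuffle_sign_def power_add)
qed

lemma shuffle_sign_empty [simp]: "shuffle_sign {} A = 1" "shuffle_sign A {} = 1"
  by (auto simp: shuffle_sign_def)

lemma shuffle_sign_singleton: "shuffle_sign {i} {j} = (if j < i then -1 else 1)"
proof -
  have "{(a, b). a \<in> {i} \<and> b \<in> {j} \<and> b < a} = (if j < i then {(i, j)} else {})" by auto
  then show ?thesis by (simp add: shuffle_sign_def)
qed

text \<open>Shuffle signs are multiplicative over disjoint unions in either argument and
  cardinalities add, so both sides collect the same pairwise signs.\<close>

lemma wedge_sign_assoc: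
  fixes I\<^sub>1 I\<^sub>2 I\<^sub>3 J\<^sub>1 J\<^sub>2 J\<^sub>3 :: "'n::{finite,linorder} set"
  assumes "I\<^sub>1 \<inter> I\<^sub>2 = {}" "I\<^sub>2 \<inter> I\<^sub>3 = {}" "J\<^sub>1 \<inter> J\<^sub>2 = {}" "J\<^sub>2 \<inter> J\<^sub>3 = {}"
  shows "wedge_sign (I\<^sub>1 \<union> I\<^sub>2) (J\<^sub>1 \<union> J\<^sub>2) I\<^sub>3 J\<^sub>3 * wedge_sign I\<^sub>1 J\<^sub>1 I\<^sub>2 J\<^sub>2 =
    wedge_sign I\<^sub>1 J\<^sub>1 (I\<^sub>2 \<union> I\<^sub>3) (J\<^sub>2 \<union> J\<^sub>3) * wedge_sign I\<^sub>2 J\<^sub>2 I\<^sub>3 J\<^sub>3"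
proof -
  have "card (J\<^sub>1 \<union> J\<^sub>2) * card I\<^sub>3 + card J\<^sub>1 * card I\<^sub>2 = card J\<^sub>1 * card (I\<^sub>2 \<union> I\<^sub>3) + card J\<^sub>2 * card I\<^sub>3"
    using assms by (simp add: card_Un_disjoint algebra_simps)
  then have "(-1::real) ^ (card (J\<^sub>1 \<union> J\<^sub>2) * card I\<^sub>3) * (-1) ^ (card J\<^sub>1 * card I\<^sub>2) =
      (-1) ^ (card J\<^sub>1 * card (I\<^sub>2 \<union> I\<^sub>3)) * (-1) ^ (card J\<^sub>2 * card I\<^sub>3)"
    by (simp only: power_add[symmetric])
  then show ?thesis
    using assms unfolding wedge_sign_def
    by (simp add: shuffle_sign_Un_left shuffle_sign_Un_right)
qed

text \<open>Both sides run over all ordered partitions of \<open>P\<close> into three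
  blocks.\<close>

lemma sum_Pow_Pow:
  fixes P :: "'n::finite set"
  shows "(\<Sum>I\<in>Pow P. \<Sum>I\<^sub>1\<in>Pow I. f I\<^sub>1 (I - I\<^sub>1) (P - I)) =
    (\<Sum>I\<^sub>1\<in>Pow P. \<Sum>I\<^sub>2\<in>Pow (P - I\<^sub>1). f I\<^sub>1 I\<^sub>2 (P - I\<^sub>1 - I\<^sub>2))"
  unfolding sum.Sigma[OF finite ballI[OF finite]]
proof (rule sum.reindex_bij_witness[where i="\<lambda>(I\<^sub>1, I\<^sub>2). (I\<^sub>1 \<union> I\<^sub>2, I\<^sub>1)" and j="\<lambda>(I, I\<^sub>1). (I\<^sub>1, I - I\<^sub>1)"]; clarsimp)
  fix I I\<^sub>1 assume "I \<subseteq> P" "I\<^sub>1 \<subseteq> I"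
  then have "P - I\<^sub>1 - (I - I\<^sub>1) = P - I" by auto
  then show "f I\<^sub>1 (I - I\<^sub>1) (P - I\<^sub>1 - (I - I\<^sub>1)) = f I\<^sub>1 (I - I\<^sub>1) (P - I)" by simp
qed auto

lemma sum_sum_delta:
  assumes "finite A" "finite B"
  shows "(\<Sum>I\<in>A. \<Sum>J\<in>B. if I = K \<and> J = L then f I J else 0) =
    (if K \<in> A \<and> L \<in> B then f K L else (0::real))"
proof -
  have "(\<Sum>I\<in>A. \<Sum>J\<in>B. if I = K \<and> J = L then f I J else 0) =
      (\<Sum>I\<in>A. if I = K then \<Sum>J\<in>B. if J = L then f K J else 0 else 0)"
    by (intro sum.cong refl) auto
  then show ?thesis using assms by simp
qed

section \<open>The exterior algebra as a real algebra\<close>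

instantiation ext :: ("{finite,linorder}") real_algebra_1
begin

definition "0 = Ext (\<lambda>I J. 0)"
definition "1 = Ext (\<lambda>I J. if I = {} \<and> J = {} then 1 else 0)"
definition "a + b = Ext (\<lambda>I J. coeff a I J + coeff b I J)"
definition "- a = Ext (\<lambda>I J. - coeff a I J)"
definition "a - b = Ext (\<lambda>I J. coeff a I J - coeff b I J)"
definition "c *\<^sub>R a = Ext (\<lambda>I J. c * coeff a I J)"
definition "a * b = Ext (\<lambda>P Q. \<Sum>I\<in>Pow P. \<Sum>J\<in>Pow Q.
  wedge_sign I J (P - I) (Q - J) * coeff a I J * coeff b (P - I) (Q - J))"

lemma coeff_mult_unfold: "coeff (a * b) P Q = (\<Sum>I\<in>Pow P. \<Sum>J\<in>Pow Q.
    wedge_sign I J (P - I) (Q - J) * coeff a I J * coeff b (P - I) (Q - J))"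
  by (simp add: times_ext_def)

text \<open>Both products sum over splittings of \<open>P\<close> and of \<open>Q\<close> into three
  blocks. The two index sets are reindexed separately, and the interchanges of sums bring together
  the pair to be reindexed.\<close>

lemma coeff_mult_assoc: "coeff (a * b * c) P Q = coeff (a * (b * c)) P (Q :: 'a set)"
proof -
  define F where "F I\<^sub>1 I\<^sub>2 I\<^sub>3 J\<^sub>1 J\<^sub>2 J\<^sub>3 = wedge_sign (I\<^sub>1 \<union> I\<^sub>2) (J\<^sub>1 \<union> J\<^sub>2) I\<^sub>3 J\<^sub>3 * wedge_sign I\<^sub>1 J\<^sub>1 I\<^sub>2 J\<^sub>2 *
    (coeff a I\<^sub>1 J\<^sub>1 * coeff b I\<^sub>2 J\<^sub>2 * coeff c I\<^sub>3 J\<^sub>3)" for I\<^sub>1 I\<^sub>2 I\<^sub>3 J\<^sub>1 J\<^sub>2 J\<^sub>3 :: "'a set"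
  have "coeff (a * b * c) P Q = (\<Sum>I\<in>Pow P. \<Sum>J\<in>Pow Q. \<Sum>I\<^sub>1\<in>Pow I. \<Sum>J\<^sub>1\<in>Pow J.
      F I\<^sub>1 (I - I\<^sub>1) (P - I) J\<^sub>1 (J - J\<^sub>1) (Q - J))"
    unfolding coeff_mult_unfold sum_distrib_left sum_distrib_right F_def
    by (intro sum.cong refl) (auto simp: Un_absorb1 mult_ac)
  also have "\<dots> = (\<Sum>I\<in>Pow P. \<Sum>I\<^sub>1\<in>Pow I. \<Sum>J\<in>Pow Q. \<Sum>J\<^sub>1\<in>Pow J.
      F I\<^sub>1 (I - I\<^sub>1) (P - I) J\<^sub>1 (J - J\<^sub>1) (Q - J))"
    by (intro sum.cong refl sum.swap)
  also have "\<dots> = (\<Sum>I\<in>Pow P. \<Sum>I\<^sub>1\<in>Pow I. \<Sum>J\<^sub>1\<in>Pow Q. \<Sum>J\<^sub>2\<in>Pow (Q - J\<^sub>1).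
      F I\<^sub>1 (I - I\<^sub>1) (P - I) J\<^sub>1 J\<^sub>2 (Q - J\<^sub>1 - J\<^sub>2))"
    by (intro sum.cong refl sum_Pow_Pow)
  also have "\<dots> = (\<Sum>I\<^sub>1\<in>Pow P. \<Sum>I\<^sub>2\<in>Pow (P - I\<^sub>1). \<Sum>J\<^sub>1\<in>Pow Q. \<Sum>J\<^sub>2\<in>Pow (Q - J\<^sub>1).
      F I\<^sub>1 I\<^sub>2 (P - I\<^sub>1 - I\<^sub>2) J\<^sub>1 J\<^sub>2 (Q - J\<^sub>1 - J\<^sub>2))"
    by (rule sum_Pow_Pow)
  also have "\<dots> = (\<Sum>I\<^sub>1\<in>Pow P. \<Sum>J\<^sub>1\<in>Pow Q. \<Sum>I\<^sub>2\<in>Pow (P - I\<^sub>1). \<Sum>J\<^sub>2\<in>Pow (Q - J\<^sub>1).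
      F I\<^sub>1 I\<^sub>2 (P - I\<^sub>1 - I\<^sub>2) J\<^sub>1 J\<^sub>2 (Q - J\<^sub>1 - J\<^sub>2))"
    by (intro sum.cong refl sum.swap)
  also have "\<dots> = coeff (a * (b * c)) P Q"
    unfolding coeff_mult_unfold sum_distrib_left sum_distrib_right
  proof (intro sum.cong refl)
    fix I\<^sub>1 J\<^sub>1 I\<^sub>2 J\<^sub>2 assume A: "I\<^sub>1 \<in> Pow P" "J\<^sub>1 \<in> Pow Q" "I\<^sub>2 \<in> Pow (P - I\<^sub>1)" "J\<^sub>2 \<in> Pow (Q - J\<^sub>1)"
    then have "I\<^sub>2 \<union> (P - I\<^sub>1 - I\<^sub>2) = P - I\<^sub>1" "J\<^sub>2 \<union> (Q - J\<^sub>1 - J\<^sub>2) = Q - J\<^sub>1" by auto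
    then show "F I\<^sub>1 I\<^sub>2 (P - I\<^sub>1 - I\<^sub>2) J\<^sub>1 J\<^sub>2 (Q - J\<^sub>1 - J\<^sub>2) =
        wedge_sign I\<^sub>1 J\<^sub>1 (P - I\<^sub>1) (Q - J\<^sub>1) * coeff a I\<^sub>1 J\<^sub>1 *
        (wedge_sign I\<^sub>2 J\<^sub>2 (P - I\<^sub>1 - I\<^sub>2) (Q - J\<^sub>1 - J\<^sub>2) * coeff b I\<^sub>2 J\<^sub>2 * coeff c (P - I\<^sub>1 - I\<^sub>2) (Q - J\<^sub>1 - J\<^sub>2))"
      using A wedge_sign_assoc[of I\<^sub>1 I\<^sub>2 "P - I\<^sub>1 - I\<^sub>2" J\<^sub>1 J\<^sub>2 "Q - J\<^sub>1 - J\<^sub>2"]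
      unfolding F_def by (auto simp: mult_ac)
  qed
  finally show ?thesis .
qed

lemma coeff_one_mult: "coeff (1 * a) P Q = coeff a P (Q :: 'a set)"
proof -
  have "coeff (1 * a) P Q = (\<Sum>I\<in>Pow P. \<Sum>J\<in>Pow Q. if I = {} \<and> J = {} then
      wedge_sign I J (P - I) (Q - J) * coeff a (P - I) (Q - J) else 0)"
    unfolding coeff_mult_unfold one_ext_def by (intro sum.cong refl) simp
  then show ?thesis by (simp add: sum_sum_delta wedge_sign_def)
qed

lemma coeff_mult_one: "coeff (a * 1) P Q = coeff a P (Q :: 'a set)"
proof -
  have "coeff (a * 1) P Q = (\<Sum>I\<in>Pow P. \<Sum>J\<in>Pow Q. if I = P \<and> J = Q then
      wedge_sign I J (P - I) (Q - J) * coeff a I J else 0)"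
    unfolding coeff_mult_unfold one_ext_def by (intro sum.cong refl) auto
  then show ?thesis by (simp add: sum_sum_delta wedge_sign_def)
qed

instance
proof
  fix a b c :: "'a ext" and r s :: real
  show "a + b + c = a + (b + c)" "a + b = b + a" "0 + a = a" "- a + a = 0" "a - b = a + - b"
    "r *\<^sub>R (a + b) = r *\<^sub>R a + r *\<^sub>R b" "(r + s) *\<^sub>R a = r *\<^sub>R a + s *\<^sub>R a"
    "r *\<^sub>R s *\<^sub>R a = (r * s) *\<^sub>R a" "1 *\<^sub>R a = a"
    by (auto simp: plus_ext_def zero_ext_def uminus_ext_def minus_ext_def scaleR_ext_def
        algebra_simps intro!: ext_eqI)
  show "a * b * c = a * (b * c)" by (rule ext_eqI) (rule coeff_mult_assoc)
  show "1 * a = a" "a * 1 = a" by (rule ext_eqI, simp only: coeff_one_mult coeff_mult_one)+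
  show "(a + b) * c = a * c + b * c" "a * (b + c) = a * b + a * c"
    by (auto simp: plus_ext_def times_ext_def algebra_simps sum.distrib intro!: ext_eqI)
  show "r *\<^sub>R a * b = r *\<^sub>R (a * b)" "a * r *\<^sub>R b = r *\<^sub>R (a * b)"
    by (auto simp: scaleR_ext_def times_ext_def mult_ac sum_distrib_left intro!: ext_eqI sum.cong)
  have "coeff (0 :: 'a ext) {} {} \<noteq> coeff 1 {} {}"
    by (simp add: zero_ext_def one_ext_def)
  then show "(0 :: 'a ext) \<noteq> 1" by metis
qed

end

lemma coeff_simps [simp]:
  "coeff 0 I J = 0" "coeff (a + b) I J = coeff a I J + coeff b I J"
  "coeff (- a) I J = - coeff a I J" "coeff (a - b) I J = coeff a I J - coeff b I J"
  "coeff (c *\<^sub>R a) I J = c * coeff a I J"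
  by (simp_all add: zero_ext_def plus_ext_def uminus_ext_def minus_ext_def scaleR_ext_def)

lemma coeff_sum [simp]: "coeff (sum f S) I J = (\<Sum>i\<in>S. coeff (f i) I J)"
  by (induction S rule: infinite_finite_induct) auto

definition monomial :: "'n::{finite,linorder} set \<Rightarrow> 'n set \<Rightarrow> 'n ext" where
  "monomial K L = Ext (\<lambda>I J. if I = K \<and> J = L then 1 else 0)"

lemma coeff_monomial: "coeff (monomial K L) I J = (if I = K \<and> J = L then 1 else 0)"
  by (simp add: monomial_def)

lemma monomial_mult:
  "monomial I J * monomial K L =
    (if I \<inter> K = {} \<and> J \<inter> L = {} then wedge_sign I J K L *\<^sub>R monomial (I \<union> K) (J \<union> L) else 0)"
proof (rule ext_eqI)
  fix P Q
  have "coeff (monomial I J * monomial K L) P Q =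
      (\<Sum>I'\<in>Pow P. \<Sum>J'\<in>Pow Q. if I' = I \<and> J' = J then
        wedge_sign I' J' (P - I') (Q - J') * coeff (monomial K L) (P - I') (Q - J') else 0)"
    unfolding coeff_mult_unfold coeff_monomial[of I J] by (intro sum.cong refl) simp
  also have "\<dots> = (if I \<subseteq> P \<and> J \<subseteq> Q \<and> P - I = K \<and> Q - J = L then wedge_sign I J K L else 0)"
    by (auto simp: coeff_monomial sum_sum_delta)
  also have "(I \<subseteq> P \<and> J \<subseteq> Q \<and> P - I = K \<and> Q - J = L) \<longleftrightarrow>
      (I \<inter> K = {} \<and> J \<inter> L = {}) \<and> P = I \<union> K \<and> Q = J \<union> L"
    by auto
  finally show "coeff (monomial I J * monomial K L) P Q =
      coeff (if I \<inter> K = {} \<and> J \<inter> L = {} then wedge_sign I J K L *\<^sub>R monomial (I \<union> K) (J \<union> L) else 0) P Q"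
    by (auto simp: coeff_monomial)
qed

section \<open>One-forms, their squares, and beta\<close>

definition dx :: "'n::{finite,linorder} \<Rightarrow> 'n ext" where "dx i = monomial {i} {}"
definition dxi :: "'n::{finite,linorder} \<Rightarrow> 'n ext" where "dxi i = monomial {} {i}"

lemma dx_dx: "dx i * dx j = - (dx j * dx i)"
  and dxi_dxi: "dxi i * dxi j = - (dxi j * dxi i)"
  and dxi_dx: "dxi i * dx j = - (dx j * dxi i)"
  by (auto simp: dx_def dxi_def monomial_mult wedge_sign_def shuffle_sign_singleton insert_commute
      simp del: scaleR_minus1_left)

definition dx_form :: "real^'n::{finite,linorder} \<Rightarrow> 'n ext" where
  "dx_form c = (\<Sum>i\<in>UNIV. c $ i *\<^sub>R dx i)"

definition dxi_form :: "real^'n::{finite,linorder} \<Rightarrow> 'n ext" where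
  "dxi_form c = (\<Sum>i\<in>UNIV. c $ i *\<^sub>R dxi i)"

text \<open>For eta = \<open>dx_form c\<close> the second factor is J(eta), so this is the
  elementary positive form eta wedge J(eta) on which weak positivity is tested. At c = x it is the
  form theta.\<close>

definition square_form :: "real^'n::{finite,linorder} \<Rightarrow> 'n ext" where
  "square_form c = dx_form c * dxi_form c"

definition beta :: "'n::{finite,linorder} ext" where
  "beta = (\<Sum>j\<in>UNIV. dx j * dxi j)"

lemma linear_dx_form: "linear dx_form" and linear_dxi_form: "linear dxi_form"
  by (auto intro!: linearI simp: dx_form_def dxi_form_def algebra_simps sum.distrib scaleR_sum_right)

lemma dx_form_axis: "dx_form (axis i 1) = dx i" and dxi_form_axis: "dxi_form (axis i 1) = dxi i"
  by (auto simp: dx_form_def dxi_form_def axis_def if_distrib[of "\<lambda>c. c *\<^sub>R _"] cong: if_cong)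

lemma dx_form_anticommute: "dx_form c * dx_form d = - (dx_form d * dx_form c)"
proof -
  have "dx_form c * dx_form d = (\<Sum>i\<in>UNIV. \<Sum>j\<in>UNIV. (c $ i * d $ j) *\<^sub>R (dx i * dx j))"
    by (simp add: dx_form_def sum_product mult_ac)
  also have "\<dots> = (\<Sum>i\<in>UNIV. \<Sum>j\<in>UNIV. - ((c $ i * d $ j) *\<^sub>R (dx j * dx i)))"
    by (subst dx_dx) simp
  also have "\<dots> = - (dx_form d * dx_form c)"
    by (subst sum.swap) (simp add: dx_form_def sum_product sum_negf mult_ac)
  finally show ?thesis .
qed

lemma dxi_form_anticommute: "dxi_form c * dxi_form d = - (dxi_form d * dxi_form c)"
proof -
  have "dxi_form c * dxi_form d = (\<Sum>i\<in>UNIV. \<Sum>j\<in>UNIV. (c $ i * d $ j) *\<^sub>R (dxi i * dxi j))"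
    by (simp add: dxi_form_def sum_product mult_ac)
  also have "\<dots> = (\<Sum>i\<in>UNIV. \<Sum>j\<in>UNIV. - ((c $ i * d $ j) *\<^sub>R (dxi j * dxi i)))"
    by (subst dxi_dxi) simp
  also have "\<dots> = - (dxi_form d * dxi_form c)"
    by (subst sum.swap) (simp add: dxi_form_def sum_product sum_negf mult_ac)
  finally show ?thesis .
qed

lemma dxi_dx_form_anticommute: "dxi_form c * dx_form d = - (dx_form d * dxi_form c)"
proof -
  have "dxi_form c * dx_form d = (\<Sum>i\<in>UNIV. \<Sum>j\<in>UNIV. (c $ i * d $ j) *\<^sub>R (dxi i * dx j))"
    by (simp add: dxi_form_def dx_form_def sum_product mult_ac)
  also have "\<dots> = (\<Sum>i\<in>UNIV. \<Sum>j\<in>UNIV. - ((c $ i * d $ j) *\<^sub>R (dx j * dxi i)))"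
    by (subst dxi_dx) simp
  also have "\<dots> = - (dx_form d * dxi_form c)"
    by (subst sum.swap) (simp add: dxi_form_def dx_form_def sum_product sum_negf mult_ac)
  finally show ?thesis .
qed

lemma square_form_scale: "square_form (h *\<^sub>R c) = h\<^sup>2 *\<^sub>R square_form c"
  by (simp add: square_form_def linear_scale[OF linear_dx_form] linear_scale[OF linear_dxi_form] power2_eq_square)

lemma square_form_commute_dx_form: "square_form c * dx_form d = dx_form d * square_form c"
proof -
  have "square_form c * dx_form d = dx_form c * (dxi_form c * dx_form d)"
    by (simp add: square_form_def mult.assoc)
  also have "\<dots> = - (dx_form c * dx_form d) * dxi_form c"
    by (simp add: dxi_dx_form_anticommute mult.assoc)
  also have "\<dots> = dx_form d * square_form c"
    by (simp add: dx_form_anticommute[of c d] square_form_def mult.assoc)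
  finally show ?thesis .
qed

lemma square_form_commute_dxi_form: "square_form c * dxi_form d = dxi_form d * square_form c"
proof -
  have "square_form c * dxi_form d = dx_form c * (dxi_form c * dxi_form d)"
    by (simp add: square_form_def mult.assoc)
  also have "\<dots> = - (dx_form c * dxi_form d) * dxi_form c"
    by (simp add: dxi_form_anticommute[of c d] mult.assoc)
  also have "\<dots> = dxi_form d * square_form c"
    by (simp add: dxi_dx_form_anticommute square_form_def mult.assoc[symmetric])
  finally show ?thesis .
qed

lemma beta_eq_sum_square_form: "beta = (\<Sum>j\<in>UNIV. square_form (axis j 1))"
  by (simp add: beta_def square_form_def dx_form_axis dxi_form_axis)

lemma beta_commute_dx_form: "beta * dx_form d = dx_form d * beta"
  and beta_commute_dxi_form: "beta * dxi_form d = dxi_form d * beta"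
  by (simp_all add: beta_eq_sum_square_form sum_distrib_left sum_distrib_right
      square_form_commute_dx_form square_form_commute_dxi_form)

lemma beta_commute_square_form: "beta * square_form c = square_form c * beta"
  by (metis (no_types, lifting) beta_commute_dx_form beta_commute_dxi_form mult.assoc square_form_def)

lemma square_form_square: "square_form c * square_form c = 0"
proof -
  have "dx_form c * dx_form c + dx_form c * dx_form c = 0"
    using dx_form_anticommute[of c c] by (metis add.right_inverse)
  then have "2 *\<^sub>R (dx_form c * dx_form c) = 0" by (simp only: scaleR_2)
  then have 0: "dx_form c * dx_form c = 0" by simp
  have "square_form c * square_form c = dx_form c * square_form c * dxi_form c"
    by (metis square_form_def mult.assoc square_form_commute_dx_form)
  also have "\<dots> = (dx_form c * dx_form c) * (dxi_form c * dxi_form c)"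
    by (simp add: square_form_def mult.assoc)
  finally show ?thesis by (simp add: 0)
qed

text \<open>The form version of |x|^2 |y|^2 - (x.y)^2 = sum over i < j of (x_i y_j - x_j y_i)^2.
  Summing over ordered pairs counts each term twice, hence the factor 2; the diagonal contributes
  nothing.\<close>

lemma lagrange_identity:
  "(\<Sum>i\<in>UNIV. \<Sum>j\<in>UNIV. square_form (x $ i *\<^sub>R axis j 1 - x $ j *\<^sub>R axis i 1)) =
    2 *\<^sub>R ((x \<bullet> x) *\<^sub>R beta - square_form x)"
proof -
  have e: "square_form (x $ i *\<^sub>R axis j 1 - x $ j *\<^sub>R axis i 1) =
      (x $ i * x $ i) *\<^sub>R (dx j * dxi j) + (x $ j * x $ j) *\<^sub>R (dx i * dxi i)
      - (x $ i * x $ j) *\<^sub>R (dx i * dxi j) - (x $ i * x $ j) *\<^sub>R (dx j * dxi i)" for i j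
    by (simp add: square_form_def linear_diff[OF linear_dx_form] linear_diff[OF linear_dxi_form]
        linear_scale[OF linear_dx_form] linear_scale[OF linear_dxi_form] dx_form_axis dxi_form_axis
        algebra_simps)
  have 1: "(\<Sum>i\<in>UNIV. \<Sum>j\<in>UNIV. (x $ i * x $ i) *\<^sub>R (dx j * dxi j)) = (x \<bullet> x) *\<^sub>R beta"
    unfolding inner_vec_def beta_def scaleR_sum_left scaleR_sum_right by (subst sum.swap) simp
  then have 2: "(\<Sum>i\<in>UNIV. \<Sum>j\<in>UNIV. (x $ j * x $ j) *\<^sub>R (dx i * dxi i)) = (x \<bullet> x) *\<^sub>R beta"
    by (subst sum.swap)
  have 3: "(\<Sum>i\<in>UNIV. \<Sum>j\<in>UNIV. (x $ i * x $ j) *\<^sub>R (dx i * dxi j)) = square_form x"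
    by (simp add: square_form_def dx_form_def dxi_form_def sum_product mult.commute)
  then have 4: "(\<Sum>i\<in>UNIV. \<Sum>j\<in>UNIV. (x $ i * x $ j) *\<^sub>R (dx j * dxi i)) = square_form x"
    by (subst sum.swap) (simp add: mult.commute)
  have "a + a - b - b = 2 *\<^sub>R (a - b)" for a b :: "'a ext"
    by (simp add: scaleR_2)
  then show ?thesis
    unfolding e sum.distrib sum_subtractf 1 2 3 4 .
qed

text \<open>The binomial expansion stops after the linear term because \<open>b\<close> squares to
  zero.\<close>

lemma diff_power_nilpotent:
  fixes a b :: "'a::ring_1"
  assumes ab: "a * b = b * a" and b: "b * b = 0"
  shows "(a - b) ^ Suc k = a ^ Suc k - of_nat (Suc k) * (a ^ k * b)"
proof (induction k)
  case (Suc k)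
  have c: "a ^ n * b = b * a ^ n" for n
    by (metis ab power_commuting_commutes)
  have "(a - b) ^ Suc (Suc k) = (a ^ Suc k - of_nat (Suc k) * (a ^ k * b)) * (a - b)"
    by (simp only: power_Suc2[of _ "Suc k"] Suc.IH)
  also have "\<dots> = a ^ Suc (Suc k) - a ^ Suc k * b - of_nat (Suc k) * (a ^ k * (b * a))
      + of_nat (Suc k) * (a ^ k * (b * b))"
    by (simp add: algebra_simps power_Suc2 del: of_nat_Suc power_Suc)
  also have "a ^ k * (b * a) = a ^ Suc k * b"
    by (simp add: ab[symmetric] power_Suc2 mult.assoc del: power_Suc)
  finally show ?case
    by (simp add: b algebra_simps)
qed (simp)

section \<open>Superforms as functions with values in the algebra\<close>

definition sform :: "(real^'n::{finite,linorder} \<Rightarrow> 'n ext) \<Rightarrow> 'n superform" where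
  "sform F = (\<lambda>x. coeff (F x))"

lemma sform_wedge: "sform F \<and>\<^sub>s sform G = sform (\<lambda>x. F x * G x)"
  by (simp add: sform_def sf_wedge_def coeff_mult_unfold wedge_sign_def fun_eq_iff)

lemma sform_fun: "sf_fun f = sform (\<lambda>x. f x *\<^sub>R 1)"
  by (auto simp: sf_fun_def sform_def fun_eq_iff one_ext_def)

lemma sform_scale: "sf_scale c (sform F) = sform (\<lambda>x. c *\<^sub>R F x)"
  by (simp add: sf_scale_def sform_def fun_eq_iff)

text \<open>A list fixes the order of the factors, since multiplication of forms is not
  commutative.\<close>

lemma sform_prod: "sf_prod (\<lambda>j. sform (F j)) k = sform (\<lambda>x. prod_list (map (\<lambda>j. F j x) [0..<k]))"
  by (induction k) (simp_all add: sform_fun sform_wedge)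

lemma sform_power:
  fixes F :: "real^'n::{finite,linorder} \<Rightarrow> 'n ext"
  shows "sf_power (sform F) k = sform (\<lambda>x. F x ^ k)"
proof -
  have "prod_list (map (\<lambda>j. a) [0..<k]) = a ^ k" for a :: "'n ext" and k
    by (induction k) (auto simp: power_commutes)
  then show ?thesis by (simp add: sf_power_def sform_prod)
qed

lemma sform_dx: "sf_dx i = sform (\<lambda>x. dx i)" and sform_dxi: "sf_dxi i = sform (\<lambda>x. dxi i)"
  by (auto simp: sf_dx_def sf_dxi_def sform_def dx_def dxi_def monomial_def)

lemma sform_beta: "sf_beta = sform (\<lambda>x. beta)"
  unfolding sf_beta_def sform_dx sform_dxi sform_wedge
  by (simp add: sform_def beta_def fun_eq_iff)

lemma coeff_dx_form: "coeff (dx_form c) I J = (\<Sum>i\<in>UNIV. c $ i * coeff (dx i) I J)"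
  and coeff_dxi_form: "coeff (dxi_form c) I J = (\<Sum>i\<in>UNIV. c $ i * coeff (dxi i) I J)"
  by (simp_all add: dx_form_def dxi_form_def)

lemma sform_J_dx_form:
  fixes c :: "real^'n::{finite,linorder} \<Rightarrow> real^'n::{finite,linorder}"
  shows "sf_J (sform (\<lambda>x. dx_form (c x))) = sform (\<lambda>x. dxi_form (c x))"
proof -
  have "(-1) ^ (card K + card K * card L) * coeff (dx i) L K = coeff (dxi i) K L" for K L and i :: 'n
    by (auto simp: dx_def dxi_def coeff_monomial)
  then show ?thesis
    by (simp add: sf_J_def sform_def coeff_dx_form coeff_dxi_form sum_distrib_left fun_eq_iff mult.left_commute)
qed

definition smooth_ext :: "(real^'n::{finite,linorder} \<Rightarrow> 'n ext) \<Rightarrow> bool" where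
  "smooth_ext F \<longleftrightarrow> (\<forall>I J. smooth (\<lambda>x. coeff (F x) I J))"

definition smooth_vec :: "(real^'n::finite \<Rightarrow> real^'n) \<Rightarrow> bool" where
  "smooth_vec c \<longleftrightarrow> (\<forall>i. smooth (\<lambda>x. c x $ i))"

lemma smooth_ext_const: "smooth_ext (\<lambda>x. a)"
  by (simp add: smooth_ext_def smooth_const)

lemma smooth_ext_scaleR: "smooth f \<Longrightarrow> smooth_ext F \<Longrightarrow> smooth_ext (\<lambda>x. f x *\<^sub>R F x)"
  by (simp add: smooth_ext_def smooth_mult)

lemma smooth_ext_mult: "smooth_ext F \<Longrightarrow> smooth_ext G \<Longrightarrow> smooth_ext (\<lambda>x. F x * G x)"
  unfolding smooth_ext_def coeff_mult_unfold
  by (intro allI smooth_sum smooth_mult smooth_const) auto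

lemma smooth_ext_sum: "(\<And>i. i \<in> S \<Longrightarrow> smooth_ext (F i)) \<Longrightarrow> smooth_ext (\<lambda>x. \<Sum>i\<in>S. F i x)"
  unfolding smooth_ext_def by (auto intro!: smooth_sum)

lemma smooth_ext_power: "smooth_ext F \<Longrightarrow> smooth_ext (\<lambda>x. F x ^ k)"
  by (induction k) (auto intro: smooth_ext_const smooth_ext_mult)

lemma smooth_ext_prod_list:
  "(\<And>c. c \<in> set cs \<Longrightarrow> smooth_ext (F c)) \<Longrightarrow> smooth_ext (\<lambda>x. prod_list (map (\<lambda>c. F c x) cs))"
  by (induction cs) (auto intro: smooth_ext_const smooth_ext_mult)

lemma smooth_ext_dx_form: "smooth_vec c \<Longrightarrow> smooth_ext (\<lambda>x. dx_form (c x))"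
  and smooth_ext_dxi_form: "smooth_vec c \<Longrightarrow> smooth_ext (\<lambda>x. dxi_form (c x))"
  unfolding smooth_ext_def smooth_vec_def coeff_dx_form coeff_dxi_form
  by (auto intro!: smooth_sum smooth_mult smooth_const)

lemma smooth_ext_square_form: "smooth_vec c \<Longrightarrow> smooth_ext (\<lambda>x. square_form (c x))"
  unfolding square_form_def by (intro smooth_ext_mult smooth_ext_dx_form smooth_ext_dxi_form)

lemma smooth_vec_id: "smooth_vec (\<lambda>x. x)" and smooth_vec_const: "smooth_vec (\<lambda>x. a)"
  and smooth_vec_scale: "smooth f \<Longrightarrow> smooth_vec c \<Longrightarrow> smooth_vec (\<lambda>x. f x *\<^sub>R c x)"
  and smooth_vec_diff: "smooth_vec c \<Longrightarrow> smooth_vec d \<Longrightarrow> smooth_vec (\<lambda>x. c x - d x)"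
  by (auto simp: smooth_vec_def intro: smooth_coord smooth_const smooth_mult smooth_diff)

definition bihomogeneous :: "nat \<Rightarrow> nat \<Rightarrow> 'n::{finite,linorder} ext \<Rightarrow> bool" where
  "bihomogeneous p q a \<longleftrightarrow> (\<forall>I J. coeff a I J \<noteq> 0 \<longrightarrow> card I = p \<and> card J = q)"

lemma bihomogeneous_scaleR: "bihomogeneous p q a \<Longrightarrow> bihomogeneous p q (c *\<^sub>R a)"
  by (auto simp: bihomogeneous_def)

lemma bihomogeneous_add: "bihomogeneous p q a \<Longrightarrow> bihomogeneous p q b \<Longrightarrow> bihomogeneous p q (a + b)"
  unfolding bihomogeneous_def by (metis add_0 coeff_simps(2))

lemma bihomogeneous_sum: "(\<And>i. i \<in> S \<Longrightarrow> bihomogeneous p q (F i)) \<Longrightarrow> bihomogeneous p q (sum F S)"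
proof (induction S rule: infinite_finite_induct)
  case (insert i S)
  then show ?case by (simp add: bihomogeneous_add)
qed (simp_all add: bihomogeneous_def)

lemma bihomogeneous_mult:
  assumes "bihomogeneous p q a" "bihomogeneous r s b"
  shows "bihomogeneous (p + r) (q + s) (a * b)"
  unfolding bihomogeneous_def
proof (intro allI impI)
  fix P Q assume "coeff (a * b) P Q \<noteq> 0"
  then obtain I where I: "I \<in> Pow P" "(\<Sum>J\<in>Pow Q. wedge_sign I J (P - I) (Q - J) * coeff a I J * coeff b (P - I) (Q - J)) \<noteq> 0"
    unfolding coeff_mult_unfold by (rule sum.not_neutral_contains_not_neutral)
  from I(2) obtain J where J: "J \<in> Pow Q" "wedge_sign I J (P - I) (Q - J) * coeff a I J * coeff b (P - I) (Q - J) \<noteq> 0"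
    by (rule sum.not_neutral_contains_not_neutral)
  then have "card I = p" "card J = q" "card (P - I) = r" "card (Q - J) = s"
    using assms by (auto simp: bihomogeneous_def)
  moreover have "card P = card I + card (P - I)" "card Q = card J + card (Q - J)"
    using I(1) J(1) by (auto simp: card_Diff_subset card_mono)
  ultimately show "card P = p + r \<and> card Q = q + s" by simp
qed

lemma bihomogeneous_one: "bihomogeneous 0 0 1"
  by (auto simp: bihomogeneous_def one_ext_def)

lemma bihomogeneous_power: "bihomogeneous p q a \<Longrightarrow> bihomogeneous (k * p) (k * q) (a ^ k)"
  by (induction k) (auto simp: bihomogeneous_one intro: bihomogeneous_mult)

lemma bihomogeneous_prod_list:
  "(\<And>a. a \<in> set as \<Longrightarrow> bihomogeneous p q a) \<Longrightarrow> bihomogeneous (length as * p) (length as * q) (prod_list as)"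
  by (induction as) (auto simp: bihomogeneous_one intro: bihomogeneous_mult)

lemma bihomogeneous_dx: "bihomogeneous 1 0 (dx i)" and bihomogeneous_dxi: "bihomogeneous 0 1 (dxi i)"
  by (auto simp: bihomogeneous_def dx_def dxi_def coeff_monomial)

lemma bihomogeneous_dx_form: "bihomogeneous 1 0 (dx_form c)"
  and bihomogeneous_dxi_form: "bihomogeneous 0 1 (dxi_form c)"
  unfolding dx_form_def dxi_form_def
  by (intro bihomogeneous_sum bihomogeneous_scaleR bihomogeneous_dx bihomogeneous_dxi)+

lemma bihomogeneous_square_form: "bihomogeneous 1 1 (square_form c)"
  using bihomogeneous_mult[OF bihomogeneous_dx_form bihomogeneous_dxi_form] by (simp add: square_form_def)

lemma bihomogeneous_beta: "bihomogeneous 1 1 beta"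
  unfolding beta_eq_sum_square_form by (intro bihomogeneous_sum bihomogeneous_square_form)

lemma test_superform_sform:
  assumes "test_fun U \<phi>" "smooth_ext F" "\<And>x. bihomogeneous p q (F x)"
  shows "test_superform U p q (sform (\<lambda>x. \<phi> x *\<^sub>R F x))"
proof -
  obtain K where "compact K" "K \<subseteq> U" "\<And>x. x \<notin> K \<Longrightarrow> \<phi> x = 0"
    using test_funE[OF assms(1)] by metis
  moreover have "smooth_superform (sform (\<lambda>x. \<phi> x *\<^sub>R F x))"
    using smooth_ext_scaleR[OF test_fun_smooth[OF assms(1)] assms(2)]
    by (simp add: smooth_superform_def sform_def smooth_ext_def)
  moreover have "has_bidegree p q (sform (\<lambda>x. \<phi> x *\<^sub>R F x))"
    using assms(3) by (auto simp: has_bidegree_def sform_def bihomogeneous_def)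
  ultimately show ?thesis
    unfolding test_superform_def supported_in_def sform_def by auto
qed

lemma prod_list_scaleR:
  "prod_list (map (\<lambda>j. s *\<^sub>R f j) xs) = s ^ length xs *\<^sub>R (prod_list (map f xs) :: 'a::real_algebra_1)"
  by (induction xs) (auto simp: mult.commute)

lemma power_scaleR: "(s *\<^sub>R a) ^ n = s ^ n *\<^sub>R (a ^ n :: 'a::real_algebra_1)"
  by (induction n) (auto simp: mult_ac)

section \<open>The exterior derivative of a radial test form\<close>

lemma sf_d_radial:
  assumes "smooth \<gamma>"
  shows "sf_d (sform (\<lambda>x. b * (\<gamma> x *\<^sub>R dxi_form x))) = sform (\<lambda>x. \<Sum>k\<in>UNIV. dx k *
    (\<Sum>j\<in>UNIV. (partial k \<gamma> x * x $ j + \<gamma> x * axis k 1 $ j) *\<^sub>R (b * dxi j)))"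
proof -
  define G where "G = (\<lambda>k x. \<Sum>j\<in>UNIV. (partial k \<gamma> x * x $ j + \<gamma> x * axis k 1 $ j) *\<^sub>R (b * dxi j))"
  have "partial k (\<lambda>z. sform (\<lambda>x. b * (\<gamma> x *\<^sub>R dxi_form x)) z I J) x = coeff (G k x) I J" for k I J x
  proof -
    obtain \<gamma>' where \<gamma>': "(\<gamma> has_derivative \<gamma>') (at x)"
      using smooth_imp_differentiable[OF assms] unfolding differentiable_def by blast
    have "((\<lambda>z. \<Sum>j\<in>UNIV. (\<gamma> z * z $ j) * coeff (b * dxi j) I J) has_derivative
        (\<lambda>h. \<Sum>j\<in>UNIV. (\<gamma> x * h $ j + \<gamma>' h * x $ j) * coeff (b * dxi j) I J)) (at x)"
      by (intro has_derivative_sum has_derivative_mult_left has_derivative_mult \<gamma>'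
          bounded_linear_imp_has_derivative bounded_linear_vec_nth)
    from partial_eq[OF this, of k] partial_eq[OF \<gamma>', of k]
    have "partial k (\<lambda>z. \<Sum>j\<in>UNIV. (\<gamma> z * z $ j) * coeff (b * dxi j) I J) x = coeff (G k x) I J"
      by (simp add: G_def add.commute)
    then show ?thesis
      by (simp add: sform_def dxi_form_def scaleR_sum_right sum_distrib_left)
  qed
  then have "sf_dx k \<and>\<^sub>s (\<lambda>y I J. partial k (\<lambda>z. sform (\<lambda>x. b * (\<gamma> x *\<^sub>R dxi_form x)) z I J) y) =
      sform (\<lambda>x. dx k * G k x)" for k
    by (simp add: sform_dx sform_wedge[symmetric]) (simp add: sform_def)
  then show ?thesis
    unfolding sf_d_def by (simp add: sform_def G_def) (simp add: fun_eq_iff)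
qed

text \<open>When gamma depends only on w = |x|^2, its differential is kappa times sum x_k dx_k with
  kappa = 2 gamma'(w), so the derivative terms collect into kappa theta. The constant form
  \<open>b\<close>, later a power of beta, stays in front because it commutes with every
  \<open>dx k\<close>.\<close>

lemma d_radial_form:
  fixes b :: "'n::{finite,linorder} ext"
  assumes "smooth \<gamma>" "\<And>x k. partial k \<gamma> x = \<kappa> x * x $ k" "\<And>k. dx k * b = b * dx k"
  shows "sf_d (sform (\<lambda>x. b * (\<gamma> x *\<^sub>R dxi_form x))) =
    sform (\<lambda>x. \<gamma> x *\<^sub>R (b * beta) + \<kappa> x *\<^sub>R (b * square_form x))"
proof -
  have "(\<Sum>k\<in>UNIV. dx k * (\<Sum>j\<in>UNIV. (\<kappa> x * x $ k * x $ j + \<gamma> x * axis k 1 $ j) *\<^sub>R (b * dxi j))) =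
      \<gamma> x *\<^sub>R (b * beta) + \<kappa> x *\<^sub>R (b * square_form x)" for x
  proof -
    have "dx k * (\<Sum>j\<in>UNIV. (\<kappa> x * x $ k * x $ j + \<gamma> x * axis k 1 $ j) *\<^sub>R (b * dxi j)) =
        \<gamma> x *\<^sub>R (b * (dx k * dxi k)) + \<kappa> x *\<^sub>R (b * ((x $ k *\<^sub>R dx k) * dxi_form x))" for k
    proof -
      have "(\<Sum>j\<in>UNIV. (\<kappa> x * x $ k * x $ j + \<gamma> x * axis k 1 $ j) *\<^sub>R (b * dxi j)) =
          (\<kappa> x * x $ k) *\<^sub>R (b * dxi_form x) + \<gamma> x *\<^sub>R (b * dxi_form (axis k 1))"
        by (simp add: dxi_form_def scaleR_sum_right sum_distrib_left sum.distrib scaleR_left_distrib mult.assoc)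
      moreover have "dx k * (b * y) = b * (dx k * y)" for y
        by (metis assms(3) mult.assoc)
      ultimately show ?thesis
        by (simp add: dxi_form_axis distrib_left add.commute)
    qed
    then show ?thesis
      by (simp add: sum.distrib beta_def square_form_def dx_form_def sum_distrib_left sum_distrib_right
          scaleR_sum_right)
  qed
  then show ?thesis
    by (simp only: sf_d_radial[OF assms(1)] assms(2))
qed

section \<open>Positivity and minimality\<close>

locale positive_supercurrent =
  fixes U :: "(real^'n::{finite,linorder}) set" and m :: nat and T :: "'n supercurrent"
  assumes m_pos: "m \<ge> 1" and current: "supercurrent U m m T" and positive: "weakly_positive U m T"
begin

abbreviation test_field :: "(real^'n::{finite,linorder} \<Rightarrow> 'n ext) \<Rightarrow> bool" where
  "test_field F \<equiv> test_superform U m m (sform F)"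

lemma T_combination:
  assumes "test_field F" "test_field G"
  shows "T (sform (\<lambda>x. s *\<^sub>R F x + t *\<^sub>R G x)) = s * T (sform F) + t * T (sform G)"
proof -
  have "sform (\<lambda>x. s *\<^sub>R F x + t *\<^sub>R G x) = (\<lambda>x I J. s * sform F x I J + t * sform G x I J)"
    by (simp add: sform_def fun_eq_iff)
  moreover have "\<forall>a b s t. test_superform U m m a \<longrightarrow> test_superform U m m b \<longrightarrow>
      T (\<lambda>x I J. s * a x I J + t * b x I J) = s * T a + t * T b"
    using current unfolding supercurrent_def by (elim conjE)
  ultimately show ?thesis
    using assms by simp
qed

lemma T_sum:
  assumes "finite S" "test_fun U \<phi>" "\<And>i. i \<in> S \<Longrightarrow> smooth_ext (F i)"
    "\<And>i x. i \<in> S \<Longrightarrow> bihomogeneous m m (F i x)"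
  shows "T (sform (\<lambda>x. \<phi> x *\<^sub>R (\<Sum>i\<in>S. F i x))) = (\<Sum>i\<in>S. T (sform (\<lambda>x. \<phi> x *\<^sub>R F i x)))"
  using assms
proof (induction S rule: finite_induct)
  case empty
  have "test_field (\<lambda>x. \<phi> x *\<^sub>R 0)"
    using empty by (intro test_superform_sform smooth_ext_const) (auto simp: bihomogeneous_def)
  from T_combination[OF this this, of 0 0] show ?case by simp
next
  case (insert i S)
  have "test_field (\<lambda>x. \<phi> x *\<^sub>R F i x)" "test_field (\<lambda>x. \<phi> x *\<^sub>R (\<Sum>i\<in>S. F i x))"
    using insert.prems by (auto intro!: test_superform_sform smooth_ext_sum bihomogeneous_sum)
  from T_combination[OF this, of 1 1] show ?case
    using insert by (simp add: scaleR_add_right)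
qed

text \<open>A nonnegative smooth \<open>\<phi>\<close> need not be the \<open>2m\<close>-th power of a smooth function, but \<open>\<phi> + \<epsilon>\<close> is.\<close>

lemma positive_prod_list:
  assumes \<phi>: "test_fun U \<phi>" "\<And>x. 0 \<le> \<phi> x" and cs: "length cs = m" "\<And>c. c \<in> set cs \<Longrightarrow> smooth_vec c"
    and U: "open U"
  shows "0 \<le> T (sform (\<lambda>x. \<phi> x *\<^sub>R prod_list (map (\<lambda>c. square_form (c x)) cs)))"
proof -
  define R where "R = (\<lambda>x. prod_list (map (\<lambda>c. square_form (c x)) cs))"
  have R: "smooth_ext R"
    unfolding R_def using cs(2) by (intro smooth_ext_prod_list smooth_ext_square_form)
  have "bihomogeneous (length (map (\<lambda>c. square_form (c x)) cs) * 1) (length (map (\<lambda>c. square_form (c x)) cs) * 1) (R x)" for x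
    unfolding R_def
    by (rule bihomogeneous_prod_list) (auto intro: bihomogeneous_square_form simp del: One_nat_def)
  then have Rm: "bihomogeneous m m (R x)" for x
    by (simp add: cs(1))
  obtain K where K: "compact K" "K \<subseteq> U" "\<And>x. x \<notin> K \<Longrightarrow> \<phi> x = 0"
    using test_funE[OF \<phi>(1)] by metis
  obtain \<eta> where \<eta>: "test_fun U \<eta>" "\<And>x. 0 \<le> \<eta> x" "\<And>x. x \<in> K \<Longrightarrow> \<eta> x = 1"
    using smooth_cutoff[OF K(1) U K(2)] by (metis subsetD)
  have \<eta>m: "test_fun U (\<lambda>x. \<eta> x ^ (2 * m))"
  proof -
    have "test_fun U (\<lambda>x. \<eta> x * \<eta> x ^ (2 * m - 1))"
      by (intro test_fun_mult_left \<eta> smooth_power test_fun_smooth[OF \<eta>(1)])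
    moreover have "\<eta> x * \<eta> x ^ (2 * m - 1) = \<eta> x ^ (2 * m)" for x
      using m_pos by (metis Suc_diff_1 mult_pos_pos pos2 power_Suc less_le_trans zero_less_one)
    ultimately show ?thesis by simp
  qed
  have t: "test_field (\<lambda>x. \<phi> x *\<^sub>R R x)" "test_field (\<lambda>x. \<eta> x ^ (2 * m) *\<^sub>R R x)"
    by (intro test_superform_sform \<phi> \<eta>m R Rm)+
  have "0 \<le> T (sform (\<lambda>x. \<phi> x *\<^sub>R R x)) + \<epsilon> * T (sform (\<lambda>x. \<eta> x ^ (2 * m) *\<^sub>R R x))"
    if \<epsilon>: "\<epsilon> > 0" for \<epsilon>
  proof -
    \<comment> \<open>Each of the m factors contributes h^2, so the product carries h^(2m) =
      eta^(2m) (phi + epsilon). As eta is 1 wherever phi is nonzero, this is phi + epsilon eta^(2m),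
      and the error is a fixed test function times epsilon.\<close>
    define h where "h = (\<lambda>x. \<eta> x * (\<phi> x + \<epsilon>) powr (1 / real (2 * m)))"
    have p: "0 < \<phi> x + \<epsilon>" for x using \<phi>(2)[of x] \<epsilon> by simp
    have h: "test_fun U h"
      unfolding h_def
      by (intro test_fun_mult_left \<eta> smooth_powr smooth_add smooth_const test_fun_smooth[OF \<phi>(1)] p)
    have "h x ^ (2 * m) = \<phi> x + \<epsilon> * \<eta> x ^ (2 * m)" for x
    proof -
      have "((\<phi> x + \<epsilon>) powr (1 / real (2 * m))) ^ (2 * m) = \<phi> x + \<epsilon>"
        using m_pos p[of x] by (simp add: powr_realpow[symmetric] powr_powr)
      then have "h x ^ (2 * m) = \<eta> x ^ (2 * m) * (\<phi> x + \<epsilon>)"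
        by (simp add: h_def power_mult_distrib)
      then show ?thesis
        using K(3)[of x] \<eta>(3)[of x] by (cases "x \<in> K") (auto simp: algebra_simps)
    qed
    then have hm: "(h x)\<^sup>2 ^ m = \<phi> x + \<epsilon> * \<eta> x ^ (2 * m)" for x by (simp add: power_mult)
    define \<alpha> where "\<alpha> = (\<lambda>j. sform (\<lambda>x. dx_form (h x *\<^sub>R (cs ! j) x)))"
    have "\<alpha> j = sform (\<lambda>x. h x *\<^sub>R dx_form ((cs ! j) x))" for j
      by (simp add: \<alpha>_def linear_scale[OF linear_dx_form])
    then have "\<forall>j<m. test_superform U 1 0 (\<alpha> j)"
      using cs by (auto intro!: test_superform_sform h smooth_ext_dx_form bihomogeneous_dx_form simp del: One_nat_def)
    then have "0 \<le> T (sf_prod (\<lambda>j. \<alpha> j \<and>\<^sub>s sf_J (\<alpha> j)) m)"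
      using positive unfolding weakly_positive_def by blast
    also have "sf_prod (\<lambda>j. \<alpha> j \<and>\<^sub>s sf_J (\<alpha> j)) m =
        sform (\<lambda>x. prod_list (map (\<lambda>j. square_form (h x *\<^sub>R (cs ! j) x)) [0..<m]))"
      unfolding \<alpha>_def sform_J_dx_form sform_wedge sform_prod square_form_def ..
    also have "\<dots> = sform (\<lambda>x. 1 *\<^sub>R (\<phi> x *\<^sub>R R x) + \<epsilon> *\<^sub>R (\<eta> x ^ (2 * m) *\<^sub>R R x))"
    proof -
      have "map (\<lambda>j. square_form ((cs ! j) x)) [0..<m] = map (\<lambda>c. square_form (c x)) cs" for x
        using cs(1) by (intro nth_equalityI) auto
      then show ?thesis
        by (simp add: square_form_scale prod_list_scaleR hm R_def scaleR_add_left)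
    qed
    finally show ?thesis
      unfolding T_combination[OF t] by simp
  qed
  from this[of "1 / real (Suc n)" for n]
  have pos: "0 \<le> T (sform (\<lambda>x. \<phi> x *\<^sub>R R x)) + 1 / real (Suc n) * T (sform (\<lambda>x. \<eta> x ^ (2 * m) *\<^sub>R R x))" for n
    by (simp only: zero_less_divide_1_iff of_nat_0_less_iff zero_less_Suc)
  have "(\<lambda>n. T (sform (\<lambda>x. \<phi> x *\<^sub>R R x)) + 1 / real (Suc n) * T (sform (\<lambda>x. \<eta> x ^ (2 * m) *\<^sub>R R x)))
      \<longlonglongrightarrow> T (sform (\<lambda>x. \<phi> x *\<^sub>R R x)) + 0 * T (sform (\<lambda>x. \<eta> x ^ (2 * m) *\<^sub>R R x))"
    by (intro tendsto_intros LIMSEQ_Suc[OF lim_const_over_n[of 1]])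
  then have "0 \<le> T (sform (\<lambda>x. \<phi> x *\<^sub>R R x)) + 0 * T (sform (\<lambda>x. \<eta> x ^ (2 * m) *\<^sub>R R x))"
    by (rule LIMSEQ_le_const) (use pos in blast)
  then show ?thesis by (simp add: R_def)
qed

text \<open>Expanding the power of the sum yields products of m squares, each nonnegative on
  \<open>T\<close> when multiplied by \<open>\<phi>\<close>.\<close>

lemma positive_power:
  assumes \<phi>: "test_fun U \<phi>" "\<And>x. 0 \<le> \<phi> x" and P: "finite P" "\<And>p. p \<in> P \<Longrightarrow> smooth_vec (c p)"
    and U: "open U"
  shows "0 \<le> T (sform (\<lambda>x. \<phi> x *\<^sub>R (\<Sum>p\<in>P. square_form (c p x)) ^ m))"
proof -
  \<comment> \<open>The expansion proceeds one factor at a time: \<open>ps\<close> records the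
    squares already chosen and \<open>l\<close> counts the unexpanded factors.\<close>
  have "0 \<le> T (sform (\<lambda>x. \<phi> x *\<^sub>R (prod_list (map (\<lambda>p. square_form (c p x)) ps) *
      (\<Sum>p\<in>P. square_form (c p x)) ^ l)))"
    if "length ps + l = m" "set ps \<subseteq> P" for ps l
    using that
  proof (induction l arbitrary: ps)
    case 0
    then show ?case
      using positive_prod_list[OF \<phi>, of "map c ps"] P U by (auto simp: comp_def)
  next
    case (Suc l)
    define F where "F = (\<lambda>q x. prod_list (map (\<lambda>p. square_form (c p x)) (ps @ [q])) *
      (\<Sum>p\<in>P. square_form (c p x)) ^ l)"
    have "smooth_ext (F q)" if "q \<in> P" for q
      unfolding F_def using that Suc.prems P
      by (intro smooth_ext_mult smooth_ext_power smooth_ext_sum smooth_ext_prod_list smooth_ext_square_form) auto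
    moreover have "bihomogeneous m m (F q x)" for q x
    proof -
      have "bihomogeneous (length (ps @ [q]) * 1 + l * 1) (length (ps @ [q]) * 1 + l * 1) (F q x)"
        unfolding F_def
        using bihomogeneous_prod_list[of "map (\<lambda>p. square_form (c p x)) (ps @ [q])" 1 1, unfolded length_map]
        by (intro bihomogeneous_mult bihomogeneous_power bihomogeneous_sum bihomogeneous_square_form)
          (auto intro: bihomogeneous_square_form simp del: One_nat_def)
      then show ?thesis using Suc.prems by simp
    qed
    ultimately have "T (sform (\<lambda>x. \<phi> x *\<^sub>R (\<Sum>q\<in>P. F q x))) = (\<Sum>q\<in>P. T (sform (\<lambda>x. \<phi> x *\<^sub>R F q x)))"
      using P(1) \<phi>(1) by (intro T_sum)
    moreover have "0 \<le> T (sform (\<lambda>x. \<phi> x *\<^sub>R F q x))" if "q \<in> P" for q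
      unfolding F_def using Suc.prems that by (intro Suc.IH) auto
    moreover have "(\<Sum>q\<in>P. F q x) = prod_list (map (\<lambda>p. square_form (c p x)) ps) *
        (\<Sum>p\<in>P. square_form (c p x)) ^ Suc l" for x
      by (simp add: F_def sum_distrib_left[symmetric] sum_distrib_right[symmetric] mult.assoc)
    ultimately show ?case by (simp add: sum_nonneg)
  qed
  from this[of "[]" m] show ?thesis by simp
qed

lemma positive_beta:
  assumes "open U" "test_fun U \<phi>" "\<And>x. 0 \<le> \<phi> x"
  shows "0 \<le> T (sform (\<lambda>x. \<phi> x *\<^sub>R beta ^ m))"
  unfolding beta_eq_sum_square_form
  using assms by (intro positive_power smooth_vec_const) auto

lemma test_field_beta: "test_fun U \<phi> \<Longrightarrow> test_field (\<lambda>x. \<phi> x *\<^sub>R beta ^ m)"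
  using bihomogeneous_power[OF bihomogeneous_beta, of m]
  by (intro test_superform_sform smooth_ext_const) auto

lemma test_field_radial: "test_fun U \<phi> \<Longrightarrow> test_field (\<lambda>x. \<phi> x *\<^sub>R (beta ^ (m - 1) * square_form x))"
  using bihomogeneous_mult[OF bihomogeneous_power[OF bihomogeneous_beta, of "m - 1"] bihomogeneous_square_form] m_pos
  by (intro test_superform_sform smooth_ext_const smooth_ext_mult smooth_ext_square_form smooth_vec_id) auto

text \<open>The power \<open>(|x|\<^sup>2 \<beta> - \<theta>)\<^bsup>m\<^esup>\<close>, where \<open>\<theta> = \<Sum> x\<^sub>k dx\<^sub>k \<and> \<Sum> x\<^sub>j d\<xi>\<^sub>j\<close> has square zero, is positive because
  by Lagrange's identity \<open>|x|\<^sup>2 \<beta> - \<theta>\<close> is a sum of squares of \<open>x\<^sub>i dx\<^sub>j - x\<^sub>j dx\<^sub>i\<close>.\<close>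

lemma radial_part_le:
  assumes U: "open U" and \<phi>: "test_fun U \<phi>" "\<And>x. 0 \<le> \<phi> x"
  shows "real m * T (sform (\<lambda>x. (\<phi> x * (x \<bullet> x) ^ (m - 1)) *\<^sub>R (beta ^ (m - 1) * square_form x))) \<le>
    T (sform (\<lambda>x. (\<phi> x * (x \<bullet> x) ^ m) *\<^sub>R beta ^ m))"
proof -
  obtain k where k: "m = Suc k" using m_pos by (cases m) auto
  have w: "smooth (\<lambda>x::real^'n::{finite,linorder}. x \<bullet> x)" using smooth_inner_diff[of 0] by simp
  let ?c = "\<lambda>(i, j) x::real^'n::{finite,linorder}. x $ i *\<^sub>R axis j 1 - x $ j *\<^sub>R axis i (1::real)"
  have "0 \<le> T (sform (\<lambda>x. \<phi> x *\<^sub>R (\<Sum>p\<in>UNIV. square_form (?c p x)) ^ m))"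
    using U \<phi> by (intro positive_power)
      (auto intro!: smooth_vec_diff smooth_vec_scale smooth_vec_const smooth_coord)
  also have "(\<lambda>x. \<phi> x *\<^sub>R (\<Sum>p\<in>UNIV. square_form (?c p x)) ^ m) =
     (\<lambda>x. 2 ^ m *\<^sub>R ((\<phi> x * (x \<bullet> x) ^ m) *\<^sub>R beta ^ m) +
        (- (2 ^ m * real m)) *\<^sub>R ((\<phi> x * (x \<bullet> x) ^ (m - 1)) *\<^sub>R (beta ^ (m - 1) * square_form x)))"
  proof
    fix x :: "real^'n::{finite,linorder}"
    have of_nat_mult: "of_nat n * a = real n *\<^sub>R a" for n and a :: "'n ext"
      by (simp add: scaleR_conv_of_real)
    have "(\<Sum>p\<in>UNIV. square_form (?c p x)) = (\<Sum>i\<in>UNIV. \<Sum>j\<in>UNIV. square_form (x $ i *\<^sub>R axis j 1 - x $ j *\<^sub>R axis i 1))"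
      unfolding sum.cartesian_product UNIV_Times_UNIV by (intro sum.cong) auto
    also have "\<dots> = 2 *\<^sub>R ((x \<bullet> x) *\<^sub>R beta - square_form x)"
      by (rule lagrange_identity)
    finally have "(\<Sum>p\<in>UNIV. square_form (?c p x)) ^ m =
        2 ^ m *\<^sub>R ((x \<bullet> x) *\<^sub>R beta - square_form x) ^ Suc k"
      by (simp only: k power_scaleR)
    also have "((x \<bullet> x) *\<^sub>R beta - square_form x) ^ Suc k =
        ((x \<bullet> x) *\<^sub>R beta) ^ Suc k - of_nat (Suc k) * (((x \<bullet> x) *\<^sub>R beta) ^ k * square_form x)"
      by (intro diff_power_nilpotent) (simp_all add: beta_commute_square_form square_form_square)
    also have "\<dots> = (x \<bullet> x) ^ m *\<^sub>R beta ^ m - (real m * (x \<bullet> x) ^ (m - 1)) *\<^sub>R (beta ^ (m - 1) * square_form x)"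
      by (simp only: power_scaleR k of_nat_mult mult_scaleR_left scaleR_scaleR diff_Suc_1)
    finally show "\<phi> x *\<^sub>R (\<Sum>p\<in>UNIV. square_form (?c p x)) ^ m =
      2 ^ m *\<^sub>R ((\<phi> x * (x \<bullet> x) ^ m) *\<^sub>R beta ^ m) +
        (- (2 ^ m * real m)) *\<^sub>R ((\<phi> x * (x \<bullet> x) ^ (m - 1)) *\<^sub>R (beta ^ (m - 1) * square_form x))"
      by (simp add: scaleR_diff_right mult_ac)
  qed
  also have "T (sform \<dots>) = 2 ^ m * T (sform (\<lambda>x. (\<phi> x * (x \<bullet> x) ^ m) *\<^sub>R beta ^ m)) +
      (- (2 ^ m * real m)) * T (sform (\<lambda>x. (\<phi> x * (x \<bullet> x) ^ (m - 1)) *\<^sub>R (beta ^ (m - 1) * square_form x)))"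
    by (intro T_combination test_field_beta test_field_radial test_fun_mult_left \<phi> smooth_power w)
  \<comment> \<open>The factor \<open>2 ^ m\<close> comes from the doubled sum in Lagrange's
    identity and cancels.\<close>
  finally have "2 ^ m * (real m * T (sform (\<lambda>x. (\<phi> x * (x \<bullet> x) ^ (m - 1)) *\<^sub>R (beta ^ (m - 1) * square_form x))))
      \<le> 2 ^ m * T (sform (\<lambda>x. (\<phi> x * (x \<bullet> x) ^ m) *\<^sub>R beta ^ m))"
    by (simp add: algebra_simps)
  then show ?thesis by (rule mult_left_le_imp_le) simp
qed

end

text \<open>By the definitions of \<open>sc_wedge\<close> and \<open>sc_d\<close>, minimality says
  that \<open>T\<close> kills d(beta^(m-1) wedge gamma sum x_j dxi_j), up to a sign that does not
  affect vanishing.\<close>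

lemma minimal_radial_identity:
  fixes T :: "'n::{finite,linorder} supercurrent"
  assumes T: "minimal_supercurrent U m T" and \<gamma>: "test_fun U \<gamma>"
    and \<kappa>: "\<And>x k. partial k \<gamma> x = \<kappa> x * x $ k"
  shows "T (sform (\<lambda>x. \<gamma> x *\<^sub>R beta ^ m + \<kappa> x *\<^sub>R (beta ^ (m - 1) * square_form x))) = 0"
proof -
  have "test_superform U 0 1 (sform (\<lambda>x. \<gamma> x *\<^sub>R dxi_form x))"
    by (intro test_superform_sform \<gamma> smooth_ext_dxi_form smooth_vec_id bihomogeneous_dxi_form)
  then have "sc_wedge (sc_d m m T) (sf_power sf_beta (m - 1)) (sform (\<lambda>x. \<gamma> x *\<^sub>R dxi_form x)) = 0"
    using T unfolding minimal_supercurrent_def sc_eq_def by blast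
  then have "T (sf_d (sform (\<lambda>x. beta ^ (m - 1) * (\<gamma> x *\<^sub>R dxi_form x)))) = 0"
    unfolding sc_wedge_def sc_d_def sform_beta sform_power sform_wedge by simp
  moreover have "dx k * beta ^ (m - 1) = beta ^ (m - 1) * dx k" for k :: 'n
    using power_commuting_commutes[OF beta_commute_dx_form[of "axis k 1"], of "m - 1"] by (simp add: dx_form_axis)
  moreover have "beta ^ (m - 1) * beta = (beta ^ m :: 'n ext)"
    using T by (metis minimal_supercurrent_def One_nat_def Suc_le_D diff_Suc_1 power_Suc2)
  ultimately show ?thesis
    using d_radial_form[OF test_fun_smooth[OF \<gamma>] \<kappa>, of "beta ^ (m - 1)"] by simp
qed

section \<open>Monotonicity\<close>

text \<open>Difference quotients along a sequence are bounded by \<open>h\<close> through the mean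
  value inequality on the convex set \<open>{a..b}\<close>, so dominated convergence
  applies.\<close>

lemma has_real_derivative_integral:
  fixes f f' :: "real \<Rightarrow> 'a \<Rightarrow> real"
  assumes deriv: "\<And>s x. s \<in> {a..b} \<Longrightarrow> ((\<lambda>s. f s x) has_real_derivative f' s x) (at s within {a..b})"
    and bound: "\<And>s x. s \<in> {a..b} \<Longrightarrow> \<bar>f' s x\<bar> \<le> h x"
    and h: "integrable M h" and f: "\<And>s. s \<in> {a..b} \<Longrightarrow> integrable M (f s)"
    and f': "f' t \<in> borel_measurable M" and t: "t \<in> {a..b}"
  shows "((\<lambda>s. \<integral>x. f s x \<partial>M) has_real_derivative (\<integral>x. f' t x \<partial>M)) (at t within {a..b})"
  unfolding has_field_derivative_iff tendsto_at_iff_sequentially comp_def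
proof (intro allI impI)
  fix X :: "nat \<Rightarrow> real" assume X: "\<forall>i. X i \<in> {a..b} - {t}" "X \<longlonglongrightarrow> t"
  have X_in: "X i \<in> {a..b}" "X i \<noteq> t" for i using X(1) by auto
  have "(\<lambda>i. \<integral>x. (f (X i) x - f t x) / (X i - t) \<partial>M) \<longlonglongrightarrow> (\<integral>x. f' t x \<partial>M)"
  proof (rule integral_dominated_convergence[where w=h])
    show "(\<lambda>x. (f (X i) x - f t x) / (X i - t)) \<in> borel_measurable M" for i
      using f[OF X_in(1)[of i]] f[OF t]
      by (intro borel_measurable_divide borel_measurable_diff borel_measurable_const borel_measurable_integrable)
    show "AE x in M. (\<lambda>i. (f (X i) x - f t x) / (X i - t)) \<longlonglongrightarrow> f' t x"
      using deriv[OF t] X unfolding has_field_derivative_iff tendsto_at_iff_sequentially comp_def by blast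
    show "AE x in M. norm ((f (X i) x - f t x) / (X i - t)) \<le> h x" for i
    proof (rule AE_I2)
      fix x
      have "norm (f (X i) x - f t x) \<le> h x * norm (X i - t)"
        using X_in(1)[of i] t deriv bound
        by (intro field_differentiable_bound[of "{a..b}" "\<lambda>s. f s x" "\<lambda>s. f' s x"]) auto
      then show "norm ((f (X i) x - f t x) / (X i - t)) \<le> h x"
        using X_in(2)[of i] by (simp add: divide_le_eq)
    qed
  qed (use h f' in auto)
  moreover have "(\<integral>x. (f (X i) x - f t x) / (X i - t) \<partial>M) = ((\<integral>x. f (X i) x \<partial>M) - (\<integral>x. f t x \<partial>M)) / (X i - t)" for i
    using f[OF X_in(1)[of i]] f[OF t] by simp
  ultimately show "(\<lambda>i. ((\<integral>x. f (X i) x \<partial>M) - (\<integral>x. f t x \<partial>M)) / (X i - t)) \<longlonglongrightarrow> (\<integral>x. f' t x \<partial>M)"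
    by (simp only:)
qed

text \<open>The descent from 1 to 0 takes place on [1 - 1/(j+1), 1], to the left of 1. The value at
  u = 1 is thus 0 for every \<open>j\<close>, so the limit is the indicator of the open ball and
  supports stay in the closed ball.\<close>

definition radial_cut :: "nat \<Rightarrow> real \<Rightarrow> real" where
  "radial_cut j u = 1 - step (1 + real (Suc j) * (u - 1))"

definition radial_cut_slope :: "nat \<Rightarrow> real \<Rightarrow> real" where
  "radial_cut_slope j u = real (Suc j) * step_deriv (1 + real (Suc j) * (u - 1))"

lemma radial_cut_has_derivative: "(radial_cut j has_real_derivative - radial_cut_slope j u) (at u)"
  unfolding radial_cut_def radial_cut_slope_def
  by (rule derivative_eq_intros DERIV_chain2[OF step_has_derivative] refl)+ simp

lemma smooth_radial_cut: "smooth f \<Longrightarrow> smooth (\<lambda>x. radial_cut j (f x))"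
  and smooth_radial_cut_slope: "smooth f \<Longrightarrow> smooth (\<lambda>x. radial_cut_slope j (f x))"
  unfolding radial_cut_def radial_cut_slope_def
  by (intro smooth_diff smooth_add smooth_mult smooth_step smooth_step_deriv smooth_const; assumption)+

lemma radial_cut_bounds: "0 \<le> radial_cut j u" "radial_cut j u \<le> 1"
  by (auto simp: radial_cut_def step_le_1 step_nonneg)

lemma radial_cut_eq_0: "u \<ge> 1 \<Longrightarrow> radial_cut j u = 0" and radial_cut_slope_eq_0: "u \<ge> 1 \<Longrightarrow> radial_cut_slope j u = 0"
  by (auto simp: radial_cut_def radial_cut_slope_def step_eq_1 step_deriv_eq_0)

lemma radial_cut_slope_nonneg: "0 \<le> radial_cut_slope j u"
  by (simp add: radial_cut_slope_def step_deriv_nonneg)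

lemma radial_cut_slope_bounded: obtains C where "C > 0" "\<And>u. radial_cut_slope j u \<le> C"
proof -
  have "compact (step_deriv ` {0..1})"
    by (intro compact_continuous_image continuous_step_deriv) auto
  then obtain C where C: "C > 0" "\<And>t. t \<in> {0..1} \<Longrightarrow> norm (step_deriv t) \<le> C"
    by (metis bounded_pos compact_imp_bounded image_eqI)
  have "step_deriv t \<le> C" for t
    using C(1) C(2)[of t] step_deriv_eq_0[of t] by (cases "t \<in> {0..1}") auto
  then have "radial_cut_slope j u \<le> real (Suc j) * C" for u
    unfolding radial_cut_slope_def by (intro mult_left_mono) auto
  then show thesis using C(1) by (intro that[of "real (Suc j) * C"]) auto
qed

lemma radial_cut_tendsto: "(\<lambda>j. radial_cut j u) \<longlonglongrightarrow> (if u < 1 then 1 else 0)"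
proof (cases "u < 1")
  case True
  obtain n where n: "1 / (1 - u) < real n" using reals_Archimedean2 by blast
  have "radial_cut j u = 1" if "j \<ge> n" for j
  proof -
    have "1 / (1 - u) < real (Suc j)" using n that by simp
    then have "1 < real (Suc j) * (1 - u)" using True by (simp add: divide_less_eq)
    then have "1 + real (Suc j) * (u - 1) \<le> 0" by (simp add: algebra_simps)
    then show ?thesis by (simp add: radial_cut_def step_eq_0 del: of_nat_Suc)
  qed
  then show ?thesis
    using True by (intro tendsto_eventually) (auto simp: eventually_sequentially)
qed (simp add: radial_cut_eq_0)

lemma mem_ball_iff_inner_power:
  fixes x :: "'a::real_inner"
  assumes "0 < r" "m \<ge> 1"
  shows "x \<in> ball 0 r \<longleftrightarrow> (x \<bullet> x) ^ m / (r ^ m)\<^sup>2 < 1"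
proof -
  have "(x \<bullet> x) ^ m = (norm x ^ (2 * m))"
    by (simp add: power_mult power2_norm_eq_inner)
  moreover have "(r ^ m)\<^sup>2 = r ^ (2 * m)"
    by (simp add: power_mult[symmetric] mult.commute)
  moreover have "norm x < r \<longleftrightarrow> norm x ^ (2 * m) < r ^ (2 * m)"
    using assms by (metis norm_ge_zero power_strict_mono power_less_imp_less_base less_imp_le mult_pos_pos pos2 zero_less_one less_le_trans)
  ultimately show ?thesis using assms(1) by simp
qed

lemma smooth_inner_power: "smooth (\<lambda>x::real^'n::finite. (x \<bullet> x) ^ m / c)"
  by (intro smooth_divide_const smooth_power smooth_inner_diff[of 0, unfolded diff_zero])

section \<open>The trace measure\<close>

context positive_supercurrent
begin

definition density :: "(real^'n::{finite,linorder} \<Rightarrow> real) \<Rightarrow> real" where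
  "density \<phi> = sc_wedge T (sf_scale (1 / fact m) (sf_power sf_beta m)) (sf_fun \<phi>)"

lemma density_eq:
  assumes "test_fun U \<phi>"
  shows "density \<phi> = 1 / fact m * T (sform (\<lambda>x. \<phi> x *\<^sub>R beta ^ m))"
proof -
  have "density \<phi> = T (sform (\<lambda>x. (1 / fact m) *\<^sub>R (\<phi> x *\<^sub>R beta ^ m) + 0 *\<^sub>R (\<phi> x *\<^sub>R beta ^ m)))"
    by (simp add: density_def sc_wedge_def sform_beta sform_power sform_scale sform_fun sform_wedge mult.commute)
  then show ?thesis
    by (simp only: T_combination[OF test_field_beta[OF assms] test_field_beta[OF assms]] mult_zero_left add_0_right)
qed

lemma positive_functional_density:
  assumes "open U"
  shows "positive_functional U density"
proof
  show "open U" by fact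
  show "density (\<lambda>x. \<phi> x + \<psi> x) = density \<phi> + density \<psi>" if t: "test_fun U \<phi>" "test_fun U \<psi>" for \<phi> \<psi>
    using T_combination[OF test_field_beta[OF t(1)] test_field_beta[OF t(2)], of 1 1] t
    by (simp add: density_eq test_fun_add scaleR_add_left distrib_left)
  show "density (\<lambda>x. c * \<phi> x) = c * density \<phi>" if t: "test_fun U \<phi>" for \<phi> c
    using T_combination[OF test_field_beta[OF t] test_field_beta[OF t], of c 0] t
    by (simp add: density_eq test_fun_scale)
  show "0 \<le> density \<phi>" if "test_fun U \<phi>" "\<And>x. 0 \<le> \<phi> x" for \<phi>
    using positive_beta[OF assms that] that by (simp add: density_eq)
qed

text \<open>The Riesz measure of \<open>density\<close> supplies existence; with uniqueness, the
  definite description in \<open>current_measure\<close> denotes a representing measure.\<close>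

lemma represents_current_trace_measure:
  assumes "open U"
  shows "represents_current U (current_measure U (sc_wedge T (sf_scale (1 / fact m) (sf_power sf_beta m))))
    (sc_wedge T (sf_scale (1 / fact m) (sf_power sf_beta m)))"
proof -
  interpret positive_functional U density by (rule positive_functional_density[OF assms])
  have "represents_current U riesz_measure (sc_wedge T (sf_scale (1 / fact m) (sf_power sf_beta m)))"
    unfolding represents_current_def
    using riesz_representation riesz_measure_compact
    by (auto simp: sets_riesz_measure riesz_measure_Compl test_superform_fun density_def[symmetric])
  then show ?thesis
    using represents_current_measure[OF assms] by blast
qed

end

text \<open>Testing minimality against \<open>\<gamma> \<Sum> x\<^sub>j d\<xi>\<^sub>j\<close> with \<open>\<gamma> = radial_cut j (|x|\<^bsup>2m\<^esup> / \<rho>\<^sup>2)\<close> gives the differential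
  inequality \<open>G \<le> \<rho> G'\<close> for \<open>G \<rho> = \<integral> radial_cut j (|x|\<^bsup>2m\<^esup> / \<rho>\<^sup>2) d\<mu>\<close>; here \<open>\<rho>\<close> stands for \<open>r\<^bsup>m\<^esup>\<close>.\<close>

lemma minimal_growth:
  fixes T :: "'n::{finite,linorder} supercurrent"
  assumes U: "open U" and T: "minimal_supercurrent U m T"
    and \<mu>: "represents_current U \<mu> (sc_wedge T (sf_scale (1 / fact m) (sf_power sf_beta m)))"
    and \<rho>: "\<rho> > 0" and K: "compact K" "K \<subseteq> U" "\<And>x. (x \<bullet> x) ^ m / \<rho>\<^sup>2 < 1 \<Longrightarrow> x \<in> K"
  shows "(\<integral>x. radial_cut j ((x \<bullet> x) ^ m / \<rho>\<^sup>2) \<partial>\<mu>) \<le>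
    (\<integral>x. 2 * ((x \<bullet> x) ^ m / \<rho>\<^sup>2) * radial_cut_slope j ((x \<bullet> x) ^ m / \<rho>\<^sup>2) \<partial>\<mu>)"
proof -
  interpret positive_supercurrent U m T
    using T by unfold_locales (auto simp: minimal_supercurrent_def)
  define w where "w = (\<lambda>x::real^'n::{finite,linorder}. (x \<bullet> x) ^ m / \<rho>\<^sup>2)"
  define \<gamma> where "\<gamma> = (\<lambda>x. radial_cut j (w x))"
  define \<phi> where "\<phi> = (\<lambda>x. radial_cut_slope j (w x))"
  \<comment> \<open>The chain rule gives d_k gamma = - phi 2 m |x|^(2m-2) x_k / rho^2, where
    \<open>\<phi>\<close> is the profile's slope with its sign reversed.\<close>
  define \<kappa> where "\<kappa> = (\<lambda>x. - (2 * real m / \<rho>\<^sup>2) * (\<phi> x * (x \<bullet> x) ^ (m - 1)))"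
  have w: "smooth w" unfolding w_def by (rule smooth_inner_power)
  have out: "w x \<ge> 1" if "x \<notin> K" for x
    using K(3)[of x] that unfolding w_def by (meson not_less)
  have \<gamma>: "test_fun U \<gamma>" and \<phi>: "test_fun U \<phi>"
    unfolding test_fun_def \<gamma>_def \<phi>_def using K out
    by (auto intro!: smooth_radial_cut smooth_radial_cut_slope w exI[of _ K] radial_cut_eq_0 radial_cut_slope_eq_0)
  have "partial k \<gamma> x = \<kappa> x * x $ k" for k x
  proof -
    have "((\<lambda>x. (x \<bullet> x) ^ m) has_derivative (\<lambda>h. real m * (2 * (x \<bullet> h)) * (x \<bullet> x) ^ (m - 1))) (at x)"
      by (auto intro!: derivative_eq_intros simp: inner_commute fun_eq_iff)
    from has_derivative_mult_left[OF this, of "1 / \<rho>\<^sup>2"]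
    have "(w has_derivative (\<lambda>h. real m * (2 * (x \<bullet> h)) * (x \<bullet> x) ^ (m - 1) / \<rho>\<^sup>2)) (at x)"
      by (simp add: w_def)
    from partial_eq[OF DERIV_compose_FDERIV[OF radial_cut_has_derivative[of j "w x"] this], of k]
    show ?thesis
      by (simp add: \<gamma>_def \<kappa>_def \<phi>_def inner_axis)
  qed
  from minimal_radial_identity[OF T \<gamma> this]
  have "T (sform (\<lambda>x. \<gamma> x *\<^sub>R beta ^ m + \<kappa> x *\<^sub>R (beta ^ (m - 1) * square_form x))) = 0" .
  moreover have "(\<lambda>x. \<gamma> x *\<^sub>R beta ^ m + \<kappa> x *\<^sub>R (beta ^ (m - 1) * square_form x)) =
      (\<lambda>x. 1 *\<^sub>R (\<gamma> x *\<^sub>R beta ^ m) +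
        (- (2 * real m / \<rho>\<^sup>2)) *\<^sub>R ((\<phi> x * (x \<bullet> x) ^ (m - 1)) *\<^sub>R (beta ^ (m - 1) * square_form x)))"
    by (simp add: \<kappa>_def fun_eq_iff)
  moreover have "smooth (\<lambda>x::real^'n::{finite,linorder}. (x \<bullet> x) ^ k)" for k
    using smooth_inner_power[of k 1] by simp
  then have t: "test_fun U (\<lambda>x. \<phi> x * (x \<bullet> x) ^ k)" for k
    by (intro test_fun_mult_left \<phi>)
  ultimately have "T (sform (\<lambda>x. \<gamma> x *\<^sub>R beta ^ m)) = 2 / \<rho>\<^sup>2 *
      (real m * T (sform (\<lambda>x. (\<phi> x * (x \<bullet> x) ^ (m - 1)) *\<^sub>R (beta ^ (m - 1) * square_form x))))"
    using T_combination[OF test_field_beta[OF \<gamma>] test_field_radial[OF t], of 1 "- (2 * real m / \<rho>\<^sup>2)" "m - 1"]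
    by simp
  \<comment> \<open>The weight w^(m-1) left by the chain rule is exactly the one in
    \<open>radial_part_le\<close>, and the factor m is absorbed there.\<close>
  also have "\<dots> \<le> 2 / \<rho>\<^sup>2 * T (sform (\<lambda>x. (\<phi> x * (x \<bullet> x) ^ m) *\<^sub>R beta ^ m))"
    using radial_part_le[OF U \<phi>] \<rho> by (intro mult_left_mono) (auto simp: \<phi>_def radial_cut_slope_nonneg)
  finally have "density \<gamma> \<le> 2 / \<rho>\<^sup>2 * density (\<lambda>x. \<phi> x * (x \<bullet> x) ^ m)"
    unfolding density_eq[OF \<gamma>] density_eq[OF t]
    by (simp add: field_simps)
  moreover have "density f = (\<integral>x. f x \<partial>\<mu>)" if "test_fun U f" for f
    using \<mu> that unfolding represents_current_def density_def test_superform_fun by blast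
  ultimately have "(\<integral>x. \<gamma> x \<partial>\<mu>) \<le> 2 / \<rho>\<^sup>2 * (\<integral>x. \<phi> x * (x \<bullet> x) ^ m \<partial>\<mu>)"
    using \<gamma> t by simp
  also have "\<dots> = (\<integral>x. 2 / \<rho>\<^sup>2 * (\<phi> x * (x \<bullet> x) ^ m) \<partial>\<mu>)" by simp
  also have "(\<lambda>x. 2 / \<rho>\<^sup>2 * (\<phi> x * (x \<bullet> x) ^ m)) = (\<lambda>x. 2 * w x * radial_cut_slope j (w x))"
    by (simp add: \<phi>_def w_def fun_eq_iff)
  finally show ?thesis
    by (simp only: \<gamma>_def w_def)
qed

text \<open>The quotient G/rho has derivative (rho G' - G)/rho^2, nonnegative by
  \<open>minimal_growth\<close>; the mean value theorem on [s^m, t^m] concludes.\<close>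

lemma minimal_radial_cut_monotone:
  fixes T :: "'n::{finite,linorder} supercurrent"
  assumes U: "open U" and T: "minimal_supercurrent U m T"
    and \<mu>: "represents_current U \<mu> (sc_wedge T (sf_scale (1 / fact m) (sf_power sf_beta m)))"
    and st: "0 < s" "s < t" "cball 0 t \<subseteq> U"
  shows "(\<integral>x. radial_cut j ((x \<bullet> x) ^ m / (s ^ m)\<^sup>2) \<partial>\<mu>) / s ^ m \<le> (\<integral>x. radial_cut j ((x \<bullet> x) ^ m / (t ^ m)\<^sup>2) \<partial>\<mu>) / t ^ m"
proof -
  have m: "m \<ge> 1" using T by (simp add: minimal_supercurrent_def)
  define a b where "a = s ^ m" and "b = t ^ m"
  have ab: "0 < a" "a < b" unfolding a_def b_def using st m by (auto intro!: power_strict_mono)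
  define f where "f = (\<lambda>\<rho> x::real^'n::{finite,linorder}. radial_cut j ((x \<bullet> x) ^ m / \<rho>\<^sup>2))"
  \<comment> \<open>The derivative in rho: with u = |x|^(2m) / rho^2 one has du/drho = -2u/rho, and
    the minus sign cancels that of the decreasing profile.\<close>
  define f' where "f' = (\<lambda>\<rho> x::real^'n::{finite,linorder}.
    2 * ((x \<bullet> x) ^ m / \<rho>\<^sup>2) * radial_cut_slope j ((x \<bullet> x) ^ m / \<rho>\<^sup>2) / \<rho>)"
  have sets: "sets \<mu> = sets borel" and fin: "\<And>K. compact K \<Longrightarrow> K \<subseteq> U \<Longrightarrow> emeasure \<mu> K < \<infinity>"
    using \<mu> by (auto simp: represents_current_def)
  have inside: "x \<in> cball 0 t" if "\<rho> \<in> {a..b}" "(x \<bullet> x) ^ m / \<rho>\<^sup>2 < 1" for \<rho> and x :: "real^'n::{finite,linorder}"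
  proof -
    have "(x \<bullet> x) ^ m < \<rho>\<^sup>2" using that ab by (auto simp: divide_less_eq split: if_splits)
    also have "\<rho>\<^sup>2 \<le> b\<^sup>2" using that ab by (intro power_mono) auto
    finally have "x \<in> ball 0 t"
      using ab mem_ball_iff_inner_power[of t m x] st m by (simp add: b_def)
    then show ?thesis by auto
  qed
  have smooth_f: "smooth (f \<rho>)" "smooth (f' \<rho>)" for \<rho>
    unfolding f_def f'_def
    by (intro smooth_radial_cut smooth_divide_const smooth_mult smooth_const smooth_radial_cut_slope smooth_inner_power)+
  have zero: "f \<rho> x = 0" if "\<rho> \<in> {a..b}" "x \<notin> cball 0 t" for \<rho> x
    unfolding f_def using inside[OF that(1), of x] that(2) by (intro radial_cut_eq_0) (meson not_less)
  have tf: "test_fun U (f \<rho>)" if "\<rho> \<in> {a..b}" for \<rho>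
    unfolding test_fun_def using smooth_f zero[OF that] st(3) by (auto intro!: exI[of _ "cball 0 t"])
  obtain C where C: "C > 0" "\<And>u. radial_cut_slope j u \<le> C" using radial_cut_slope_bounded by metis
  \<comment> \<open>Where \<open>f'\<close> is nonzero, u < 1, the slope is at most \<open>C\<close>
    and 1/rho <= 1/a, hence the constant 2C/a on the ball.\<close>
  define h where "h = (\<lambda>x::real^'n::{finite,linorder}. 2 * C / a * indicator (cball 0 t) x)"
  have h: "integrable \<mu> h"
    unfolding h_def using fin[of "cball 0 t"] st(3) sets
    by (intro integrable_mult_right integrable_real_indicator) auto
  have bound: "\<bar>f' \<rho> x\<bar> \<le> h x" if \<rho>: "\<rho> \<in> {a..b}" for \<rho> x
  proof (cases "(x \<bullet> x) ^ m / \<rho>\<^sup>2 < 1")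
    case True
    have "2 * ((x \<bullet> x) ^ m / \<rho>\<^sup>2) * radial_cut_slope j ((x \<bullet> x) ^ m / \<rho>\<^sup>2) \<le> 2 * 1 * C"
      using True C by (intro mult_mono) (auto simp: radial_cut_slope_nonneg)
    then have "f' \<rho> x \<le> 2 * C / a"
      unfolding f'_def using \<rho> ab C by (intro frac_le) auto
    moreover have "0 \<le> f' \<rho> x"
      unfolding f'_def using \<rho> ab by (auto simp: radial_cut_slope_nonneg)
    ultimately show ?thesis using inside[OF \<rho> True] by (simp add: h_def)
  next
    case False
    then show ?thesis using C ab by (simp add: f'_def radial_cut_slope_eq_0 h_def)
  qed
  have deriv: "((\<lambda>\<rho>. f \<rho> x) has_real_derivative f' \<rho> x) (at \<rho> within {a..b})" if "\<rho> \<in> {a..b}" for \<rho> x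
  proof -
    have "\<rho> > 0" using that ab by simp
    then have "((\<lambda>\<rho>. (x \<bullet> x) ^ m / \<rho>\<^sup>2) has_real_derivative - (2 * ((x \<bullet> x) ^ m / \<rho>\<^sup>2) / \<rho>)) (at \<rho>)"
      by (auto intro!: derivative_eq_intros simp: field_simps power2_eq_square)
    from DERIV_chain2[OF radial_cut_has_derivative this, of j]
    have "((\<lambda>\<rho>. f \<rho> x) has_real_derivative f' \<rho> x) (at \<rho>)"
      unfolding f_def f'_def by (simp add: mult_ac)
    then show ?thesis by (rule has_field_derivative_at_within)
  qed
  define G where "G = (\<lambda>\<rho>. \<integral>x. f \<rho> x \<partial>\<mu>)"
  define G' where "G' = (\<lambda>\<rho>. \<integral>x. f' \<rho> x \<partial>\<mu>)"
  have G: "(G has_real_derivative G' \<rho>) (at \<rho> within {a..b})" if "\<rho> \<in> {a..b}" for \<rho>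
    unfolding G_def G'_def
  proof (rule has_real_derivative_integral[OF deriv bound h _ _ that])
    show "integrable \<mu> (f \<rho>)" if "\<rho> \<in> {a..b}" for \<rho>
      by (rule test_fun_integrable[OF sets fin tf[OF that]])
    show "f' \<rho> \<in> borel_measurable \<mu>"
      using borel_measurable_continuous_onI[OF smooth_continuous[OF smooth_f(2)]]
      by (simp add: measurable_cong_sets[OF sets refl])
  qed
  have grow: "0 \<le> (G' \<rho> * \<rho> - G \<rho>) / \<rho>\<^sup>2" if \<rho>: "\<rho> \<in> {a..b}" for \<rho>
  proof -
    have "\<rho> > 0" using \<rho> ab by simp
    then have "f' \<rho> x * \<rho> = 2 * ((x \<bullet> x) ^ m / \<rho>\<^sup>2) * radial_cut_slope j ((x \<bullet> x) ^ m / \<rho>\<^sup>2)" for x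
      by (simp add: f'_def)
    moreover have "G' \<rho> * \<rho> = (\<integral>x. f' \<rho> x * \<rho> \<partial>\<mu>)" by (simp add: G'_def)
    ultimately show ?thesis
      using minimal_growth[OF U T \<mu> \<open>\<rho> > 0\<close> compact_cball st(3) inside[OF \<rho>], of j]
      by (simp add: G_def f_def)
  qed
  have "((\<lambda>\<rho>. G \<rho> / \<rho>) has_derivative (\<lambda>h. (G' \<rho> * \<rho> - G \<rho>) / \<rho>\<^sup>2 * h)) (at \<rho> within {a..b})"
    if "a \<le> \<rho>" "\<rho> \<le> b" for \<rho>
  proof -
    have "((\<lambda>\<rho>. G \<rho> / \<rho>) has_real_derivative (G' \<rho> * \<rho> - G \<rho> * 1) / (\<rho> * \<rho>)) (at \<rho> within {a..b})"
      using that ab G[of \<rho>] by (intro DERIV_divide DERIV_ident) auto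
    then show ?thesis
      by (simp only: has_field_derivative_def power2_eq_square mult_1_right)
  qed
  from mvt_simple[OF ab(2) this] obtain \<rho> where "\<rho> \<in> {a<..<b}"
    "G b / b - G a / a = (G' \<rho> * \<rho> - G \<rho>) / \<rho>\<^sup>2 * (b - a)" by auto
  then have "0 \<le> G b / b - G a / a"
    using mult_nonneg_nonneg[OF grow[of \<rho>], of "b - a"] ab by simp
  then show ?thesis by (simp add: G_def f_def a_def b_def)
qed

text \<open>All the cuts vanish off the open ball and are at most 1, so the indicator of the closed
  ball, of finite mass, dominates them.\<close>

lemma radial_cut_integral_tendsto:
  fixes \<mu> :: "(real^'n::finite) measure"
  assumes \<mu>: "sets \<mu> = sets borel" "emeasure \<mu> (cball 0 r) < \<infinity>" and r: "0 < r" "m \<ge> 1"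
  shows "(\<lambda>j. \<integral>x. radial_cut j ((x \<bullet> x) ^ m / (r ^ m)\<^sup>2) \<partial>\<mu>) \<longlonglongrightarrow> measure \<mu> (ball 0 r)"
proof -
  have b: "x \<in> ball 0 r \<longleftrightarrow> (x \<bullet> x) ^ m / (r ^ m)\<^sup>2 < 1" for x :: "real^'n"
    by (rule mem_ball_iff_inner_power[OF r])
  have "(\<lambda>j. \<integral>x. radial_cut j ((x \<bullet> x) ^ m / (r ^ m)\<^sup>2) \<partial>\<mu>) \<longlonglongrightarrow> (\<integral>x. indicator (ball 0 r) x \<partial>\<mu>)"
  proof (rule integral_dominated_convergence[where w="indicator (cball 0 r)"])
    show "indicator (ball 0 r) \<in> borel_measurable \<mu>"
      using \<mu>(1) by (intro borel_measurable_indicator) auto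
    show "integrable \<mu> (indicator (cball 0 r) :: _ \<Rightarrow> real)"
      using \<mu> by (intro integrable_real_indicator) auto
    show "(\<lambda>x. radial_cut j ((x \<bullet> x) ^ m / (r ^ m)\<^sup>2)) \<in> borel_measurable \<mu>" for j
      using borel_measurable_continuous_onI[OF smooth_continuous[OF smooth_radial_cut[OF smooth_inner_power]]]
      by (simp add: measurable_cong_sets[OF \<mu>(1) refl])
    show "AE x in \<mu>. (\<lambda>j. radial_cut j ((x \<bullet> x) ^ m / (r ^ m)\<^sup>2)) \<longlonglongrightarrow> indicator (ball 0 r) x"
      using radial_cut_tendsto by (intro AE_I2) (simp only: indicator_def b of_bool_def)
    show "AE x in \<mu>. norm (radial_cut j ((x \<bullet> x) ^ m / (r ^ m)\<^sup>2)) \<le> indicator (cball 0 r) x" for j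
    proof (rule AE_I2)
      fix x :: "real^'n"
      have "radial_cut j ((x \<bullet> x) ^ m / (r ^ m)\<^sup>2) = 0" if "x \<notin> ball 0 r"
        using that unfolding b by (intro radial_cut_eq_0) simp
      then show "norm (radial_cut j ((x \<bullet> x) ^ m / (r ^ m)\<^sup>2)) \<le> indicator (cball 0 r) x"
        using radial_cut_bounds[of j "(x \<bullet> x) ^ m / (r ^ m)\<^sup>2"] by (cases "x \<in> ball 0 r") (auto simp: indicator_def)
    qed
  qed
  moreover have "ball 0 r \<in> sets \<mu>" using \<mu>(1) by simp
  ultimately show ?thesis by simp
qed

theorem theorem6p2:
  fixes T :: "'n::{finite,linorder} supercurrent" and U :: "(real^'n::{finite,linorder}) set" and m :: nat
  assumes "open U" and "0 \<in> U"
    and "minimal_supercurrent U m T"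
  shows "mono_on {r::real. 0 < r \<and> compact (closure (ball (0::real^'n::{finite,linorder}) r)) \<and> closure (ball (0::real^'n::{finite,linorder}) r) \<subseteq> U}
           (\<lambda>r. r powi (- int m) *
                measure (current_measure U (sc_wedge T (sf_scale (1 / fact m) (sf_power sf_beta m)))) (ball 0 r))"
proof (rule mono_onI)
  define \<mu> where "\<mu> = current_measure U (sc_wedge T (sf_scale (1 / fact m) (sf_power sf_beta m)))"
  interpret positive_supercurrent U m T
    using assms(3) by unfold_locales (auto simp: minimal_supercurrent_def)
  have \<mu>: "represents_current U \<mu> (sc_wedge T (sf_scale (1 / fact m) (sf_power sf_beta m)))"
    unfolding \<mu>_def by (rule represents_current_trace_measure[OF assms(1)])
  let ?R = "{r::real. 0 < r \<and> compact (closure (ball (0::real^'n::{finite,linorder}) r)) \<and>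
    closure (ball (0::real^'n::{finite,linorder}) r) \<subseteq> U}"
  fix s t :: real
  assume "s \<in> ?R"
    and "t \<in> ?R" and "s \<le> t"
  then have st: "0 < s" "0 < t" "cball 0 s \<subseteq> U" "cball 0 t \<subseteq> U" by auto
  have lim: "(\<lambda>j. (\<integral>x. radial_cut j ((x \<bullet> x) ^ m / (r ^ m)\<^sup>2) \<partial>\<mu>) / r ^ m) \<longlonglongrightarrow> measure \<mu> (ball 0 r) / r ^ m"
    if "0 < r" "cball 0 r \<subseteq> U" for r
    using \<mu> that m_pos by (intro tendsto_divide tendsto_const radial_cut_integral_tendsto) (auto simp: represents_current_def)
  have "measure \<mu> (ball 0 s) / s ^ m \<le> measure \<mu> (ball 0 t) / t ^ m"
  \<comment> \<open>Monotonicity of the cut integrals needs s < t; equal radii are trivial, and the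
    strict case follows by letting \<open>j\<close> tend to infinity at both radii.\<close>
  proof (cases "s = t")
    case False
    then show ?thesis
      using \<open>s \<le> t\<close> st
      by (intro LIMSEQ_le[OF lim lim]) (auto intro!: exI[of _ 0] minimal_radial_cut_monotone[OF assms(1,3) \<mu>])
  qed simp
  then show "s powi (- int m) * measure (current_measure U (sc_wedge T (sf_scale (1 / fact m) (sf_power sf_beta m)))) (ball 0 s)
      \<le> t powi (- int m) * measure (current_measure U (sc_wedge T (sf_scale (1 / fact m) (sf_power sf_beta m)))) (ball 0 t)"
    by (simp add: \<mu>_def power_int_minus divide_inverse mult.commute)
qed

end
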